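(* Fix $\alpha\in[0,\tfrac12)$ and, for each $n$, let $\mu_n\vdash n$ be a partition of $n$ with at most $n^\alpha$ parts. Let $V_{\mu_n}$ be the number of vertices of $S(\sigma,\tau)$ for $(\sigma,\tau)$ chosen uniformly at random from $\mathcal{K}_{\mu_n}\times S_n$. Let $p(x)$ be a polynomial of degree $l$ such that $p(x)$ is non-decreasing and $p(x)\ge 0$ for $x\ge0$. Then for any $\epsilon>0$ such that $\alpha+\epsilon<\tfrac12$, as $n\to\infty$, $$\mathbb{E}[p(V_{\mu_n})]=\mathbb{E}[p(C_n)]+O\left(\frac{\log^l(n)}{n^{1-2\alpha-2\epsilon}}\right)=p(\log(n))+O(\log(n)^{l-1})+O\left(\frac{\log^l(n)}{n^{1-2\alpha-2\epsilon}}\right),$$ where $C_n$ is the number of cycles of a uniformly random permutation chosen from the alternating group $A_n$.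
   Context: $S_n$ is the symmetric group on $\{1,\dots,n\}$; $\mathcal{K}_{\mu_n}$ is the conjugacy class of $S_n$ of permutations with cycle type $\mu_n$. The number of cycles of a permutation includes fixed points ($1$-cycles). For $\sigma,\tau\in S_n$, $S(\sigma,\tau)$ is the (not necessarily connected) square-tiled surface built from $n$ axis-parallel unit squares labelled $1,\dots,n$, where the right side of square $j$ is glued by translation to the left side of square $\sigma(j)$ and the top side of square $j$ is glued by translation to the bottom side of square $\tau(j)$. Its vertices are the points of the surface coming from the corners of the squares; their number equals the number of cycles of the commutator $[\sigma,\tau]=\sigma\tau\sigma^{-1}\tau^{-1}$. *)

theory Defs
  imports
    "HOL-Probability.Probability"
    "HOL-Library.Landau_Symbols"
    "HOL-Library.Multiset"
    "HOL-Computational_Algebra.Polynomial"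
    "HOL-Combinatorics.Orbits"
    "HOL-Algebra.Sym_Groups"
begin

section \<open>Partitions and cycle types\<close>

definition is_partition_of :: "nat multiset \<Rightarrow> nat \<Rightarrow> bool" where
  "is_partition_of \<mu> n \<longleftrightarrow> 0 \<notin># \<mu> \<and> sum_mset \<mu> = n"

text \<open>The orbit of a fixed point \<open>i\<close> is \<open>{i}\<close>, so fixed points count as cycles.\<close>

definition cycles_of :: "nat \<Rightarrow> (nat \<Rightarrow> nat) \<Rightarrow> nat set set" where
  "cycles_of n \<sigma> = orbit \<sigma> ` {1..n}"

definition cycle_type :: "nat \<Rightarrow> (nat \<Rightarrow> nat) \<Rightarrow> nat multiset" where
  "cycle_type n \<sigma> = image_mset card (mset_set (cycles_of n \<sigma>))"

definition conj_class :: "nat \<Rightarrow> nat multiset \<Rightarrow> (nat \<Rightarrow> nat) set" where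
  "conj_class n \<mu> = {\<sigma> \<in> carrier (sym_group n). cycle_type n \<sigma> = \<mu>}"


section \<open>Square-tiled surfaces\<close>

text \<open>The point \<open>(j, x, y)\<close> is the point with coordinates \<open>(x, y)\<close> of the closed unit square
  labelled \<open>j\<close>, with \<open>(0, 0)\<close> the bottom left corner.\<close>

definition squares :: "nat \<Rightarrow> (nat \<times> real \<times> real) set" where
  "squares n = {1..n} \<times> {0..1} \<times> {0..1}"

inductive side_glued ::
  "nat \<Rightarrow> (nat \<Rightarrow> nat) \<Rightarrow> (nat \<Rightarrow> nat) \<Rightarrow> nat \<times> real \<times> real \<Rightarrow> nat \<times> real \<times> real \<Rightarrow> bool"
  for n \<sigma> \<tau> where
  right_left: "j \<in> {1..n} \<Longrightarrow> y \<in> {0..1} \<Longrightarrow> side_glued n \<sigma> \<tau> (j, 1, y) (\<sigma> j, 0, y)"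
| top_bottom: "j \<in> {1..n} \<Longrightarrow> x \<in> {0..1} \<Longrightarrow> side_glued n \<sigma> \<tau> (j, x, 1) (\<tau> j, x, 0)"

definition gluing ::
  "nat \<Rightarrow> (nat \<Rightarrow> nat) \<Rightarrow> (nat \<Rightarrow> nat) \<Rightarrow> ((nat \<times> real \<times> real) \<times> (nat \<times> real \<times> real)) set" where
  "gluing n \<sigma> \<tau> = {(P, Q). P \<in> squares n \<and> Q \<in> squares n \<and> equivclp (side_glued n \<sigma> \<tau>) P Q}"

lemma equiv_gluing: "equiv (squares n) (gluing n \<sigma> \<tau>)"
proof (rule equivI)
  show "refl_on (squares n) (gluing n \<sigma> \<tau>)"
    by (auto simp: refl_on_def gluing_def)
  show "sym (gluing n \<sigma> \<tau>)"
    by (auto simp: sym_def gluing_def intro: equivclp_sym)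
  show "trans (gluing n \<sigma> \<tau>)"
    by (auto simp: trans_def gluing_def intro: equivclp_trans)
  show "gluing n \<sigma> \<tau> \<subseteq> squares n \<times> squares n"
    by (auto simp: gluing_def)
qed

text \<open>The points of \<open>S(\<sigma>, \<tau>)\<close>. Its topology and flat structure play no role in counting vertices.\<close>

definition square_tiled_surface ::
  "nat \<Rightarrow> (nat \<Rightarrow> nat) \<Rightarrow> (nat \<Rightarrow> nat) \<Rightarrow> (nat \<times> real \<times> real) set set" where
  "square_tiled_surface n \<sigma> \<tau> = squares n // gluing n \<sigma> \<tau>"

definition vertices ::
  "nat \<Rightarrow> (nat \<Rightarrow> nat) \<Rightarrow> (nat \<Rightarrow> nat) \<Rightarrow> (nat \<times> real \<times> real) set set" where
  "vertices n \<sigma> \<tau> = {v \<in> square_tiled_surface n \<sigma> \<tau>. v \<inter> ({1..n} \<times> {0, 1} \<times> {0, 1}) \<noteq> {}}"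


section \<open>The random variables\<close>

definition num_vertices_pmf :: "nat \<Rightarrow> nat multiset \<Rightarrow> nat pmf" where
  "num_vertices_pmf n \<mu> =
     map_pmf (\<lambda>(\<sigma>, \<tau>). card (vertices n \<sigma> \<tau>))
       (pmf_of_set (conj_class n \<mu> \<times> carrier (sym_group n)))"

definition num_cycles_alt_pmf :: "nat \<Rightarrow> nat pmf" where
  "num_cycles_alt_pmf n = map_pmf (\<lambda>\<pi>. card (cycles_of n \<pi>)) (pmf_of_set (carrier (alt_group n)))"

end

theory Submission
  imports Defs "HOL-Combinatorics.Multiset_Permutations" "HOL-Real_Asymp.Real_Asymp"
    "HOL-Computational_Algebra.Computational_Algebra"
begin

text \<open>Encode a random number of cycles \<open>C\<close> by the polynomial \<open>E[(1 + X)^C]\<close>, whose coefficient at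
  \<open>X^j\<close> is \<open>E[C choose j]\<close>. Any polynomial \<open>p\<close> of degree \<open>l\<close> is a combination of the
  \<open>v choose j\<close> with \<open>j \<le> l\<close>, so it is enough to compare the first \<open>l + 1\<close> coefficients of
  three polynomials: the one for \<open>V\<close>, the one for a uniform element of \<open>A_n\<close>, and
  \<open>U n = (1 + X/1)(1 + X/2) \<cdots> (1 + X/n)\<close>, which belongs to a uniform element of \<open>S_n\<close>. They
  are compared in the norm \<open>\<Sum>j. \<bar>coeff j\<bar> * z^j\<close> (\<open>coeff_norm\<close>) with \<open>z = 1 / ln n\<close>: an error
  \<open>\<delta>\<close> in this norm costs \<open>\<delta> * (ln n)^l\<close> in the expectation, which is the shape of the error
  term of the theorem.

  The vertices of the surface are the cycles of \<open>\<sigma> \<tau> \<sigma>\<^sup>-\<^sup>1 \<tau>\<^sup>-\<^sup>1\<close> (\<open>card_vertices\<close>).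
  Conjugation by \<open>\<tau>\<close> turns this permutation into \<open>\<rho> \<beta>\<close>, where \<open>\<beta> = \<sigma>\<^sup>-\<^sup>1\<close> is fixed and \<open>\<rho>\<close> is
  uniform in the conjugacy class of \<open>\<sigma>\<close>. Now \<open>\<rho>\<close> is revealed one point at a time: its current
  cycle is multiplied out as transpositions \<open>(x w)\<close>, and after each of them the point \<open>w\<close> is
  erased. Erasing a point costs a factor \<open>1 + X\<close> if it is fixed and does not change the number
  of cycles otherwise; multiplying by \<open>(x w)\<close> splits the cycle of \<open>x\<close> if \<open>w\<close> lies in it, and
  merges two cycles if not. Since \<open>w\<close> is uniform among the remaining points, the average
  depends only on the cycle lengths of \<open>\<beta>\<close>, and it obeys the recursion \<open>type_avg\<close>
  (\<open>sum_commutator_cycles\<close>).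

  It remains to show that \<open>type_avg\<close> is close to \<open>U n\<close>, by induction on the number of cycles
  of \<open>\<rho>\<close>, smallest cycles outermost (\<open>type_avg_near_U\<close>). If \<open>\<rho>\<close> is one long cycle, the average
  has a closed form: a signed sum of shifted binomial polynomials indexed by the sums of sets
  of cycle lengths of \<open>\<beta>\<close> (\<open>cycle_avg_full_formula\<close>). The empty set gives essentially \<open>U n\<close>;
  all other terms are small because a multiset of sum \<open>m\<close> has, relative to \<open>m choose s\<close>, few
  submultisets of sum \<open>s\<close> (\<open>subset_sum_poly_bound_interior\<close>). In the induction step a cycle of
  length \<open>a \<le> m / 2\<close> is revealed on \<open>m\<close> points. Starting from \<open>U (m - a)\<close> the recursion
  produces \<open>U m\<close> up to an error of order \<open>(2 + F) / m\<close>, with \<open>F\<close> the number of fixed points of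
  \<open>\<beta>\<close> (\<open>average_cycle_avg_U_near_U\<close>), and the error left by the other cycles is carried along
  with a bounded loss (\<open>cycle_avg_propagates\<close>). Since the cycles are sorted, the \<open>i\<close>-th
  largest one is revealed on at least \<open>i n / k\<close> points, with \<open>k \<le> n powr \<alpha>\<close> the number of
  cycles. Hence the errors \<open>1 / m\<close> add up to \<open>harm k * k / n\<close>. The dependence on fixed points
  costs another factor \<open>n powr \<alpha>\<close>, up to logarithms, and the total is
  \<open>O(n powr (2 \<alpha>) * (ln n)^2 / n)\<close> (\<open>type_avg_U_distance\<close>).

  Passing from \<open>S_n\<close> to \<open>A_n\<close> adds the sign-weighted sum
  \<open>(X + 1) X (X - 1) \<cdots> (X + 2 - n) / n!\<close>, which is of size \<open>O(1 / n)\<close>. Finally the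
  coefficients of \<open>U n\<close> are the elementary symmetric functions of \<open>1, 1/2, \<dots>, 1/n\<close>, and
  Newton's identities with \<open>harm n = ln n + O(1)\<close> and \<open>\<Sum>i. 1 / i^2 = O(1)\<close> show that the
  \<open>j\<close>-th one is \<open>ln n gchoose j\<close> up to \<open>O((ln n)^(j - 1))\<close> (\<open>coeff_U_near_binomial\<close>).\<close>

(* From here on inv is the inverse of a function. *)
unbundle no m_inv_syntax

section \<open>Listing the cycles of a permutation\<close>

text \<open>The cycles of \<open>\<pi>\<close> on \<open>R\<close>, each listed in the order in which \<open>\<pi>\<close> runs through it. Working
  with lists makes the effect of a transposition on a cycle a statement about cutting and
  joining lists.\<close>

definition cycle_rep :: "('a \<Rightarrow> 'a) \<Rightarrow> 'a set \<Rightarrow> 'a list list \<Rightarrow> bool" where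
  "cycle_rep \<pi> R css \<longleftrightarrow> distinct (concat css) \<and> set (concat css) = R \<and>
     (\<forall>c\<in>set css. c \<noteq> [] \<and> map \<pi> c = rotate1 c)"

definition num_cycles :: "'a set \<Rightarrow> ('a \<Rightarrow> 'a) \<Rightarrow> nat" where
  "num_cycles R \<pi> = card (orbit \<pi> ` R)"

text \<open>If \<open>\<pi>\<close> shifts the list by one place, its \<open>n\<close>-th power shifts it by \<open>n\<close> places, so the list
  is exactly one orbit.\<close>

lemma orbit_of_traversed_list:
  assumes "map \<pi> c = rotate1 c" "x \<in> set c"
  shows "orbit \<pi> x = set c"
proof -
  from assms(2) obtain j where j: "j < length c" "c ! j = x" by (auto simp: in_set_conv_nth)
  define L where "L = length c"
  have L: "L > 0" using j by (auto simp: L_def)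
  have step: "\<pi> (c ! i) = c ! (Suc i mod L)" if "i < L" for i
    using assms(1) that nth_map[of i c \<pi>] nth_rotate1[of i c] by (simp add: L_def)
  have pow: "(\<pi> ^^ n) x = c ! ((j + n) mod L)" for n
  proof (induction n)
    case 0
    then show ?case using j by (simp add: L_def)
  next
    case (Suc n)
    then show ?case using step[of "(j + n) mod L"] L by (simp add: mod_Suc_eq)
  qed
  show ?thesis
  proof
    show "orbit \<pi> x \<subseteq> set c"
      using L by (auto simp: orbit_altdef pow L_def)
    show "set c \<subseteq> orbit \<pi> x"
    proof
      fix y assume "y \<in> set c"
      then obtain i where i: "i < L" "y = c ! i" by (auto simp: in_set_conv_nth L_def)
      have jL: "j < L" using j by (simp add: L_def)
      have "(j + (i + (L - j))) mod L = (i + L) mod L" using jL by (simp add: algebra_simps)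
      also have "\<dots> = i" using i by simp
      finally have "y = (\<pi> ^^ (i + (L - j))) x" using pow[of "i + (L - j)"] i by simp
      moreover have "0 < i + (L - j)" using jL by simp
      ultimately show "y \<in> orbit \<pi> x" unfolding orbit_altdef by blast
    qed
  qed
qed

lemma cycle_rep_distinct:
  assumes "cycle_rep \<pi> R css"
  shows "distinct css" "inj_on set (set css)" "\<And>c. c \<in> set css \<Longrightarrow> distinct c"
proof -
  have ne: "[] \<notin> set css" using assms by (auto simp: cycle_rep_def)
  then have rem: "removeAll [] css = css" by (simp add: removeAll_id)
  have d: "distinct (concat css)" using assms by (simp add: cycle_rep_def)
  show "distinct css" using d rem by (simp add: distinct_concat_iff)
  show "\<And>c. c \<in> set css \<Longrightarrow> distinct c" using d by (simp add: distinct_concat_iff)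
  show "inj_on set (set css)"
  proof (rule inj_onI)
    fix a b assume ab: "a \<in> set css" "b \<in> set css" "set a = set b"
    show "a = b"
    proof (rule ccontr)
      assume "a \<noteq> b"
      then have "set a \<inter> set b = {}" using d ab(1,2) unfolding distinct_concat_iff by blast
      then have "a = []" using ab(3) by simp
      then show False using ab ne by simp
    qed
  qed
qed

lemma cycle_rep_orbits:
  assumes "cycle_rep \<pi> R css"
  shows "orbit \<pi> ` R = set ` set css"
proof -
  have "orbit \<pi> ` set c = {set c}" if "c \<in> set css" for c
  proof -
    have c: "map \<pi> c = rotate1 c" "c \<noteq> []" using assms that by (auto simp: cycle_rep_def)
    then obtain x where "x \<in> set c" by (cases c) auto
    then show ?thesis using orbit_of_traversed_list[OF c(1)] by (auto simp: image_def)
  qed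
  moreover have "R = (\<Union>c\<in>set css. set c)" using assms by (auto simp: cycle_rep_def)
  ultimately show ?thesis by (auto simp: image_UN)
qed

lemma num_cycles_cycle_rep: "cycle_rep \<pi> R css \<Longrightarrow> num_cycles R \<pi> = length css"
  unfolding num_cycles_def
  by (simp add: cycle_rep_orbits card_image cycle_rep_distinct distinct_card)

lemma cycle_type_cycle_rep:
  assumes "cycle_rep \<pi> R css"
  shows "image_mset card (mset_set (orbit \<pi> ` R)) = mset (map length css)"
proof -
  have "mset_set (orbit \<pi> ` R) = image_mset set (mset_set (set css))"
    using assms by (simp add: cycle_rep_orbits cycle_rep_distinct image_mset_mset_set)
  also have "mset_set (set css) = mset css"
    using assms by (simp add: cycle_rep_distinct mset_set_set)
  finally have "image_mset card (mset_set (orbit \<pi> ` R)) = image_mset (\<lambda>c. card (set c)) (mset css)"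
    by (simp add: image_mset.compositionality comp_def)
  also have "\<dots> = image_mset length (mset css)"
    using cycle_rep_distinct(3)[OF assms] by (intro image_mset_cong) (simp add: distinct_card)
  finally show ?thesis by simp
qed

lemma cycle_rep_perm:
  assumes "cycle_rep \<pi> R css" "mset css' = mset css"
  shows "cycle_rep \<pi> R css'"
proof -
  have "mset (concat css') = mset (concat css)"
    using assms(2) by (metis mset_concat mset_map sum_mset_sum_list)
  moreover have "set css' = set css" using assms(2) by (metis set_mset_mset)
  ultimately show ?thesis using assms(1)
    unfolding cycle_rep_def by (metis mset_eq_imp_distinct_iff mset_eq_setD)
qed

lemma cycle_rep_rotate:
  assumes "cycle_rep \<pi> R (c # css)"
  shows "cycle_rep \<pi> R (rotate k c # css)"
proof -
  have "map \<pi> (rotate k c) = rotate1 (rotate k c)"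
    using assms by (simp add: cycle_rep_def rotate_map[symmetric] rotate1_rotate_swap)
  then show ?thesis using assms by (auto simp: cycle_rep_def)
qed

lemma cycle_rep_front:
  assumes "cycle_rep \<pi> R css" "c \<in> set css" "x \<in> set c"
  obtains us css' where "cycle_rep \<pi> R ((x # us) # css')" "length c = Suc (length us)"
    "mset css = add_mset c (mset css')" "set (x # us) = set c"
proof -
  obtain A B where AB: "css = A @ c # B" using assms(2) by (meson split_list)
  have "cycle_rep \<pi> R (c # A @ B)" using assms(1) by (rule cycle_rep_perm) (simp add: AB)
  moreover obtain P Q where PQ: "c = P @ x # Q" using assms(3) by (meson split_list)
  moreover have "rotate (length P) c = x # Q @ P" by (simp add: PQ rotate_append)
  ultimately have "cycle_rep \<pi> R ((x # Q @ P) # A @ B)"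
    using cycle_rep_rotate by metis
  then show ?thesis by (rule that) (auto simp: PQ AB)
qed

lemma rotate1_snoc: "rotate1 (x # xs) = xs @ [x]" by simp

section \<open>Erasing a point\<close>

text \<open>This is \<open>\<pi>\<close> with \<open>w\<close> bypassed: the predecessor of \<open>w\<close> is sent to \<open>\<pi> w\<close>, and \<open>w\<close> becomes
  fixed.\<close>

definition contract :: "('a \<Rightarrow> 'a) \<Rightarrow> 'a \<Rightarrow> ('a \<Rightarrow> 'a)" where
  "contract \<pi> w = Transposition.transpose w (\<pi> w) \<circ> \<pi>"

lemma contract_permutes:
  assumes "\<pi> permutes R" "w \<in> R"
  shows "contract \<pi> w permutes (R - {w})"
proof -
  have "Transposition.transpose w (\<pi> w) permutes R"
    using assms by (intro permutes_swap_id) (auto simp: permutes_in_image)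
  then have p: "contract \<pi> w permutes R" unfolding contract_def
    using assms(1) permutes_compose by blast
  have "contract \<pi> w w = w" by (simp add: contract_def)
  then show ?thesis using p
    by (metis Diff_iff insertI1 permutes_superset singletonD p)
qed

lemma contract_apply:
  assumes "inj \<pi>" "y \<noteq> w"
  shows "contract \<pi> w y = (if \<pi> y = w then \<pi> w else \<pi> y)"
  using assms by (auto simp: contract_def Transposition.transpose_def inj_eq)

lemma cycle_rep_contract:
  assumes "cycle_rep \<pi> R ((w # us) # css)" "\<pi> permutes R"
  shows "cycle_rep (contract \<pi> w) (R - {w}) (if us = [] then css else us # css)"
    and "\<pi> w = w \<longleftrightarrow> us = []"
proof -
  have inj: "inj \<pi>" using assms(2) by (rule permutes_inj)
  let ?f = "\<lambda>v. if v = w then \<pi> w else v"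
  have ap: "map (contract \<pi> w) c = map ?f (map \<pi> c)" if "w \<notin> set c" for c
    unfolding map_map
  proof (rule map_cong[OF refl])
    fix y assume "y \<in> set c"
    then have "y \<noteq> w" using that by auto
    then show "contract \<pi> w y = (?f \<circ> \<pi>) y" using contract_apply[OF inj] by simp
  qed
  have d: "distinct (concat ((w # us) # css))" using assms(1) unfolding cycle_rep_def by blast
  have m: "\<pi> w # map \<pi> us = us @ [w]" using assms(1) by (auto simp: cycle_rep_def)
  show fx: "\<pi> w = w \<longleftrightarrow> us = []" using m d by (cases us) auto
  have c: "map (contract \<pi> w) c = rotate1 c" if "c \<in> set css" for c
  proof -
    have w: "w \<notin> set c" using d that by auto
    have "map \<pi> c = rotate1 c" using assms(1) that by (auto simp: cycle_rep_def)
    then have "map (contract \<pi> w) c = map ?f (rotate1 c)" using ap[OF w] by simp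
    also have "\<dots> = rotate1 c" by (rule map_idI) (use w in auto)
    finally show ?thesis .
  qed
  have u: "map (contract \<pi> w) us = rotate1 us" if ne: "us \<noteq> []"
  proof -
    obtain v vs where us: "us = v # vs" using ne by (cases us) auto
    have v: "\<pi> w = v" "map \<pi> us = vs @ [w]" using m us by auto
    have w: "w \<notin> set us" "w \<notin> set vs" using d us by auto
    have "map (contract \<pi> w) us = map ?f (vs @ [w])" using ap[OF w(1)] v(2) by simp
    also have "\<dots> = map ?f vs @ [v]" using v by simp
    also have "map ?f vs = vs" by (rule map_idI) (use w in auto)
    finally show ?thesis using us by simp
  qed
  show "cycle_rep (contract \<pi> w) (R - {w}) (if us = [] then css else us # css)"
    using assms(1) c u d unfolding cycle_rep_def by auto
qed

text \<open>Converse of the previous lemma: a cycle list of the smaller permutation extends by putting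
  \<open>w\<close> just before \<open>\<pi> w\<close>, or as a cycle of its own. It yields the existence of cycle lists by
  induction on the number of points.\<close>

lemma cycle_rep_uncontract:
  assumes "\<pi> permutes R" "w \<in> R"
  shows "cycle_rep (contract \<pi> w) (R - {w}) css \<Longrightarrow> \<pi> w = w \<Longrightarrow> cycle_rep \<pi> R ([w] # css)"
    and "cycle_rep (contract \<pi> w) (R - {w}) ((\<pi> w # us) # css) \<Longrightarrow> \<pi> w \<noteq> w
           \<Longrightarrow> cycle_rep \<pi> R ((w # \<pi> w # us) # css)"
proof -
  have inj: "inj \<pi>" using assms(1) by (rule permutes_inj)
  have surj: "surj \<pi>" using assms(1) by (rule permutes_surj)
  { assume r: "cycle_rep (contract \<pi> w) (R - {w}) css" and fx: "\<pi> w = w"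
    have "map \<pi> c = map (contract \<pi> w) c" if "c \<in> set css" for c
    proof (rule map_cong[OF refl])
      fix y assume "y \<in> set c"
      then have "y \<in> R - {w}" using r that unfolding cycle_rep_def by auto
      then show "\<pi> y = contract \<pi> w y" using contract_apply[OF inj, of y w] fx by auto
    qed
    then show "cycle_rep \<pi> R ([w] # css)" using r fx assms(2) unfolding cycle_rep_def by auto }
  { assume r: "cycle_rep (contract \<pi> w) (R - {w}) ((\<pi> w # us) # css)" and nf: "\<pi> w \<noteq> w"
    let ?g = "\<lambda>v. if v = \<pi> w then w else v"
    have ap: "map \<pi> c = map ?g (map (contract \<pi> w) c)" if "c \<in> set ((\<pi> w # us) # css)" for c
      unfolding map_map
    proof (rule map_cong[OF refl])
      fix y assume "y \<in> set c"
      then have "y \<in> R - {w}" using r that unfolding cycle_rep_def by auto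
      then show "\<pi> y = (?g \<circ> contract \<pi> w) y" using contract_apply[OF inj, of y w] inj
        by (auto simp: inj_eq)
    qed
    have d: "distinct (concat ((\<pi> w # us) # css))" "w \<notin> set (concat ((\<pi> w # us) # css))"
      using r unfolding cycle_rep_def by blast+
    have mc: "map (contract \<pi> w) (\<pi> w # us) = us @ [\<pi> w]"
      using r unfolding cycle_rep_def by simp
    have "map \<pi> (\<pi> w # us) = map ?g (map (contract \<pi> w) (\<pi> w # us))"
      by (rule ap) simp
    also have "\<dots> = map ?g (us @ [\<pi> w])" by (simp only: mc)
    also have "\<dots> = us @ [w]" using d by (auto intro!: map_idI)
    finally have 1: "map \<pi> (w # \<pi> w # us) = rotate1 (w # \<pi> w # us)" by simp
    have 2: "map \<pi> c = rotate1 c" if "c \<in> set css" for c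
    proof -
      have "map (contract \<pi> w) c = rotate1 c" using r that unfolding cycle_rep_def by auto
      moreover have "\<pi> w \<notin> set c" using d that by auto
      ultimately show ?thesis using ap[of c] that by (auto intro!: map_idI)
    qed
    have 3: "set (concat ((w # \<pi> w # us) # css)) = R"
      using r assms(2) unfolding cycle_rep_def by auto
    have 4: "distinct (concat ((w # \<pi> w # us) # css))" using d by auto
    have 5: "\<forall>c\<in>set css. c \<noteq> []" using r unfolding cycle_rep_def by auto
    have 6: "\<forall>c\<in>set ((w # \<pi> w # us) # css). c \<noteq> [] \<and> map \<pi> c = rotate1 c"
      using 1 2 5 by (metis list.discI set_ConsD)
    show "cycle_rep \<pi> R ((w # \<pi> w # us) # css)"
      unfolding cycle_rep_def using 3 4 6 by (intro conjI) }
qed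

lemma cycle_rep_exists:
  assumes "finite R" "\<pi> permutes R"
  shows "\<exists>css. cycle_rep \<pi> R css"
  using assms
proof (induction R arbitrary: \<pi> rule: finite_remove_induct)
  case empty
  then show ?case by (intro exI[of _ "[]"]) (simp add: cycle_rep_def)
next
  case (remove R)
  from remove obtain w where w: "w \<in> R" by blast
  have "contract \<pi> w permutes (R - {w})" using remove.prems w by (rule contract_permutes)
  then obtain css where css: "cycle_rep (contract \<pi> w) (R - {w}) css" using remove.IH[OF w] by blast
  show ?case
  proof (cases "\<pi> w = w")
    case True
    then show ?thesis using cycle_rep_uncontract(1)[OF remove.prems w css] by blast
  next
    case False
    have "\<pi> w \<in> R - {w}" using w remove.prems False by (simp add: permutes_in_image)
    then obtain c where "c \<in> set css" "\<pi> w \<in> set c" using css unfolding cycle_rep_def by auto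
    then obtain us css' where "cycle_rep (contract \<pi> w) (R - {w}) ((\<pi> w # us) # css')"
      using cycle_rep_front[OF css] by metis
    then show ?thesis using cycle_rep_uncontract(2)[OF remove.prems w] False by blast
  qed
qed

lemma cycle_rep_at:
  assumes "finite R" "\<pi> permutes R" "x \<in> R"
  obtains us css where "cycle_rep \<pi> R ((x # us) # css)"
proof -
  obtain css0 where c0: "cycle_rep \<pi> R css0" using cycle_rep_exists assms by blast
  then obtain c where c: "c \<in> set css0" "x \<in> set c" using assms(3) unfolding cycle_rep_def by auto
  show ?thesis by (rule cycle_rep_front[OF c0 c]) (rule that)
qed

text \<open>The source of all factors \<open>1 + X\<close>: erasing a point loses a cycle only if the point is fixed.\<close>

lemma num_cycles_contract:
  assumes "finite R" "\<pi> permutes R" "w \<in> R"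
  shows "num_cycles R \<pi> = (if \<pi> w = w then 1 else 0) + num_cycles (R - {w}) (contract \<pi> w)"
proof -
  obtain us css where r: "cycle_rep \<pi> R ((w # us) # css)" by (rule cycle_rep_at[OF assms])
  show ?thesis
    using num_cycles_cycle_rep[OF cycle_rep_contract(1)[OF r assms(2)]] cycle_rep_contract(2)[OF r assms(2)]
      num_cycles_cycle_rep[OF r] by (cases "us = []") simp_all
qed

lemma cycle_rep_unique:
  assumes "cycle_rep \<pi> R css" "cycle_rep \<pi>' R css" "\<pi> permutes R" "\<pi>' permutes R"
  shows "\<pi> = \<pi>'"
proof
  fix y
  show "\<pi> y = \<pi>' y"
  proof (cases "y \<in> R")
    case True
    then obtain c where "c \<in> set css" "y \<in> set c" using assms unfolding cycle_rep_def by auto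
    moreover then have "map \<pi> c = map \<pi>' c" using assms unfolding cycle_rep_def by auto
    ultimately show ?thesis by auto
  next
    case False
    then show ?thesis using assms by (simp add: permutes_not_in)
  qed
qed

section \<open>Multiplying by a transposition and erasing a point\<close>

text \<open>When \<open>\<rho> = \<rho>' \<circ> (x w)\<close> and \<open>\<rho>'\<close> fixes \<open>w\<close>, erasing \<open>w\<close> from \<open>\<rho> \<circ> \<beta>\<close> leaves \<open>\<rho>' \<circ> peel \<beta> x w\<close>.\<close>

definition peel :: "('a \<Rightarrow> 'a) \<Rightarrow> 'a \<Rightarrow> 'a \<Rightarrow> ('a \<Rightarrow> 'a)" where
  "peel \<beta> x w = contract (Transposition.transpose x w \<circ> \<beta>) w"

lemma peel_apply:
  assumes "inj \<beta>" "y \<noteq> w" "x \<noteq> w"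
  shows "peel \<beta> x w y = (if \<beta> y = w then x else if \<beta> y = x then (if \<beta> w = w then x else \<beta> w) else \<beta> y)"
proof -
  have inj: "inj (Transposition.transpose x w \<circ> \<beta>)" using assms(1) by (intro inj_compose) auto
  show ?thesis using assms contract_apply[OF inj assms(2)] unfolding peel_def
    by (auto simp: Transposition.transpose_def inj_eq split: if_splits)
qed

lemma peel_permutes:
  assumes "\<beta> permutes R" "x \<in> R" "w \<in> R"
  shows "peel \<beta> x w permutes (R - {w})"
  unfolding peel_def
  by (rule contract_permutes) (use assms in \<open>auto intro: permutes_compose permutes_swap_id\<close>)

text \<open>If \<open>w\<close> lies in the cycle of \<open>x\<close>, the transposition cuts that cycle just before \<open>x\<close> and \<open>w\<close>;
  erasing \<open>w\<close> then shortens the second piece \<open>w # vs\<close>, which disappears if \<open>vs\<close> is empty.\<close>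

lemma cycle_rep_peel_split:
  assumes r: "cycle_rep \<beta> R ((x # us @ w # vs) # css)" and p: "\<beta> permutes R"
  shows "cycle_rep (peel \<beta> x w) (R - {w}) ((x # us) # (if vs = [] then css else vs # css))"
    and "\<beta> w = x \<longleftrightarrow> vs = []"
proof -
  have inj: "inj \<beta>" using p by (rule permutes_inj)
  have d: "distinct (concat ((x # us @ w # vs) # css))" using r unfolding cycle_rep_def by blast
  have xw: "x \<noteq> w" using d by auto
  let ?f = "\<lambda>v. if v = w then x else if v = x then (if \<beta> w = w then x else \<beta> w) else v"
  have ap: "map (peel \<beta> x w) c = map ?f (map \<beta> c)" if "w \<notin> set c" for c
    unfolding map_map
  proof (rule map_cong[OF refl])
    fix y assume "y \<in> set c"
    then have "y \<noteq> w" using that by auto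
    then show "peel \<beta> x w y = (?f \<circ> \<beta>) y" using peel_apply[OF inj _ xw] by simp
  qed
  have m: "map \<beta> (x # us) @ \<beta> w # map \<beta> vs = (us @ [w]) @ vs @ [x]"
    using r unfolding cycle_rep_def by simp
  have "length (map \<beta> (x # us)) = length (us @ [w])" by simp
  then have m1: "map \<beta> (x # us) = us @ [w]" and m2: "\<beta> w # map \<beta> vs = vs @ [x]"
    using m append_eq_append_conv by blast+
  show "\<beta> w = x \<longleftrightarrow> vs = []" using m2 d by (cases vs) auto
  have c: "map (peel \<beta> x w) c = rotate1 c" if "c \<in> set css" for c
  proof -
    have w: "w \<notin> set c" "x \<notin> set c" using d that by auto
    have "map \<beta> c = rotate1 c" using r that unfolding cycle_rep_def by auto
    then have "map (peel \<beta> x w) c = map ?f (rotate1 c)" using ap[OF w(1)] by simp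
    also have "\<dots> = rotate1 c" by (rule map_idI) (use w in auto)
    finally show ?thesis .
  qed
  have u: "map (peel \<beta> x w) (x # us) = rotate1 (x # us)"
  proof -
    have "map (peel \<beta> x w) (x # us) = map ?f (map \<beta> (x # us))" by (rule ap) (use d in auto)
    also have "\<dots> = map ?f (us @ [w])" by (simp only: m1)
    also have "\<dots> = map ?f us @ [x]" by simp
    also have "map ?f us = us" by (rule map_idI) (use d in auto)
    finally show ?thesis by simp
  qed
  have v: "map (peel \<beta> x w) vs = rotate1 vs" if ne: "vs \<noteq> []"
  proof -
    obtain v vs' where vs: "vs = v # vs'" using ne by (cases vs) auto
    have b: "\<beta> w = v" "map \<beta> vs = vs' @ [x]" using m2 vs by auto
    have w: "w \<notin> set vs" "v \<noteq> w" "x \<notin> set vs'" "w \<notin> set vs'" using d vs by auto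
    have "map (peel \<beta> x w) vs = map ?f (vs' @ [x])" using ap[OF w(1)] b(2) by simp
    also have "\<dots> = map ?f vs' @ [v]" using xw w(2) b(1) by simp
    also have "map ?f vs' = vs'" by (rule map_idI) (use w in auto)
    finally show ?thesis using vs by simp
  qed
  have Rw: "set (concat ((x # us) # (if vs = [] then css else vs # css))) = R - {w}"
    using r d unfolding cycle_rep_def by auto
  have dd: "distinct (concat ((x # us) # (if vs = [] then css else vs # css)))"
    using d by auto
  have all: "\<forall>c\<in>set ((x # us) # (if vs = [] then css else vs # css)).
              c \<noteq> [] \<and> map (peel \<beta> x w) c = rotate1 c"
    using c u v r unfolding cycle_rep_def by auto
  show "cycle_rep (peel \<beta> x w) (R - {w}) ((x # us) # (if vs = [] then css else vs # css))"
    unfolding cycle_rep_def using Rw dd all by blast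
qed

text \<open>If \<open>w\<close> lies in another cycle, the transposition joins the two cycles, and erasing \<open>w\<close>
  removes it from the joined one.\<close>

lemma cycle_rep_peel_merge:
  assumes r: "cycle_rep \<beta> R ((x # us) # (w # ys) # css)" and p: "\<beta> permutes R"
  shows "cycle_rep (peel \<beta> x w) (R - {w}) ((x # us @ ys) # css)"
    and "\<beta> w \<noteq> x"
proof -
  have inj: "inj \<beta>" using p by (rule permutes_inj)
  have d: "distinct (concat ((x # us) # (w # ys) # css))" using r unfolding cycle_rep_def by blast
  have xw: "x \<noteq> w" using d by auto
  let ?f = "\<lambda>v. if v = w then x else if v = x then (if \<beta> w = w then x else \<beta> w) else v"
  have ap: "map (peel \<beta> x w) c = map ?f (map \<beta> c)" if "w \<notin> set c" for c
    unfolding map_map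
  proof (rule map_cong[OF refl])
    fix y assume "y \<in> set c"
    then have "y \<noteq> w" using that by auto
    then show "peel \<beta> x w y = (?f \<circ> \<beta>) y" using peel_apply[OF inj _ xw] by simp
  qed
  have m1: "map \<beta> (x # us) = us @ [x]" and m2: "\<beta> w # map \<beta> ys = ys @ [w]"
    using r unfolding cycle_rep_def by auto
  show "\<beta> w \<noteq> x" using m2 d by (cases ys) auto
  have c: "map (peel \<beta> x w) c = rotate1 c" if "c \<in> set css" for c
  proof -
    have w: "w \<notin> set c" "x \<notin> set c" using d that by auto
    have "map \<beta> c = rotate1 c" using r that unfolding cycle_rep_def by auto
    then have "map (peel \<beta> x w) c = map ?f (rotate1 c)" using ap[OF w(1)] by simp
    also have "\<dots> = rotate1 c" by (rule map_idI) (use w in auto)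
    finally show ?thesis .
  qed
  have u: "map (peel \<beta> x w) (x # us @ ys) = rotate1 (x # us @ ys)"
  proof (cases ys)
    case Nil
    have "map (peel \<beta> x w) (x # us) = map ?f (map \<beta> (x # us))" by (rule ap) (use d in auto)
    also have "\<dots> = map ?f (us @ [x])" by (simp only: m1)
    also have "\<dots> = map ?f us @ [x]" using Nil m2 xw by simp
    also have "map ?f us = us" by (rule map_idI) (use d in auto)
    finally show ?thesis using Nil by simp
  next
    case (Cons y ys')
    have b: "\<beta> w = y" "map \<beta> ys = ys' @ [w]" using m2 Cons by auto
    have "map (peel \<beta> x w) (x # us @ ys) = map ?f (map \<beta> (x # us @ ys))"
      by (rule ap) (use d in auto)
    also have "map \<beta> (x # us @ ys) = map \<beta> (x # us) @ map \<beta> ys" by simp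
    also have "\<dots> = us @ [x] @ ys' @ [w]" by (simp only: m1 b(2) append_assoc)
    also have "map ?f (us @ [x] @ ys' @ [w]) = map ?f us @ [y] @ map ?f ys' @ [x]"
      using xw b(1) d Cons by auto
    also have "map ?f us = us" by (rule map_idI) (use d in auto)
    also have "map ?f ys' = ys'" by (rule map_idI) (use d Cons in auto)
    finally show ?thesis using Cons by simp
  qed
  have 1: "set (concat ((x # us @ ys) # css)) = R - {w}" using r d unfolding cycle_rep_def by auto
  have 2: "distinct (concat ((x # us @ ys) # css))" using d by auto
  have 3: "\<forall>c\<in>set css. c \<noteq> []" using r unfolding cycle_rep_def by auto
  have 4: "\<forall>c\<in>set ((x # us @ ys) # css). c \<noteq> [] \<and> map (peel \<beta> x w) c = rotate1 c"
    using c u 3 by (metis list.discI set_ConsD)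
  show "cycle_rep (peel \<beta> x w) (R - {w}) ((x # us @ ys) # css)"
    unfolding cycle_rep_def using 1 2 4 by (intro conjI)
qed

section \<open>The averaging recursion\<close>

text \<open>The weight of a cycle: the coefficient of its \<open>v\<close>-th power at \<open>X ^ j\<close> is \<open>v choose j\<close>.\<close>

abbreviation X1 :: "real poly" where "X1 \<equiv> [:1, 1:]"

text \<open>The weight collected when a point is erased whose cycle contains \<open>b\<close> other points;
  \<open>add_part\<close> below records the cycle that these points leave behind, if there are any.\<close>

definition closing :: "nat \<Rightarrow> real poly" where "closing b = (if b = 0 then X1 else 1)"

definition add_part :: "nat \<Rightarrow> nat multiset \<Rightarrow> nat multiset" where
  "add_part b M = (if b = 0 then M else add_mset b M)"

text \<open>The average weight when \<open>\<beta>\<close> has a cycle consisting of a point \<open>x\<close> and \<open>b\<close> further points,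
  with the other cycles of lengths \<open>M\<close>, and the cycle of \<open>\<rho>\<close> through \<open>x\<close> still has \<open>r\<close> points
  to be chosen. The next point \<open>w\<close> is one of the \<open>b\<close> points (the cycle of \<open>x\<close> keeps \<open>i\<close>
  further points and \<open>b - 1 - i\<close> points split off) or lies in a cycle of length \<open>s\<close>, which is
  merged. When \<open>r = 0\<close>, the point \<open>x\<close> is erased and \<open>h\<close> is the average weight of the remaining
  cycles of \<open>\<rho>\<close>.\<close>

primrec cycle_avg :: "(nat multiset \<Rightarrow> real poly) \<Rightarrow> nat \<Rightarrow> nat \<Rightarrow> nat multiset \<Rightarrow> real poly" where
  "cycle_avg h 0 b M = closing b * h (add_part b M)"
| "cycle_avg h (Suc r) b M = smult (1 / real (b + sum_mset M))
     ((\<Sum>i<b. closing (b - 1 - i) * cycle_avg h r i (add_part (b - 1 - i) M))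
      + (\<Sum>s\<in>#M. smult (real s) (cycle_avg h r (b + s - 1) (M - {#s#}))))"

text \<open>The list holds the cycle lengths of \<open>\<rho>\<close>, the multiset those of \<open>\<beta>\<close>. The first point of a new
  cycle of \<open>\<rho>\<close> is uniform, so it lies in a given cycle of length \<open>s\<close> with probability
  \<open>s / sum_mset M\<close>.\<close>

primrec type_avg :: "nat list \<Rightarrow> nat multiset \<Rightarrow> real poly" where
  "type_avg [] M = 1"
| "type_avg (a # as) M = smult (1 / real (sum_mset M))
     (\<Sum>s\<in>#M. smult (real s) (cycle_avg (type_avg as) (a - 1) (s - 1) (M - {#s#})))"

section \<open>Averages over a conjugacy class satisfy the recursion\<close>

text \<open>The cycle through \<open>x\<close> and the listed points, written as a product of transpositions such
  that the one with the first listed point is applied first; this is the form in which \<open>peel\<close>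
  can strip it from the right.\<close>

primrec cyc_through :: "'a \<Rightarrow> 'a list \<Rightarrow> ('a \<Rightarrow> 'a)" where
  "cyc_through x [] = id"
| "cyc_through x (w # ws) = cyc_through x ws \<circ> Transposition.transpose x w"

text \<open>The permutation whose cycles are consecutive blocks of \<open>xs\<close> of the prescribed lengths. For
  \<open>xs\<close> uniform it is a uniform element of its conjugacy class.\<close>

primrec cyc_prod :: "nat list \<Rightarrow> 'a list \<Rightarrow> ('a \<Rightarrow> 'a)" where
  "cyc_prod [] xs = id"
| "cyc_prod (a # as) xs = cyc_prod as (drop a xs) \<circ> cyc_through (hd xs) (take (a - 1) (tl xs))"

lemma cyc_through_permutes: "x \<in> R \<Longrightarrow> set ws \<subseteq> R \<Longrightarrow> cyc_through x ws permutes R"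
  by (induction ws) (auto intro!: permutes_compose permutes_swap_id permutes_id simp: id_def[symmetric])

lemma cyc_prod_permutes: "set xs \<subseteq> R \<Longrightarrow> sum_list as \<le> length xs \<Longrightarrow> \<forall>a\<in>set as. a \<ge> 1
    \<Longrightarrow> cyc_prod as xs permutes R"
proof (induction as arbitrary: xs)
  case Nil
  show ?case unfolding cyc_prod.simps by (rule permutes_id)
next
  case (Cons a as)
  have ne: "xs \<noteq> []" using Cons.prems by auto
  have "cyc_prod as (drop a xs) permutes R"
    using Cons.prems set_drop_subset[of a xs] by (intro Cons.IH) auto
  moreover have "cyc_through (hd xs) (take (a - 1) (tl xs)) permutes R"
    using Cons.prems ne set_take_subset[of "a - 1" "tl xs"] list.set_sel[OF ne]
    by (intro cyc_through_permutes) (auto dest: list.set_sel(2)[OF ne])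
  ultimately show ?case unfolding cyc_prod.simps by (intro permutes_compose)
qed

lemma sum_permutations_of_set_Cons:
  fixes f :: "'a list \<Rightarrow> 'b :: comm_monoid_add"
  assumes "finite A" "A \<noteq> {}"
  shows "(\<Sum>ys\<in>permutations_of_set A. f ys) = (\<Sum>w\<in>A. \<Sum>ys\<in>permutations_of_set (A - {w}). f (w # ys))"
proof -
  have "(\<Sum>ys\<in>permutations_of_set A. f ys)
      = (\<Sum>ys\<in>(\<Union>x\<in>A. (#) x ` permutations_of_set (A - {x})). f ys)"
    using permutations_of_set_nonempty[OF assms(2)] by simp
  also have "\<dots> = (\<Sum>w\<in>A. \<Sum>ys\<in>(#) w ` permutations_of_set (A - {w}). f ys)"
    by (rule sum.UNION_disjoint) (use assms in auto)
  also have "\<dots> = (\<Sum>w\<in>A. \<Sum>ys\<in>permutations_of_set (A - {w}). f (w # ys))"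
    by (intro sum.cong refl sum.reindex_cong[where l = "(#) _"]) auto
  finally show ?thesis .
qed

text \<open>A point that the left factor fixes may be erased from the right factor alone.\<close>

lemma num_cycles_comp_contract:
  assumes "finite R" "\<pi> permutes R" "w \<in> R" "g permutes (R - {w})"
  shows "num_cycles R (g \<circ> \<pi>) = (if \<pi> w = w then 1 else 0) + num_cycles (R - {w}) (g \<circ> contract \<pi> w)"
proof -
  have gw: "g w = w" using assms(4) by (simp add: permutes_not_in)
  have gi: "g a = w \<longleftrightarrow> a = w" for a
    using permutes_inj[OF assms(4)] gw by (metis injD)
  have gR: "g permutes R" using assms(4) by (rule permutes_subset) auto
  have p: "g \<circ> \<pi> permutes R" using assms(2) gR by (rule permutes_compose)
  have "contract (g \<circ> \<pi>) w = g \<circ> contract \<pi> w"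
  proof
    fix y
    show "contract (g \<circ> \<pi>) w y = (g \<circ> contract \<pi> w) y"
    proof (cases "y = w")
      case True
      then show ?thesis by (simp add: contract_def gw)
    next
      case False
      then show ?thesis
        using contract_apply[OF permutes_inj[OF p] False] contract_apply[OF permutes_inj[OF assms(2)] False]
        by (auto simp: gi)
    qed
  qed
  then show ?thesis using num_cycles_contract[OF assms(1) p assms(3)] by (simp add: gi)
qed

text \<open>The cycle of \<open>x\<close> stays in front while a second cycle is rotated to start at \<open>w\<close>: the
  situation before a merge.\<close>

lemma cycle_rep_star_front:
  assumes r: "cycle_rep \<beta> R ((x # us) # css)" and c: "c \<in> set css" "w \<in> set c"
  obtains ys css' where "cycle_rep \<beta> R ((x # us) # (w # ys) # css')" "length c = Suc (length ys)"
    "mset (map length css') = mset (map length css) - {#length c#}"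
proof -
  have "c \<in> set ((x # us) # css)" using c by simp
  then obtain ys css0 where 0: "cycle_rep \<beta> R ((w # ys) # css0)" "length c = Suc (length ys)"
    "mset ((x # us) # css) = add_mset c (mset css0)"
    by (rule cycle_rep_front[OF r _ c(2)]) (rule that)
  have d: "distinct ((x # us) # css)" using cycle_rep_distinct[OF r] by simp
  have "x # us \<noteq> c" using d c by auto
  moreover have "x # us \<in># add_mset c (mset css0)" unfolding 0(3)[symmetric] by simp
  ultimately have xin: "x # us \<in># mset css0" by simp
  obtain css' where m0: "mset css0 = add_mset (x # us) (mset css')"
  proof
    show "mset css0 = add_mset (x # us) (mset (remove1 (x # us) css0))" using xin by simp
  qed
  have "mset ((x # us) # (w # ys) # css') = mset ((w # ys) # css0)" using m0 by simp
  then have 1: "cycle_rep \<beta> R ((x # us) # (w # ys) # css')" by (rule cycle_rep_perm[OF 0(1)])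
  have "mset css = add_mset c (mset css')" using 0(3) unfolding m0 by (simp add: add_mset_commute[of c])
  then have "mset (map length css') = mset (map length css) - {#length c#}" by simp
  then show ?thesis by (rule that[OF 1 0(2)])
qed

lemma sum_over_cycles:
  fixes g :: "nat \<Rightarrow> 'b :: semiring_1"
  assumes r: "cycle_rep \<beta> R css" and f: "\<And>c w. c \<in> set css \<Longrightarrow> w \<in> set c \<Longrightarrow> f w = g (length c)"
  shows "(\<Sum>w\<in>R. f w) = (\<Sum>s\<in>#mset (map length css). of_nat s * g s)"
proof -
  have d: "distinct (concat css)" "set (concat css) = R" using r unfolding cycle_rep_def by blast+
  have "(\<Sum>w\<in>R. f w) = (\<Sum>w\<in>(\<Union>c\<in>set css. set c). f w)" using d(2) by simp
  also have "\<dots> = (\<Sum>c\<in>set css. \<Sum>w\<in>set c. f w)"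
    by (rule sum.UNION_disjoint) (use d(1) in \<open>auto simp: distinct_concat_iff\<close>)
  also have "\<dots> = (\<Sum>c\<in>set css. of_nat (length c) * g (length c))"
  proof (rule sum.cong[OF refl])
    fix c assume c: "c \<in> set css"
    have "(\<Sum>w\<in>set c. f w) = (\<Sum>w\<in>set c. g (length c))" by (rule sum.cong) (use f c in auto)
    also have "\<dots> = of_nat (length c) * g (length c)"
      using cycle_rep_distinct(3)[OF r c] by (simp add: distinct_card)
    finally show "(\<Sum>w\<in>set c. f w) = of_nat (length c) * g (length c)" .
  qed
  also have "\<dots> = (\<Sum>c\<in>#mset_set (set css). of_nat (length c) * g (length c))"
    by (simp add: sum_unfold_sum_mset)
  also have "mset_set (set css) = mset css"
    using cycle_rep_distinct(1)[OF r] by (simp add: mset_set_set)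
  finally show ?thesis by (simp add: image_mset.compositionality comp_def)
qed

lemma smult_sum_right: "smult c (\<Sum>i\<in>A. f i) = (\<Sum>i\<in>A. smult c (f i))"
  by (induction A rule: infinite_finite_induct) (auto simp: smult_add_right)

lemma sum_mset_of_nat_smult:
  "(\<Sum>s\<in>#M. of_nat s * smult F (g s)) = smult F (\<Sum>s\<in>#M. smult (real s) (g s))"
proof (induction M)
  case (add s M)
  have "of_nat s * smult F (g s) = smult F (smult (real s) (g s))"
    by (simp add: of_nat_poly mult.commute)
  then show ?case using add by (simp add: smult_add_right)
qed simp

text \<open>The recursion for \<open>cycle_avg\<close> read on permutations, by induction on the number \<open>b\<close> of points
  of the current cycle that are still to be chosen. The sum over the next point \<open>w\<close> splits
  according to the cycle of \<open>\<beta>\<close> containing it: each position in the cycle of \<open>x\<close> gives one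
  splitting term, and all points of another cycle give the same merging term.\<close>

lemma sum_star_perms:
  fixes \<beta> :: "'a \<Rightarrow> 'a"
  assumes as: "\<forall>a\<in>set as. a \<ge> 1"
    and IH: "\<And>\<beta> (R :: 'a set) css. finite R \<Longrightarrow> \<beta> permutes R \<Longrightarrow> cycle_rep \<beta> R css \<Longrightarrow> sum_list as = card R \<Longrightarrow>
      (\<Sum>xs\<in>permutations_of_set R. X1 ^ num_cycles R (cyc_prod as xs \<circ> \<beta>))
        = smult (fact (card R)) (type_avg as (mset (map length css)))"
  shows "finite R \<Longrightarrow> \<beta> permutes R \<Longrightarrow> cycle_rep \<beta> R ((x # us) # css) \<Longrightarrow> sum_list as + b + 1 = card R \<Longrightarrow>
    (\<Sum>ys\<in>permutations_of_set (R - {x}).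
        X1 ^ num_cycles R (cyc_prod as (drop b ys) \<circ> cyc_through x (take b ys) \<circ> \<beta>))
      = smult (fact (card R - 1)) (cycle_avg (type_avg as) b (length us) (mset (map length css)))"
proof (induction b arbitrary: R \<beta> us css)
  case 0
  have x: "x \<in> R" using 0(3) unfolding cycle_rep_def by auto
  have cR: "card (R - {x}) = card R - 1" using x 0 by simp
  have "(\<Sum>ys\<in>permutations_of_set (R - {x}). X1 ^ num_cycles R (cyc_prod as (drop 0 ys) \<circ> cyc_through x (take 0 ys) \<circ> \<beta>))
      = (\<Sum>ys\<in>permutations_of_set (R - {x}). closing (length us) * X1 ^ num_cycles (R - {x}) (cyc_prod as ys \<circ> contract \<beta> x))"
  proof (rule sum.cong[OF refl])
    fix ys assume ys: "ys \<in> permutations_of_set (R - {x})"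
    then have l: "set ys = R - {x}" "length ys = card R - 1"
      using length_finite_permutations_of_set[OF ys] cR by (auto dest: permutations_of_setD)
    have "cyc_prod as ys permutes (R - {x})" by (rule cyc_prod_permutes) (use l as 0 in auto)
    from num_cycles_comp_contract[OF 0(1,2) x this] cycle_rep_contract(2)[OF 0(3,2)]
    show "X1 ^ num_cycles R (cyc_prod as (drop 0 ys) \<circ> cyc_through x (take 0 ys) \<circ> \<beta>)
        = closing (length us) * X1 ^ num_cycles (R - {x}) (cyc_prod as ys \<circ> contract \<beta> x)"
      by (simp add: closing_def)
  qed
  also have "\<dots> = closing (length us) * smult (fact (card R - 1)) (type_avg as (mset (map length (if us = [] then css else us # css))))"
    unfolding sum_distrib_left[symmetric]
    using IH[OF _ contract_permutes[OF 0(2) x] cycle_rep_contract(1)[OF 0(3,2)]] 0 cR by simp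
  also have "mset (map length (if us = [] then css else us # css)) = add_part (length us) (mset (map length css))"
    by (simp add: add_part_def)
  finally show ?case by simp
next
  case (Suc b)
  note r = Suc.prems(3) and p = Suc.prems(2) and fin = Suc.prems(1)
  let ?M = "mset (map length css)"
  have x: "x \<in> R" using r unfolding cycle_rep_def by auto
  have d: "distinct (x # us)" using cycle_rep_distinct(3)[OF r, of "x # us"] by simp
  have c2: "card R \<ge> 2" using Suc.prems(4) by simp
  have cR: "card (R - {x}) = card R - 1" using x fin by simp
  have ne: "R - {x} \<noteq> {}"
  proof
    assume e: "R - {x} = {}"
    show False using c2 cR unfolding e by simp
  qed
  \<comment> \<open>the contribution of the choice \<open>w\<close> for the next point of the cycle through \<open>x\<close>\<close>
  define V where "V w = (if \<beta> w = x then X1 else 1) * (\<Sum>ys\<in>permutations_of_set (R - {w} - {x}).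
        X1 ^ num_cycles (R - {w}) (cyc_prod as (drop b ys) \<circ> cyc_through x (take b ys) \<circ> peel \<beta> x w))" for w
  have Vw: "(\<Sum>ys\<in>permutations_of_set (R - {x} - {w}).
        X1 ^ num_cycles R (cyc_prod as (drop (Suc b) (w # ys)) \<circ> cyc_through x (take (Suc b) (w # ys)) \<circ> \<beta>)) = V w"
    if w: "w \<in> R - {x}" for w
  proof -
    have eq: "R - {x} - {w} = R - {w} - {x}" by auto
    have cw: "card (R - {x} - {w}) = card R - 2" using w x fin by (simp add: cR)
    have "X1 ^ num_cycles R (cyc_prod as (drop (Suc b) (w # ys)) \<circ> cyc_through x (take (Suc b) (w # ys)) \<circ> \<beta>)
       = (if \<beta> w = x then X1 else 1) *
         X1 ^ num_cycles (R - {w}) (cyc_prod as (drop b ys) \<circ> cyc_through x (take b ys) \<circ> peel \<beta> x w)"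
      if ys: "ys \<in> permutations_of_set (R - {x} - {w})" for ys
    proof -
      have l: "set ys = R - {x} - {w}" "length ys = card R - 2"
        using length_finite_permutations_of_set[OF ys] cw ys by (auto dest: permutations_of_setD)
      let ?g = "cyc_prod as (drop b ys) \<circ> cyc_through x (take b ys)"
      have "cyc_prod as (drop b ys) permutes (R - {w})"
        by (rule cyc_prod_permutes) (use l as Suc.prems(4) set_drop_subset[of b ys] in auto)
      moreover have "cyc_through x (take b ys) permutes (R - {w})"
        by (rule cyc_through_permutes) (use l x w set_take_subset[of b ys] in auto)
      ultimately have g: "?g permutes (R - {w})" by (intro permutes_compose)
      have q: "Transposition.transpose x w \<circ> \<beta> permutes R"
        using p x w by (auto intro!: permutes_compose permutes_swap_id)
      have "(Transposition.transpose x w \<circ> \<beta>) w = w \<longleftrightarrow> \<beta> w = x"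
        by (auto simp: Transposition.transpose_def)
      then show ?thesis using num_cycles_comp_contract[OF fin q _ g] w
        by (simp add: peel_def comp_assoc)
    qed
    then show ?thesis unfolding V_def eq[symmetric] sum_distrib_left by (intro sum.cong) auto
  qed
  define F where "F = (fact (card R - 2) :: real)"
  let ?S = "cycle_avg (type_avg as) b"
  have cw: "sum_list as + b + 1 = card (R - {w})" "card (R - {w}) - 1 = card R - 2" if "w \<in> R" for w
    using that fin Suc.prems(4) by simp_all
  have Vus: "V (us ! i) = smult F (closing (length us - 1 - i) * ?S i (add_part (length us - 1 - i) ?M))"
    if i: "i < length us" for i
  proof -
    let ?w = "us ! i" and ?vs = "drop (Suc i) us"
    have us: "us = take i us @ ?w # ?vs" using i by (simp add: id_take_nth_drop)
    have r': "cycle_rep \<beta> R ((x # take i us @ ?w # ?vs) # css)" using r us by simp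
    have w: "?w \<in> R" using r i unfolding cycle_rep_def by auto
    have vs: "?vs = [] \<longleftrightarrow> length us - 1 - i = 0" "length ?vs = length us - 1 - i" using i by auto
    have clo: "(if \<beta> ?w = x then X1 else 1) = closing (length us - 1 - i)"
      using cycle_rep_peel_split(2)[OF r' p] vs by (simp add: closing_def)
    have M: "mset (map length (if ?vs = [] then css else ?vs # css)) = add_part (length us - 1 - i) ?M"
      using vs by (auto simp: add_part_def)
    note e = Suc.IH[OF finite_Diff[OF fin, of "{?w}"] peel_permutes[OF p x w]
        cycle_rep_peel_split(1)[OF r' p] cw(1)[OF w]]
    show ?thesis unfolding V_def clo e M cw(2)[OF w] using i by (simp add: F_def)
  qed
  have Vc: "V w = smult F (?S (length us + length c - 1) (?M - {#length c#}))"
    if c: "c \<in> set css" "w \<in> set c" for c w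
  proof -
    obtain ys css' where ys: "cycle_rep \<beta> R ((x # us) # (w # ys) # css')" "length c = Suc (length ys)"
      "mset (map length css') = ?M - {#length c#}"
      by (rule cycle_rep_star_front[OF r c]) (rule that)
    have w: "w \<in> R" using ys(1) unfolding cycle_rep_def by auto
    note e = Suc.IH[OF finite_Diff[OF fin, of "{w}"] peel_permutes[OF p x w]
        cycle_rep_peel_merge(1)[OF ys(1) p] cw(1)[OF w]]
    show ?thesis unfolding V_def e ys(3) cw(2)[OF w]
      using cycle_rep_peel_merge(2)[OF ys(1) p] by (simp add: F_def ys(2))
  qed
  have RU: "R - {x} = set us \<union> \<Union>(set ` set css)" "set us \<inter> \<Union>(set ` set css) = {}"
    using r unfolding cycle_rep_def by auto
  have dus: "distinct us" using d by simp
  have repcss: "cycle_rep \<beta> (\<Union>(set ` set css)) css" using r unfolding cycle_rep_def by auto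
  have s1: "(\<Sum>w\<in>set us. V w) = (\<Sum>i<length us. V (us ! i))"
    by (rule sum.reindex_bij_betw[symmetric]) (use bij_betw_nth[OF dus] in auto)
  have s2: "(\<Sum>w\<in>\<Union>(set ` set css). V w)
      = (\<Sum>s\<in>#?M. of_nat s * smult F (?S (length us + s - 1) (?M - {#s#})))"
    by (rule sum_over_cycles[OF repcss]) (rule Vc)
  have s2': "(\<Sum>w\<in>\<Union>(set ` set css). V w)
      = smult F (\<Sum>s\<in>#?M. smult (real s) (?S (length us + s - 1) (?M - {#s#})))"
    unfolding s2 by (rule sum_mset_of_nat_smult)
  have card_eq: "card R - 1 = length us + sum_mset ?M"
  proof -
    have "card R = length (concat ((x # us) # css))"
      using r distinct_card[of "concat ((x # us) # css)"] unfolding cycle_rep_def by simp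
    moreover have "sum_mset ?M = sum_list (map length css)" by (rule sum_mset_sum_list)
    ultimately show ?thesis by (simp add: length_concat)
  qed
  have "(\<Sum>ys\<in>permutations_of_set (R - {x}).
        X1 ^ num_cycles R (cyc_prod as (drop (Suc b) ys) \<circ> cyc_through x (take (Suc b) ys) \<circ> \<beta>)) = (\<Sum>w\<in>R - {x}. V w)"
    unfolding sum_permutations_of_set_Cons[OF finite_Diff[OF fin] ne]
    by (rule sum.cong[OF refl]) (rule Vw)
  also have "\<dots> = (\<Sum>w\<in>set us. V w) + (\<Sum>w\<in>\<Union>(set ` set css). V w)"
    unfolding RU(1) by (rule sum.union_disjoint) (use RU in auto)
  also have "\<dots> = smult F ((\<Sum>i<length us. closing (length us - 1 - i) * ?S i (add_part (length us - 1 - i) ?M))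
      + (\<Sum>s\<in>#?M. smult (real s) (?S (length us + s - 1) (?M - {#s#}))))"
    unfolding s1 s2' smult_add_right using Vus by (simp add: smult_sum_right)
  also have "\<dots> = smult (fact (card R - 1)) (cycle_avg (type_avg as) (Suc b) (length us) ?M)"
  proof -
    have "card R - 1 = Suc (card R - 2)" using c2 by simp
    then have "(fact (card R - 1) :: real) = real (card R - 1) * F"
      using fact_Suc[of "card R - 2", where 'a = real] by (simp only: F_def)
    moreover have "real (card R - 1) \<noteq> 0" using c2 by simp
    ultimately have "fact (card R - 1) * (1 / real (length us + sum_mset ?M)) = F"
      unfolding card_eq by (simp del: of_nat_add)
    then show ?thesis unfolding cycle_avg.simps smult_smult by (simp only:)
  qed
  finally show ?case .
qed

text \<open>The sum runs over all orderings of the points rather than over the conjugacy class; every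
  element of the class arises from the same number of orderings, so this is the class average
  multiplied by \<open>n!\<close>.\<close>

lemma sum_perms_type_avg:
  fixes \<beta> :: "'a \<Rightarrow> 'a"
  assumes "\<forall>a\<in>set as. a \<ge> 1" "finite R" "\<beta> permutes R" "cycle_rep \<beta> R css" "sum_list as = card R"
  shows "(\<Sum>xs\<in>permutations_of_set R. X1 ^ num_cycles R (cyc_prod as xs \<circ> \<beta>))
        = smult (fact (card R)) (type_avg as (mset (map length css)))"
  using assms
proof (induction as arbitrary: R \<beta> css)
  case Nil
  then show ?case by (simp add: num_cycles_def)
next
  case (Cons a as)
  note r = Cons.prems(4) and p = Cons.prems(3) and fin = Cons.prems(2)
  let ?M = "mset (map length css)"
  define F where "F = (fact (card R - 1) :: real)"
  have a1: "a \<ge> 1" using Cons.prems by simp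
  have c1: "card R \<ge> 1" using Cons.prems by auto
  then have ne: "R \<noteq> {}" by auto
  let ?V = "\<lambda>x. \<Sum>ys\<in>permutations_of_set (R - {x}). X1 ^ num_cycles R (cyc_prod (a # as) (x # ys) \<circ> \<beta>)"
  have V: "?V x = smult F (cycle_avg (type_avg as) (a - 1) (length c - 1) (?M - {#length c#}))"
    if c: "c \<in> set css" "x \<in> set c" for c x
  proof -
    obtain us css' where us: "cycle_rep \<beta> R ((x # us) # css')" "length c = Suc (length us)"
      "mset css = add_mset c (mset css')"
      by (rule cycle_rep_front[OF r c]) (rule that)
    have M: "mset (map length css') = ?M - {#length c#}" using us(3) by simp
    have eq: "cyc_prod (a # as) (x # ys) = cyc_prod as (drop (a - 1) ys) \<circ> cyc_through x (take (a - 1) ys)" for ys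
      using a1 by (cases a) auto
    have as: "\<forall>a\<in>set as. a \<ge> 1" using Cons.prems by simp
    have sm: "sum_list as + (a - 1) + 1 = card R" using Cons.prems a1 by simp
    note e = sum_star_perms[OF as Cons.IH[OF as] fin p us(1) sm]
    have f: "smult (fact (card R - 1)) (cycle_avg (type_avg as) (a - 1) (length us) (mset (map length css')))
        = smult F (cycle_avg (type_avg as) (a - 1) (length c - 1) (?M - {#length c#}))"
      unfolding M F_def us(2) by simp
    show ?thesis unfolding eq by (rule trans[OF e f])
  qed
  have card_eq: "card R = sum_mset ?M"
  proof -
    have "card R = length (concat css)"
      using r distinct_card[of "concat css"] unfolding cycle_rep_def by simp
    moreover have "sum_mset ?M = sum_list (map length css)" by (rule sum_mset_sum_list)
    ultimately show ?thesis by (simp add: length_concat)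
  qed
  have "(\<Sum>xs\<in>permutations_of_set R. X1 ^ num_cycles R (cyc_prod (a # as) xs \<circ> \<beta>)) = (\<Sum>x\<in>R. ?V x)"
    by (rule sum_permutations_of_set_Cons[OF fin ne])
  also have "\<dots> = (\<Sum>s\<in>#?M. of_nat s * smult F (cycle_avg (type_avg as) (a - 1) (s - 1) (?M - {#s#})))"
    by (rule sum_over_cycles[OF r]) (rule V)
  also have "\<dots> = smult F (\<Sum>s\<in>#?M. smult (real s) (cycle_avg (type_avg as) (a - 1) (s - 1) (?M - {#s#})))"
    by (rule sum_mset_of_nat_smult)
  also have "\<dots> = smult (fact (card R)) (type_avg (a # as) ?M)"
  proof -
    have "Suc (card R - 1) = card R" using c1 by simp
    then have "(fact (card R) :: real) = real (card R) * F"
      using fact_Suc[of "card R - 1", where 'a = real] by (simp only: F_def)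
    moreover have "real (card R) \<noteq> 0" using c1 by simp
    ultimately have "fact (card R) * (1 / real (sum_mset ?M)) = F"
      unfolding card_eq by (simp del: of_nat_add)
    then show ?thesis unfolding type_avg.simps smult_smult by (simp only:)
  qed
  finally show ?case .
qed

section \<open>Commutators with a random permutation\<close>

text \<open>It serves to arrange the cycles of \<open>\<sigma>\<close> so that their lengths come in a prescribed order.\<close>

lemma mset_map_reorder:
  assumes "mset as = mset (map f xs)"
  shows "\<exists>ys. mset ys = mset xs \<and> map f ys = as"
  using assms
proof (induction as arbitrary: xs)
  case Nil
  then show ?case by simp
next
  case (Cons a as)
  have "a \<in> set (map f xs)" using Cons.prems by (metis list.set_intros(1) mset_eq_setD)
  then obtain x where x: "x \<in> set xs" "f x = a" by auto
  obtain zs where mx: "mset xs = add_mset x (mset zs)"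
  proof
    show "mset xs = add_mset x (mset (remove1 x xs))" using x by simp
  qed
  have "add_mset a (mset as) = image_mset f (mset xs)" using Cons.prems by simp
  then have "mset as = mset (map f zs)" unfolding mx by (simp add: x(2))
  then obtain ys where ys: "mset ys = mset zs" "map f ys = as" using Cons.IH by blast
  show ?case by (rule exI[of _ "x # ys"]) (use x ys mx in simp)
qed

lemma cyc_through_traverses:
  assumes "distinct (x # ws)"
  shows "map (cyc_through x ws) (x # ws) = ws @ [x]"
  using assms
proof (induction ws)
  case Nil
  then show ?case by simp
next
  case (Cons w ws)
  have IH: "map (cyc_through x ws) (x # ws) = ws @ [x]" using Cons by simp
  have p: "cyc_through x ws permutes set (x # ws)" by (rule cyc_through_permutes) auto
  have w: "cyc_through x ws w = w" using p Cons.prems by (intro permutes_not_in[OF p]) auto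
  have m: "map (cyc_through x (w # ws)) ws = map (cyc_through x ws) ws"
    using Cons.prems by (intro map_cong refl) (auto simp: Transposition.transpose_def)
  have a: "cyc_through x (w # ws) x = w" using w by simp
  have b: "cyc_through x (w # ws) w = cyc_through x ws x" by simp
  have "map (cyc_through x (w # ws)) (x # w # ws) = w # map (cyc_through x ws) (x # ws)"
    by (simp only: list.map a b m)
  also have "\<dots> = w # (ws @ [x])" by (simp only: IH)
  also have "\<dots> = (w # ws) @ [x]" by simp
  finally show ?case .
qed

lemma cycle_rep_cyc_prod:
  assumes "distinct (concat css)" "[] \<notin> set css"
  shows "cycle_rep (cyc_prod (map length css) (concat css)) (set (concat css)) css"
  using assms
proof (induction css)
  case Nil
  then show ?case by (simp add: cycle_rep_def)
next
  case (Cons c css)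
  have IH: "cycle_rep (cyc_prod (map length css) (concat css)) (set (concat css)) css"
    using Cons by simp
  obtain x ws where c: "c = x # ws" using Cons.prems by (cases c) auto
  let ?g = "cyc_prod (map length css) (concat css)" and ?t = "cyc_through x ws"
  have eq: "cyc_prod (map length (c # css)) (concat (c # css)) = ?g \<circ> ?t" by (simp add: c)
  have g: "?g permutes set (concat css)"
    using Cons.prems by (intro cyc_prod_permutes) (auto simp: length_concat Suc_le_eq)
  have t: "?t permutes set c" unfolding c by (rule cyc_through_permutes) auto
  have dd: "set c \<inter> set (concat css) = {}" "distinct c" using Cons.prems by auto
  have "map (?g \<circ> ?t) c = map ?g (rotate1 c)"
    using cyc_through_traverses[of x ws] dd(2) unfolding c by (metis list.map_comp rotate1_snoc)
  also have "\<dots> = rotate1 c"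
    by (rule map_idI) (use dd(1) in \<open>auto intro!: permutes_not_in[OF g]\<close>)
  finally have 1: "map (?g \<circ> ?t) c = rotate1 c" .
  have 2: "map (?g \<circ> ?t) d = rotate1 d" if d: "d \<in> set css" for d
  proof -
    have "map (?g \<circ> ?t) d = map ?g d"
    proof (intro map_cong refl)
      fix y assume "y \<in> set d"
      then have "y \<notin> set c" using dd(1) d by auto
      then show "(?g \<circ> ?t) y = ?g y" by (simp add: permutes_not_in[OF t])
    qed
    then show ?thesis using IH d unfolding cycle_rep_def by simp
  qed
  show ?case unfolding eq using 1 2 Cons.prems
    unfolding cycle_rep_def by (metis set_ConsD)
qed

lemma cyc_through_map:
  assumes "inj \<tau>"
  shows "cyc_through (\<tau> x) (map \<tau> ws) \<circ> \<tau> = \<tau> \<circ> cyc_through x ws"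
proof (induction ws)
  case (Cons w ws)
  have "Transposition.transpose (\<tau> x) (\<tau> w) \<circ> \<tau> = \<tau> \<circ> Transposition.transpose x w"
    using assms by (auto simp: fun_eq_iff Transposition.transpose_def inj_eq)
  then show ?case using Cons by (metis comp_assoc cyc_through.simps(2) list.simps(9))
qed simp

lemma cyc_prod_map:
  assumes "inj \<tau>" "sum_list as \<le> length xs" "\<forall>a\<in>set as. a \<ge> 1"
  shows "cyc_prod as (map \<tau> xs) \<circ> \<tau> = \<tau> \<circ> cyc_prod as xs"
  using assms(2,3)
proof (induction as arbitrary: xs)
  case (Cons a as)
  obtain y ys where ys: "xs = y # ys" using Cons.prems by (cases xs) auto
  have dr: "drop a (map \<tau> xs) = map \<tau> (drop a xs)" by (rule drop_map)
  have hd: "hd (map \<tau> xs) = \<tau> (hd xs)" by (simp add: ys)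
  have tl: "take (a - 1) (tl (map \<tau> xs)) = map \<tau> (take (a - 1) (tl xs))" by (simp add: ys take_map)
  have IH: "cyc_prod as (map \<tau> (drop a xs)) \<circ> \<tau> = \<tau> \<circ> cyc_prod as (drop a xs)"
    using Cons.prems by (intro Cons.IH) auto
  have t: "cyc_through (\<tau> (hd xs)) (map \<tau> (take (a - 1) (tl xs))) \<circ> \<tau>
      = \<tau> \<circ> cyc_through (hd xs) (take (a - 1) (tl xs))"
    by (rule cyc_through_map[OF assms(1)])
  have "cyc_prod (a # as) (map \<tau> xs) \<circ> \<tau>
      = cyc_prod as (map \<tau> (drop a xs)) \<circ> (cyc_through (\<tau> (hd xs)) (map \<tau> (take (a - 1) (tl xs))) \<circ> \<tau>)"
    by (simp only: cyc_prod.simps dr hd tl comp_assoc)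
  also have "\<dots> = \<tau> \<circ> cyc_prod (a # as) xs" unfolding t comp_assoc[symmetric] IH by (simp add: comp_assoc)
  finally show ?case .
qed simp

lemma num_cycles_conj:
  assumes "finite R" "\<pi> permutes R" "\<tau> permutes R"
  shows "num_cycles R (inv \<tau> \<circ> \<pi> \<circ> \<tau>) = num_cycles R \<pi>"
proof -
  obtain css where r: "cycle_rep \<pi> R css" using cycle_rep_exists[OF assms(1,2)] by blast
  have ii: "inj (inv \<tau>)" using assms(3) by (intro permutes_inj[OF permutes_inv])
  have "cycle_rep (inv \<tau> \<circ> \<pi> \<circ> \<tau>) R (map (map (inv \<tau>)) css)"
    unfolding cycle_rep_def
  proof (intro conjI)
    have cc: "concat (map (map (inv \<tau>)) css) = map (inv \<tau>) (concat css)" by (simp add: map_concat)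
    show "distinct (concat (map (map (inv \<tau>)) css))"
      unfolding cc using r ii unfolding cycle_rep_def distinct_map by (meson inj_on_subset subset_UNIV)
    show "set (concat (map (map (inv \<tau>)) css)) = R"
      unfolding cc set_map using r permutes_image[OF permutes_inv[OF assms(3)]] unfolding cycle_rep_def by simp
    show "\<forall>c\<in>set (map (map (inv \<tau>)) css). c \<noteq> [] \<and> map (inv \<tau> \<circ> \<pi> \<circ> \<tau>) c = rotate1 c"
    proof
      fix c assume "c \<in> set (map (map (inv \<tau>)) css)"
      then obtain d where d: "d \<in> set css" "c = map (inv \<tau>) d" by auto
      have "map (inv \<tau> \<circ> \<pi> \<circ> \<tau>) c = map (inv \<tau>) (map \<pi> d)"
        unfolding d(2) map_map using permutes_inverses[OF assms(3)] by (intro map_cong) auto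
      also have "\<dots> = rotate1 c" using r d unfolding cycle_rep_def by (simp add: rotate1_map)
      finally show "c \<noteq> [] \<and> map (inv \<tau> \<circ> \<pi> \<circ> \<tau>) c = rotate1 c"
        using r d unfolding cycle_rep_def by auto
    qed
  qed
  then show ?thesis using num_cycles_cycle_rep r by (metis length_map)
qed

text \<open>If \<open>xs\<close> lists all points and \<open>\<tau>\<close> is uniform, then the image of \<open>xs\<close> under \<open>inv \<tau>\<close> is a
  uniform ordering of the points.\<close>

lemma sum_over_conjugating_permutations:
  assumes "finite R" "xs \<in> permutations_of_set R"
  shows "(\<Sum>\<tau> | \<tau> permutes R. F (map (inv \<tau>) xs)) = (\<Sum>ys\<in>permutations_of_set R. F ys)"
proof -
  have xs: "set xs = R" using assms(2) by (auto dest: permutations_of_setD)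
  let ?P = "{\<tau>. \<tau> permutes R}" and ?f = "\<lambda>\<tau>. map (inv \<tau>) xs"
  have inj: "inj_on ?f ?P"
  proof (rule inj_onI)
    fix a b assume ab: "a \<in> ?P" "b \<in> ?P" "map (inv a) xs = map (inv b) xs"
    then have p: "a permutes R" "b permutes R" by auto
    have "inv a = inv b"
    proof
      fix y show "inv a y = inv b y"
        using ab(3) xs permutes_not_in[OF permutes_inv[OF p(1)], of y] permutes_not_in[OF permutes_inv[OF p(2)], of y]
        by (cases "y \<in> R") auto
    qed
    then show "a = b" using permutes_inv_inv p by metis
  qed
  have sub: "?f ` ?P \<subseteq> permutations_of_set R"
  proof
    fix ys assume "ys \<in> ?f ` ?P"
    then obtain a where a: "a permutes R" "ys = map (inv a) xs" by auto
    have "map (inv a) xs \<in> map (inv a) ` permutations_of_set R" using assms(2) by blast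
    then show "ys \<in> permutations_of_set R"
      unfolding a(2) using permutations_of_set_image_permutes[OF permutes_inv[OF a(1)]] by simp
  qed
  have "card (?f ` ?P) = card (permutations_of_set R)"
    using card_image[OF inj] card_permutations[OF refl assms(1)] assms(1) by simp
  then have "?f ` ?P = permutations_of_set R"
    using sub by (intro card_subset_eq) auto
  then show ?thesis using sum.reindex[OF inj, of F] by (simp add: comp_def)
qed

text \<open>Conjugating the commutator by \<open>\<tau>\<close> gives \<open>(inv \<tau> \<circ> \<sigma> \<circ> \<tau>) \<circ> inv \<sigma>\<close>: the first factor is \<open>\<sigma>\<close>
  with its cycles relabelled by \<open>inv \<tau>\<close>, so it comes from a uniform ordering of the points,
  and the second is fixed and has the cycle type of \<open>\<sigma>\<close>.\<close>

lemma sum_commutator_cycles: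
  assumes fin: "finite R" and s: "\<sigma> permutes R"
    and as: "mset as = image_mset card (mset_set (orbit \<sigma> ` R))"
  shows "(\<Sum>\<tau> | \<tau> permutes R. X1 ^ num_cycles R (\<sigma> \<circ> \<tau> \<circ> inv \<sigma> \<circ> inv \<tau>))
      = smult (fact (card R)) (type_avg as (mset as))"
proof -
  obtain css0 where r0: "cycle_rep \<sigma> R css0" using cycle_rep_exists[OF fin s] by blast
  have "mset as = mset (map length css0)" using cycle_type_cycle_rep[OF r0] as by simp
  then obtain css where css: "mset css = mset css0" "map length css = as"
    using mset_map_reorder by blast
  have r: "cycle_rep \<sigma> R css" using cycle_rep_perm[OF r0 css(1)] .
  let ?xs = "concat css"
  have xs: "distinct ?xs" "set ?xs = R" "[] \<notin> set css" using r unfolding cycle_rep_def by auto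
  have xsP: "?xs \<in> permutations_of_set R" by (rule permutations_of_setI[OF xs(2,1)])
  have a1: "\<forall>a\<in>set as. a \<ge> 1" using xs(3) css(2) by (auto simp: Suc_le_eq)
  have ls: "sum_list as = length ?xs" using css(2) by (simp add: length_concat)
  then have sc: "sum_list as = card R" using xs distinct_card by metis
  have "cycle_rep (cyc_prod as ?xs) R css" using cycle_rep_cyc_prod[OF xs(1,3)] xs(2) css(2) by simp
  moreover have "cyc_prod as ?xs permutes R" using xs a1 ls by (intro cyc_prod_permutes) auto
  ultimately have sig: "\<sigma> = cyc_prod as ?xs" using cycle_rep_unique[OF r _ s] by blast
  have si: "inv \<sigma> permutes R" using s by (rule permutes_inv)
  obtain css' where r': "cycle_rep (inv \<sigma>) R css'" using cycle_rep_exists[OF fin si] by blast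
  have perm: "permutation \<sigma>" using s fin by (meson permutation_permutes)
  have "orbit (inv \<sigma>) x = orbit \<sigma> x" for x using orbit_inv_eq[OF perm] by simp
  then have type': "mset (map length css') = mset as" using cycle_type_cycle_rep[OF r'] as by simp
  have "(\<Sum>\<tau> | \<tau> permutes R. X1 ^ num_cycles R (\<sigma> \<circ> \<tau> \<circ> inv \<sigma> \<circ> inv \<tau>))
      = (\<Sum>\<tau> | \<tau> permutes R. X1 ^ num_cycles R (cyc_prod as (map (inv \<tau>) ?xs) \<circ> inv \<sigma>))"
  proof (rule sum.cong[OF refl])
    fix \<tau> assume "\<tau> \<in> {\<tau>. \<tau> permutes R}"
    then have t: "\<tau> permutes R" by simp
    have ti: "inv \<tau> permutes R" using t by (rule permutes_inv)
    have "cyc_prod as (map (inv \<tau>) ?xs) \<circ> inv \<tau> = inv \<tau> \<circ> \<sigma>"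
      unfolding sig by (rule cyc_prod_map) (use ls a1 permutes_inj[OF ti] in auto)
    then have "cyc_prod as (map (inv \<tau>) ?xs) \<circ> inv \<tau> \<circ> \<tau> = inv \<tau> \<circ> \<sigma> \<circ> \<tau>" by simp
    then have e: "cyc_prod as (map (inv \<tau>) ?xs) = inv \<tau> \<circ> \<sigma> \<circ> \<tau>"
      by (simp add: comp_assoc permutes_inv_o[OF t])
    have q: "\<sigma> \<circ> \<tau> \<circ> inv \<sigma> \<circ> inv \<tau> permutes R"
      using s t si ti by (intro permutes_compose)
    have "inv \<tau> \<circ> (\<sigma> \<circ> \<tau> \<circ> inv \<sigma> \<circ> inv \<tau>) \<circ> \<tau> = cyc_prod as (map (inv \<tau>) ?xs) \<circ> inv \<sigma>"
      unfolding e by (simp add: comp_assoc permutes_inv_o[OF t])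
    then show "X1 ^ num_cycles R (\<sigma> \<circ> \<tau> \<circ> inv \<sigma> \<circ> inv \<tau>)
        = X1 ^ num_cycles R (cyc_prod as (map (inv \<tau>) ?xs) \<circ> inv \<sigma>)"
      using num_cycles_conj[OF fin q t] by simp
  qed
  also have "\<dots> = (\<Sum>ys\<in>permutations_of_set R. X1 ^ num_cycles R (cyc_prod as ys \<circ> inv \<sigma>))"
    by (rule sum_over_conjugating_permutations[OF fin xsP])
  also have "\<dots> = smult (fact (card R)) (type_avg as (mset as))"
    using sum_perms_type_avg[OF a1 fin si r' sc] type' by simp
  finally show ?thesis .
qed

section \<open>Vertices are cycles of the commutator\<close>

lemma card_image_same_kernel:
  assumes "\<And>i j. i \<in> A \<Longrightarrow> j \<in> A \<Longrightarrow> f i = f j \<longleftrightarrow> g i = g j"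
  shows "card (f ` A) = card (g ` A)"
proof -
  have "bij_betw (\<lambda>y. g (inv_into A f y)) (f ` A) (g ` A)"
  proof (rule bij_betwI')
    fix y z assume "y \<in> f ` A" "z \<in> f ` A"
    then show "(g (inv_into A f y) = g (inv_into A f z)) = (y = z)"
      using assms[of "inv_into A f y" "inv_into A f z"] by (metis f_inv_into_f inv_into_into)
  next
    fix y assume "y \<in> f ` A"
    then show "g (inv_into A f y) \<in> g ` A" by (simp add: inv_into_into)
  next
    fix y assume "y \<in> g ` A"
    then obtain i where i: "i \<in> A" "y = g i" by auto
    have "g (inv_into A f (f i)) = g i"
      using assms[of "inv_into A f (f i)" i] i by (metis f_inv_into_f imageI inv_into_into)
    then show "\<exists>x\<in>f ` A. y = g (inv_into A f x)" using i by (intro bexI[of _ "f i"]) auto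
  qed
  then show ?thesis by (rule bij_betw_same_card)
qed

text \<open>Every corner is glued to the bottom left corner of some square, with label \<open>lab\<close>. Passing
  around the upper right corner of a square in the two possible ways identifies the labels
  \<open>\<sigma> (\<tau> j)\<close> and \<open>\<tau> (\<sigma> j)\<close>, which are one step of the commutator apart. Conversely the orbit of
  the label is unchanged by every gluing (\<open>key\<close>), so nothing else is identified.\<close>

lemma card_vertices:
  assumes s: "\<sigma> permutes {1..n}" and t: "\<tau> permutes {1..n}"
  shows "card (vertices n \<sigma> \<tau>) = num_cycles {1..n} (\<sigma> \<circ> \<tau> \<circ> inv \<sigma> \<circ> inv \<tau>)"
proof -
  let ?k = "\<sigma> \<circ> \<tau> \<circ> inv \<sigma> \<circ> inv \<tau>"
  have k: "?k permutes {1..n}" using s t by (intro permutes_compose permutes_inv)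
  have pk: "permutation ?k" using k by (meson finite_atLeastAtMost permutation_permutes)
  have kts: "?k (\<tau> (\<sigma> j)) = \<sigma> (\<tau> j)" for j
    using permutes_inverses[OF s] permutes_inverses[OF t] by simp
  have orb: "orbit ?k (\<sigma> (\<tau> j)) = orbit ?k (\<tau> (\<sigma> j))" for j
    using permutation_orbit_step[OF pk, of "\<tau> (\<sigma> j)"] unfolding kts by simp
  \<comment> \<open>the square whose bottom left corner is glued to the given corner\<close>
  define lab where "lab = (\<lambda>(j :: nat, x :: real, y :: real).
      if x = 1 then (if y = 1 then \<sigma> (\<tau> j) else \<sigma> j) else if y = 1 then \<tau> j else j)"
  define key where "key = (\<lambda>P :: nat \<times> real \<times> real. if fst (snd P) \<in> {0, 1} \<and> snd (snd P) \<in> {0, 1}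
      then Some (orbit ?k (lab P)) else None)"
  have key1: "key P = key Q" if "side_glued n \<sigma> \<tau> P Q" for P Q
    using that by cases (auto simp: key_def lab_def orb)
  have key: "key P = key Q" if "equivclp (side_glued n \<sigma> \<tau>) P Q" for P Q
    using that by (induction rule: equivclp_induct) (auto dest: key1)
  let ?c = "\<lambda>i. gluing n \<sigma> \<tau> `` {(i, 0, 0)}"
  have sin: "\<sigma> j \<in> {1..n} \<longleftrightarrow> j \<in> {1..n}" "\<tau> j \<in> {1..n} \<longleftrightarrow> j \<in> {1..n}" for j
    using s t by (auto simp del: atLeastAtMost_iff simp: permutes_in_image)
  let ?E = "equivclp (side_glued n \<sigma> \<tau>)"
  have RL: "?E (j, 1, y) (\<sigma> j, 0, y)" if "j \<in> {1..n}" "y \<in> {0..1}" for j y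
    using that by (intro r_into_equivclp right_left)
  have TB: "?E (j, x, 1) (\<tau> j, x, 0)" if "j \<in> {1..n}" "x \<in> {0..1}" for j x
    using that by (intro r_into_equivclp top_bottom)
  have corner: "?E (j, x, y) (lab (j, x, y), 0, 0)" if j: "j \<in> {1..n}" and xy: "x \<in> {0, 1}" "y \<in> {0, 1}" for j x y
  proof -
    have "?E (j, 1, 1) (\<tau> j, 1, 0)" using TB[OF j, of 1] by simp
    moreover have "?E (\<tau> j, 1, 0) (\<sigma> (\<tau> j), 0, 0)" by (rule RL) (use sin(2)[of j] j in auto)
    ultimately have "?E (j, 1, 1) (\<sigma> (\<tau> j), 0, 0)" by (rule equivclp_trans)
    then show ?thesis using xy RL[OF j, of 0] TB[OF j, of 0] by (auto simp: lab_def)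
  qed
  have labin: "lab (j, x, y) \<in> {1..n}" if "j \<in> {1..n}" for j x y
    using that sin by (auto simp: lab_def simp del: atLeastAtMost_iff)
  \<comment> \<open>both ways around the upper right corner of square \<open>j\<close>\<close>
  have kE: "?E (i, 0, 0) (?k i, 0, 0)" if i: "i \<in> {1..n}" for i
  proof -
    define j where "j = inv \<sigma> (inv \<tau> i)"
    have ts: "\<tau> (\<sigma> j) = i" unfolding j_def using permutes_inverses[OF s] permutes_inverses[OF t] by simp
    have j: "j \<in> {1..n}" using i ts sin by metis
    have st: "\<sigma> (\<tau> j) = ?k i" using kts[of j] ts by simp
    have "?E (j, 1, 1) (\<sigma> j, 0, 1)" using RL[OF j, of 1] by simp
    moreover have "?E (\<sigma> j, 0, 1) (\<tau> (\<sigma> j), 0, 0)" by (rule TB) (use sin(1)[of j] j in auto)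
    ultimately have "?E (j, 1, 1) (\<tau> (\<sigma> j), 0, 0)" by (rule equivclp_trans)
    moreover have "?E (j, 1, 1) (\<sigma> (\<tau> j), 0, 0)" using corner[OF j, of 1 1] by (simp add: lab_def)
    ultimately show ?thesis unfolding ts st by (meson equivclp_sym equivclp_trans)
  qed
  have orbE: "?E (i, 0, 0) (j, 0, 0) \<and> j \<in> {1..n}" if "j \<in> orbit ?k i" "i \<in> {1..n}" for i j
    using that
  proof (induction rule: orbit.induct)
    case base
    then show ?case using kE[of i] k by (simp add: permutes_in_image del: atLeastAtMost_iff o_apply)
  next
    case (step j)
    then show ?case using kE[of j] k
      by (auto intro: equivclp_trans simp: permutes_in_image simp del: atLeastAtMost_iff o_apply)
  qed
  have sq: "(i, 0, 0) \<in> squares n" if "i \<in> {1..n}" for i using that by (simp add: squares_def)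
  have ker: "?c i = ?c j \<longleftrightarrow> orbit ?k i = orbit ?k j" if ij: "i \<in> {1..n}" "j \<in> {1..n}" for i j
  proof -
    have "?c i = ?c j \<longleftrightarrow> ((i, 0, 0), (j, 0, 0)) \<in> gluing n \<sigma> \<tau>"
      using eq_equiv_class_iff[OF equiv_gluing sq[OF ij(1)] sq[OF ij(2)]] .
    also have "\<dots> \<longleftrightarrow> ?E (i, 0, 0) (j, 0, 0)" using sq ij by (simp add: gluing_def)
    also have "\<dots> \<longleftrightarrow> orbit ?k i = orbit ?k j"
    proof
      assume "?E (i, 0, 0) (j, 0, 0)"
      from key[OF this] show "orbit ?k i = orbit ?k j" by (simp add: key_def lab_def)
    next
      assume "orbit ?k i = orbit ?k j"
      moreover have "j \<in> orbit ?k j" using permutation_self_in_orbit[OF pk] .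
      ultimately show "?E (i, 0, 0) (j, 0, 0)" using orbE ij by metis
    qed
    finally show ?thesis .
  qed
  have "vertices n \<sigma> \<tau> = ?c ` {1..n}"
  proof
    show "vertices n \<sigma> \<tau> \<subseteq> ?c ` {1..n}"
    proof
      fix v assume v: "v \<in> vertices n \<sigma> \<tau>"
      then have "v \<inter> ({1..n} \<times> {0, 1} \<times> {0, 1}) \<noteq> {}" by (simp add: vertices_def)
      then obtain P where P0: "P \<in> v" "P \<in> {1..n} \<times> {0, 1} \<times> {0, 1}" by blast
      obtain j x y where Pe: "P = (j, x, y)" by (cases P)
      have P: "(j, x, y) \<in> v" "j \<in> {1..n}" "x \<in> {0, 1}" "y \<in> {0, 1}" using P0 unfolding Pe by auto
      have vq: "v \<in> squares n // gluing n \<sigma> \<tau>" using v by (simp add: vertices_def square_tiled_surface_def)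
      then have ve: "v = gluing n \<sigma> \<tau> `` {(j, x, y)}" using P(1)
        by (metis Image_singleton_iff equiv_class_eq equiv_gluing quotientE)
      have "(j, x, y) \<in> squares n" using P by (auto simp: squares_def)
      then have "((j, x, y), (lab (j, x, y), 0, 0)) \<in> gluing n \<sigma> \<tau>"
        using corner[OF P(2-4)] sq[OF labin[OF P(2)]] by (simp add: gluing_def)
      then have "v = ?c (lab (j, x, y))" unfolding ve by (rule equiv_class_eq[OF equiv_gluing])
      then show "v \<in> ?c ` {1..n}" using labin[OF P(2)] by blast
    qed
    show "?c ` {1..n} \<subseteq> vertices n \<sigma> \<tau>"
    proof
      fix v assume "v \<in> ?c ` {1..n}"
      then obtain i where i: "i \<in> {1..n}" "v = ?c i" by auto
      have "v \<in> squares n // gluing n \<sigma> \<tau>" unfolding i(2) by (rule quotientI[OF sq[OF i(1)]])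
      moreover have "(i, 0, 0) \<in> v" unfolding i(2) by (rule equiv_class_self[OF equiv_gluing sq[OF i(1)]])
      moreover have "(i, 0, 0) \<in> {1..n} \<times> {0, 1 :: real} \<times> {0, 1 :: real}" using i(1) by simp
      ultimately show "v \<in> vertices n \<sigma> \<tau>"
        unfolding vertices_def square_tiled_surface_def by blast
    qed
  qed
  then show ?thesis unfolding num_cycles_def by (simp only:) (rule card_image_same_kernel, rule ker)
qed

section \<open>Weighted coefficient norms and the uniform permutation\<close>

text \<open>For \<open>z = 1 / ln n\<close> a bound on this norm bounds the coefficient at \<open>X^j\<close> by \<open>(ln n)^j\<close> times
  the same bound. The norm is submultiplicative, so products of linear factors are easy to
  estimate.\<close>

definition coeff_norm :: "real \<Rightarrow> real poly \<Rightarrow> real" where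
  "coeff_norm z P = poly (map_poly abs P) z"

lemma coeff_norm_0 [simp]: "coeff_norm z 0 = 0"
  by (simp add: coeff_norm_def)

lemma coeff_norm_pCons [simp]: "coeff_norm z (pCons a p) = \<bar>a\<bar> + z * coeff_norm z p"
  by (simp add: coeff_norm_def map_poly_pCons)

lemma coeff_norm_1 [simp]: "coeff_norm z 1 = 1"
  by (simp add: one_pCons)

lemma coeff_norm_nonneg: "0 \<le> z \<Longrightarrow> 0 \<le> coeff_norm z P"
  by (induction P) auto

lemma coeff_norm_triangle: "0 \<le> z \<Longrightarrow> coeff_norm z (P + Q) \<le> coeff_norm z P + coeff_norm z Q"
proof (induction P arbitrary: Q)
  case (pCons a p)
  obtain b q where Q: "Q = pCons b q" by (cases Q)
  have "z * coeff_norm z (p + q) \<le> z * (coeff_norm z p + coeff_norm z q)"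
    using pCons by (intro mult_left_mono) auto
  then show ?case unfolding Q using abs_triangle_ineq[of a b] by (simp add: algebra_simps)
qed simp

lemma coeff_norm_smult: "coeff_norm z (smult c P) = \<bar>c\<bar> * coeff_norm z P"
  by (induction P) (auto simp: abs_mult algebra_simps)

lemma coeff_norm_mult: "0 \<le> z \<Longrightarrow> coeff_norm z (P * Q) \<le> coeff_norm z P * coeff_norm z Q"
proof (induction P)
  case (pCons a p)
  have "coeff_norm z (pCons a p * Q) \<le> coeff_norm z (smult a Q) + coeff_norm z (pCons 0 (p * Q))"
    unfolding mult_pCons_left by (rule coeff_norm_triangle[OF pCons.prems])
  also have "\<dots> = \<bar>a\<bar> * coeff_norm z Q + z * coeff_norm z (p * Q)" by (simp add: coeff_norm_smult)
  also have "z * coeff_norm z (p * Q) \<le> z * (coeff_norm z p * coeff_norm z Q)"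
    using pCons by (intro mult_left_mono) auto
  finally show ?case by (simp add: algebra_simps)
qed simp

lemma coeff_norm_sum: "0 \<le> z \<Longrightarrow> coeff_norm z (\<Sum>i\<in>A. f i) \<le> (\<Sum>i\<in>A. coeff_norm z (f i))"
proof (induction A rule: infinite_finite_induct)
  case (insert x F)
  then show ?case using coeff_norm_triangle[of z "f x" "sum f F"] by simp
qed auto

lemma coeff_norm_sum_mset: "0 \<le> z \<Longrightarrow> coeff_norm z (\<Sum>i\<in>#A. f i) \<le> (\<Sum>i\<in>#A. coeff_norm z (f i))"
proof (induction A)
  case (add x F)
  then show ?case using coeff_norm_triangle[of z "f x" "\<Sum>i\<in>#F. f i"] by simp
qed auto

lemma coeff_norm_prod: "0 \<le> z \<Longrightarrow> coeff_norm z (\<Prod>i\<in>A. f i) \<le> (\<Prod>i\<in>A. coeff_norm z (f i))"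
proof (induction A rule: infinite_finite_induct)
  case (insert x F)
  have "coeff_norm z (f x * prod f F) \<le> coeff_norm z (f x) * coeff_norm z (prod f F)"
    using insert by (intro coeff_norm_mult)
  also have "\<dots> \<le> coeff_norm z (f x) * (\<Prod>i\<in>F. coeff_norm z (f i))"
    using insert by (intro mult_left_mono coeff_norm_nonneg) auto
  finally show ?case using insert by simp
qed auto

lemma coeff_le_coeff_norm: "0 \<le> z \<Longrightarrow> \<bar>coeff P j\<bar> * z ^ j \<le> coeff_norm z P"
proof (induction P arbitrary: j)
  case (pCons a p)
  show ?case
  proof (cases j)
    case 0
    then show ?thesis using coeff_norm_nonneg[OF pCons.prems, of p] pCons.prems by simp
  next
    case (Suc i)
    have "z * (\<bar>coeff p i\<bar> * z ^ i) \<le> z * coeff_norm z p" using pCons by (intro mult_left_mono) auto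
    then show ?thesis using Suc abs_ge_zero[of a] by (simp add: algebra_simps)
  qed
qed (simp add: coeff_norm_def)

text \<open>The polynomial \<open>E[(1 + X)^C]\<close> for the number \<open>C\<close> of cycles of a uniform permutation of \<open>m\<close>
  points. Its norm is at most \<open>growth z m\<close>, which is bounded for \<open>z = 1 / ln m\<close>.\<close>

definition U :: "nat \<Rightarrow> real poly" where "U m = (\<Prod>i=1..m. [:1, 1 / real i:])"

definition growth :: "real \<Rightarrow> nat \<Rightarrow> real" where "growth c m = (\<Prod>i=1..m. 1 + c / real i)"

lemma U_0 [simp]: "U 0 = 1" by (simp add: U_def)
lemma U_Suc: "U (Suc m) = U m * [:1, 1 / real (Suc m):]" by (simp add: U_def)
lemma growth_0 [simp]: "growth c 0 = 1" by (simp add: growth_def)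
lemma growth_Suc: "growth c (Suc m) = growth c m * (1 + c / real (Suc m))" by (simp add: growth_def)

lemma growth_ge_1: "0 \<le> c \<Longrightarrow> 1 \<le> growth c m"
  unfolding growth_def by (rule prod_ge_1) simp

lemma growth_mono: "0 \<le> c \<Longrightarrow> m \<le> n \<Longrightarrow> growth c m \<le> growth c n"
proof (induction n)
  case (Suc n)
  have "growth c n * 1 \<le> growth c n * (1 + c / real (Suc n))"
    using Suc.prems growth_ge_1[of c n] by (intro mult_left_mono) auto
  then show ?case using Suc by (cases "m = Suc n") (auto simp: growth_Suc)
qed simp

lemma coeff_norm_U: "0 \<le> z \<Longrightarrow> coeff_norm z (U m) \<le> growth z m"
  unfolding U_def growth_def
  by (rule order_trans[OF coeff_norm_prod]) (auto intro!: prod_mono)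

lemma growth_le_exp: "0 \<le> c \<Longrightarrow> growth c m \<le> exp (c * harm m)"
proof (induction m)
  case (Suc m)
  have "growth c m * (1 + c / real (Suc m)) \<le> exp (c * harm m) * exp (c / real (Suc m))"
    using Suc growth_ge_1[of c m] by (intro mult_mono) (auto simp del: of_nat_Suc intro!: exp_ge_add_one_self)
  then show ?case by (simp add: growth_Suc harm_Suc exp_add[symmetric] algebra_simps divide_inverse)
qed (simp add: harm_def)

text \<open>This is the binomial coefficient \<open>X + M - s\<close> choose \<open>M\<close>, as a polynomial in \<open>X\<close>. The shift
  \<open>s = 0\<close> gives \<open>U M\<close>.\<close>

definition shifted_binomial :: "nat \<Rightarrow> nat \<Rightarrow> real poly" where
  "shifted_binomial M s = smult (1 / fact M) (\<Prod>i<M. [:real i + 1 - real s, 1:])"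

lemma shifted_binomial_0: "shifted_binomial M 0 = U M"
proof (induction M)
  case (Suc M)
  have "shifted_binomial (Suc M) 0 = smult (1 / real (Suc M)) (shifted_binomial M 0 * [:real M + 1, 1:])"
    by (simp add: shifted_binomial_def mult.commute)
  also have "\<dots> = U M * smult (1 / real (Suc M)) [:real M + 1, 1:]"
    unfolding Suc by (simp only: mult_smult_right)
  also have "[:real M + 1, 1:] = [:real (Suc M), 1:]" by simp
  also have "smult (1 / real (Suc M)) [:real (Suc M), 1:] = [:1, 1 / real (Suc M):]" by simp
  finally show ?case by (simp add: U_Suc)
qed (simp add: shifted_binomial_def)

lemma poly_shifted_binomial:
  assumes "s \<le> n + M" "0 < M \<or> s \<le> n"
  shows "poly (shifted_binomial M s) (real n) = (if s \<le> n then real ((n - s + M) choose M) else 0)"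
proof (cases "s \<le> n")
  case True
  have "poly (shifted_binomial M s) (real n) = (\<Prod>i<M. real (n - s) + real (Suc i)) / fact M"
    using True by (simp add: shifted_binomial_def poly_prod of_nat_diff algebra_simps)
  also have "(\<Prod>i<M. real (n - s) + real (Suc i)) / fact M = real ((n - s + M) choose M)"
  proof (induction M)
    case (Suc k)
    have "real (Suc k) * real ((n - s + Suc k) choose Suc k)
        = real (n - s + Suc k) * real ((n - s + k) choose k)"
      using Suc_times_binomial[of k "n - s + k"] by (metis add_Suc_right of_nat_mult)
    then have "real ((n - s + Suc k) choose Suc k)
        = real ((n - s + k) choose k) * ((real (n - s) + real (Suc k)) / real (Suc k))"
      by (simp add: field_simps del: binomial_Suc_Suc)
    moreover have "(\<Prod>i<Suc k. real (n - s) + real (Suc i)) / fact (Suc k)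
        = (\<Prod>i<k. real (n - s) + real (Suc i)) / fact k * ((real (n - s) + real (Suc k)) / real (Suc k))"
      by simp
    ultimately show ?case unfolding Suc by simp
  qed simp
  finally show ?thesis using True by simp
next
  case False
  then have "real (s - n - 1) + 1 - real s + real n = 0" "s - n - 1 < M" using assms by auto
  then have "(\<Prod>i<M. real i + 1 - real s + real n) = 0" by (intro prod_zero) auto
  then show ?thesis using False by (simp add: shifted_binomial_def poly_prod algebra_simps)
qed

text \<open>For \<open>1 \<le> s \<le> m\<close> one of the linear factors is \<open>X\<close> itself, of norm \<open>z\<close>. The constant terms of
  the others multiply to \<open>(s - 1)! (m + 1 - s)!\<close> up to sign, which against \<open>(m + 1)!\<close> leaves
  the reciprocal of \<open>s\<close> times a binomial coefficient.\<close>

lemma coeff_norm_shifted_binomial: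
  assumes "0 \<le> z" "1 \<le> s" "s \<le> m"
  shows "coeff_norm z (shifted_binomial (Suc m) s) \<le> z * (growth z m)\<^sup>2 / (real s * real (Suc m choose s))"
proof -
  have split: "{..<Suc m} = insert (s - 1) ({..<s - 1} \<union> {s..m})" using assms by auto
  have "coeff_norm z (\<Prod>i<Suc m. [:real i + 1 - real s, 1:]) \<le> (\<Prod>i<Suc m. coeff_norm z [:real i + 1 - real s, 1:])"
    by (rule coeff_norm_prod[OF assms(1)])
  also have "\<dots> = (\<Prod>i<Suc m. \<bar>real i + 1 - real s\<bar> + z)" by simp
  also have "\<dots> = z * ((\<Prod>i<s - 1. \<bar>real i + 1 - real s\<bar> + z) * (\<Prod>i=s..m. \<bar>real i + 1 - real s\<bar> + z))"
    unfolding split using assms by (subst prod.insert, simp, force, subst prod.union_disjoint) (auto simp: of_nat_diff)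
  also have "(\<Prod>i<s - 1. \<bar>real i + 1 - real s\<bar> + z) = (\<Prod>j=1..s - 1. real j + z)"
    by (rule prod.reindex_bij_witness[where i = "\<lambda>j. s - 1 - j" and j = "\<lambda>i. s - 1 - i"])
       (use assms in \<open>auto simp: of_nat_diff\<close>)
  also have "(\<Prod>i=s..m. \<bar>real i + 1 - real s\<bar> + z) = (\<Prod>j=1..m + 1 - s. real j + z)"
    by (rule prod.reindex_bij_witness[where i = "\<lambda>j. j + s - 1" and j = "\<lambda>i. i + 1 - s"])
       (use assms in \<open>auto simp: of_nat_diff\<close>)
  also have pf: "(\<Prod>j=1..k. real j + z) = fact k * growth z k" for k
  proof (induction k)
    case (Suc k)
    have "(\<Prod>j=1..Suc k. real j + z) = fact k * growth z k * (real (Suc k) + z)" using Suc by simp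
    also have "real (Suc k) + z = real (Suc k) * (1 + z / real (Suc k))" by (simp add: field_simps)
    finally show ?case by (simp add: growth_Suc algebra_simps)
  qed simp
  finally have 1: "coeff_norm z (\<Prod>i<Suc m. [:real i + 1 - real s, 1:])
      \<le> z * (fact (s - 1) * growth z (s - 1) * (fact (m + 1 - s) * growth z (m + 1 - s)))" unfolding pf .
  also have "\<dots> \<le> z * (fact (s - 1) * growth z m * (fact (m + 1 - s) * growth z m))"
    using assms growth_mono[of z "s - 1" m] growth_mono[of z "m + 1 - s" m] growth_ge_1[of z]
    by (intro mult_left_mono mult_mono mult_nonneg_nonneg) (auto intro: order_trans[OF zero_le_one])
  finally have 2: "coeff_norm z (\<Prod>i<Suc m. [:real i + 1 - real s, 1:])
      \<le> z * (growth z m)\<^sup>2 * (fact (s - 1) * fact (m + 1 - s))" by (simp add: power2_eq_square algebra_simps)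
  have bf: "real s * real (Suc m choose s) * (fact (s - 1) * fact (m + 1 - s)) = fact (Suc m)"
  proof -
    have "fact s * fact (Suc m - s) * (Suc m choose s) = (fact (Suc m) :: nat)"
      using assms by (intro binomial_fact_lemma) auto
    then have "fact s * fact (Suc m - s) * real (Suc m choose s) = fact (Suc m)"
      by (metis of_nat_fact of_nat_mult)
    moreover have "(fact s :: real) = real s * fact (s - 1)"
      using assms by (subst fact_reduce) auto
    ultimately show ?thesis by (simp add: algebra_simps)
  qed
  have pos: "real s * real (Suc m choose s) > 0" using assms by simp
  have "coeff_norm z (shifted_binomial (Suc m) s) \<le> 1 / fact (Suc m) * (z * (growth z m)\<^sup>2 * (fact (s - 1) * fact (m + 1 - s)))"
    unfolding shifted_binomial_def coeff_norm_smult using 2 by (simp add: mult_left_mono divide_right_mono del: fact_Suc)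
  also have "\<dots> = z * (growth z m)\<^sup>2 / (real s * real (Suc m choose s))"
    unfolding bf[symmetric] using pos by (simp add: field_simps)
  finally show ?thesis .
qed

section \<open>A closed form for one long cycle\<close>

text \<open>Expanding the product, the coefficient at \<open>X^s\<close> is a sum of signs over the submultisets of
  sum \<open>s\<close>; without the signs one gets their number, the coefficient of \<open>subset_sum_poly\<close>.\<close>

definition signed_subset_poly :: "nat multiset \<Rightarrow> real poly" where
  "signed_subset_poly M = (\<Prod>s\<in>#M. 1 - monom 1 s)"

definition subset_sum_poly :: "nat multiset \<Rightarrow> real poly" where
  "subset_sum_poly M = (\<Prod>s\<in>#M. 1 + monom 1 s)"

lemma signed_subset_poly_simps [simp]: "signed_subset_poly {#} = 1" "signed_subset_poly (add_mset s M) = (1 - monom 1 s) * signed_subset_poly M"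
  by (auto simp: signed_subset_poly_def)
lemma subset_sum_poly_simps [simp]: "subset_sum_poly {#} = 1" "subset_sum_poly (add_mset s M) = (1 + monom 1 s) * subset_sum_poly M"
  by (auto simp: subset_sum_poly_def)

lemma sum_mset_add_mset_remove:
  fixes f :: "'a \<Rightarrow> 'a multiset \<Rightarrow> 'b :: comm_monoid_add"
  shows "(\<Sum>s\<in>#add_mset y M. f s (add_mset y M - {#s#})) = f y M + (\<Sum>s\<in>#M. f s (add_mset y (M - {#s#})))"
proof -
  have "(\<Sum>s\<in>#M. f s (add_mset y M - {#s#})) = (\<Sum>s\<in>#M. f s (add_mset y (M - {#s#})))"
    by (intro arg_cong[where f = sum_mset] image_mset_cong) (auto simp: multi_drop_mem_not_eq)
  then show ?thesis by simp
qed

lemma fps_of_poly_signed_subset_poly: "fps_of_poly (signed_subset_poly M) = (\<Prod>s\<in>#M. 1 - fps_X ^ s)"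
  by (induction M) (auto simp: fps_of_poly_mult fps_of_poly_diff fps_of_poly_monom')

abbreviation signed_subset_fps :: "nat multiset \<Rightarrow> real fps" where "signed_subset_fps M \<equiv> \<Prod>s\<in>#M. 1 - fps_X ^ s"

lemma Xpow_deriv: "fps_X * fps_deriv (fps_X ^ s) = (of_nat s * fps_X ^ s :: real fps)"
proof (induction s)
  case (Suc s)
  have "fps_X * fps_deriv (fps_X ^ Suc s) = fps_X * fps_X ^ s + fps_X * (fps_X * fps_deriv (fps_X ^ s) :: real fps)"
    unfolding power_Suc fps_deriv_mult by (simp add: algebra_simps del: fps_deriv_power)
  then show ?case unfolding Suc by (simp add: algebra_simps)
qed simp

text \<open>Logarithmic differentiation, in a form that avoids division.\<close>

lemma signed_subset_fps_deriv: "(\<Sum>s\<in>#M. of_nat s * fps_X ^ s * signed_subset_fps (M - {#s#})) = - (fps_X * fps_deriv (signed_subset_fps M))"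
proof (induction M)
  case (add y M)
  have "(\<Sum>s\<in>#add_mset y M. of_nat s * fps_X ^ s * signed_subset_fps (add_mset y M - {#s#}))
      = of_nat y * fps_X ^ y * signed_subset_fps M + (\<Sum>s\<in>#M. (1 - fps_X ^ y) * (of_nat s * fps_X ^ s * signed_subset_fps (M - {#s#})))"
    using sum_mset_add_mset_remove[where f = "\<lambda>s N. of_nat s * fps_X ^ s * signed_subset_fps N" and y = y and M = M]
    by (simp add: algebra_simps)
  also have "\<dots> = of_nat y * fps_X ^ y * signed_subset_fps M + (1 - fps_X ^ y) * - (fps_X * fps_deriv (signed_subset_fps M))"
    unfolding sum_mset_distrib_left[symmetric] add by simp
  also have "\<dots> = - (fps_X * fps_deriv (signed_subset_fps (add_mset y M)))"
    using Xpow_deriv[of y] by (simp add: algebra_simps)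
  finally show ?case .
qed simp

text \<open>This evaluates the merging terms of the recursion.\<close>

lemma signed_subset_fps_merge: "(\<Sum>s\<in>#M. of_nat s * (1 - fps_X ^ (b + s)) * signed_subset_fps (M - {#s#}))
    = of_nat (sum_mset M) * signed_subset_fps M - (1 - fps_X ^ b) * (fps_X * fps_deriv (signed_subset_fps M))"
proof -
  have "(\<Sum>s\<in>#M. of_nat s * (1 - fps_X ^ (b + s)) * signed_subset_fps (M - {#s#}))
      = (\<Sum>s\<in>#M. of_nat s * signed_subset_fps M + (1 - fps_X ^ b) * (of_nat s * fps_X ^ s * signed_subset_fps (M - {#s#})))"
  proof (intro arg_cong[where f = sum_mset] image_mset_cong)
    fix s assume "s \<in># M"
    then have e: "signed_subset_fps M = (1 - fps_X ^ s) * signed_subset_fps (M - {#s#})"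
      by (metis insert_DiffM image_mset_add_mset prod_mset.add_mset)
    show "of_nat s * (1 - fps_X ^ (b + s)) * signed_subset_fps (M - {#s#})
        = of_nat s * signed_subset_fps M + (1 - fps_X ^ b) * (of_nat s * fps_X ^ s * signed_subset_fps (M - {#s#}))"
      unfolding e by (simp add: algebra_simps power_add)
  qed
  also have "\<dots> = (\<Sum>s\<in>#M. of_nat s * signed_subset_fps M) + (1 - fps_X ^ b) * (\<Sum>s\<in>#M. of_nat s * fps_X ^ s * signed_subset_fps (M - {#s#}))"
    by (simp add: sum_mset.distrib sum_mset_distrib_left)
  also have "(\<Sum>s\<in>#M. of_nat s * c) = of_nat (sum_mset M) * c" for c :: "real fps"
    by (induction M) (simp_all add: algebra_simps)
  finally show ?thesis unfolding signed_subset_fps_deriv by (simp add: algebra_simps)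
qed

text \<open>The geometric series; its powers generate the binomial coefficients.\<close>

abbreviation J :: "real fps" where "J \<equiv> inverse (1 - fps_X)"

lemma J_eq: "(1 - fps_X) * J = 1"
  by (rule inverse_mult_eq_1') simp

lemma J_nth1: "fps_nth J k = 1"
proof -
  have "J = Abs_fps (\<lambda>_. 1 :: real)"
    using fps_inverse_gp'[where 'a = real] by (metis fps_inverse_idempotent fps_nth_Abs_fps zero_neq_one)
  then show ?thesis by simp
qed

lemma J_nth: "fps_nth (J ^ Suc M) k = real ((M + k) choose M)"
proof (induction M arbitrary: k)
  case 0
  then show ?case by (simp add: J_nth1)
next
  case (Suc M)
  have "fps_nth (J ^ Suc (Suc M)) k = (\<Sum>i=0..k. fps_nth (J ^ Suc M) i)"
    by (subst power_Suc2, subst fps_mult_nth) (simp add: J_nth1)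
  also have "\<dots> = real (\<Sum>i=0..k. (M + i) choose M)" unfolding Suc by simp
  also have "(\<Sum>i=0..k. (M + i) choose M) = (\<Sum>i\<le>k. (M + i) choose i)"
    by (rule sum.cong) (auto simp: binomial_symmetric[of M])
  also have "\<dots> = Suc (M + k) choose k" by (rule sum_choose_lower)
  also have "\<dots> = (Suc M + k) choose Suc M" by (subst binomial_symmetric) auto
  finally show ?case .
qed

lemma J_deriv: "fps_deriv (J ^ k) = of_nat k * J ^ Suc k"
proof -
  have "fps_deriv J = J ^ 2" by (simp add: fps_inverse_deriv)
  then show ?thesis
  proof (induction k)
    case (Suc k)
    have "fps_deriv (J ^ Suc k) = fps_deriv J * J ^ k + J * fps_deriv (J ^ k)"
      unfolding power_Suc fps_deriv_mult by (simp add: algebra_simps del: fps_deriv_power)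
    then show ?case using Suc by (simp add: power2_eq_square algebra_simps)
  qed simp
qed

text \<open>This evaluates the splitting terms of the recursion, multiplied by \<open>1 - fps_X\<close> so that
  geometric sums can be summed.\<close>

lemma split_sum: "(1 - fps_X) * (\<Sum>i<k. (1 - fps_X ^ Suc i) * (1 - fps_X ^ (k - i)))
    = (1 - fps_X) * of_nat k * (1 + fps_X ^ Suc k) - 2 * fps_X * (1 - fps_X ^ k :: real fps)"
proof -
  define G where "G = (\<Sum>i<k. fps_X ^ i :: real fps)"
  have g: "(1 - fps_X) * G = (1 - fps_X ^ k :: real fps)"
    by (simp add: one_diff_power_eq G_def)
  have r: "(\<Sum>i<k. fps_X ^ (k - i)) = (\<Sum>i<k. fps_X ^ Suc i :: real fps)"
    by (rule sum.reindex_bij_witness[where i = "\<lambda>i. k - 1 - i" and j = "\<lambda>i. k - 1 - i"])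
       (auto simp: Suc_diff_Suc simp del: power_Suc)
  have "(\<Sum>i<k. (1 - fps_X ^ Suc i) * (1 - fps_X ^ (k - i)))
      = (\<Sum>i<k. (1 + fps_X ^ Suc k) - fps_X ^ Suc i - fps_X ^ (k - i) :: real fps)"
  proof (rule sum.cong[OF refl])
    fix i assume "i \<in> {..<k}"
    then have "fps_X ^ Suc i * fps_X ^ (k - i) = (fps_X ^ Suc k :: real fps)"
      by (simp add: power_add[symmetric])
    then show "(1 - fps_X ^ Suc i) * (1 - fps_X ^ (k - i))
        = ((1 + fps_X ^ Suc k) - fps_X ^ Suc i - fps_X ^ (k - i) :: real fps)"
      by (simp add: algebra_simps del: power_Suc)
  qed
  also have "\<dots> = of_nat k * (1 + fps_X ^ Suc k) - (\<Sum>i<k. fps_X ^ Suc i) - (\<Sum>i<k. fps_X ^ (k - i))"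
    by (simp only: sum_subtractf sum_constant card_lessThan)
  also have "\<dots> = of_nat k * (1 + fps_X ^ Suc k) - fps_X * G - fps_X * G"
    unfolding r by (simp add: sum_distrib_left G_def)
  finally have e: "(\<Sum>i<k. (1 - fps_X ^ Suc i) * (1 - fps_X ^ (k - i)))
      = of_nat k * (1 + fps_X ^ Suc k) - fps_X * G - fps_X * G" .
  have "(1 - fps_X) * (\<Sum>i<k. (1 - fps_X ^ Suc i) * (1 - fps_X ^ (k - i)))
     = (1 - fps_X) * of_nat k * (1 + fps_X ^ Suc k) - 2 * fps_X * ((1 - fps_X) * G)"
    unfolding e by (simp add: algebra_simps del: power_Suc)
  then show ?thesis unfolding g .
qed

lemma fps_nth_sum_mset: "fps_nth (\<Sum>s\<in>#M. f s) n = (\<Sum>s\<in>#M. fps_nth (f s) n)"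
  by (induction M) auto

lemma poly_sum_mset: "poly (\<Sum>s\<in>#M. f s) x = (\<Sum>s\<in>#M. poly (f s) x)"
  by (induction M) auto

text \<open>If \<open>\<rho>\<close> is a single cycle through all points, the averages at \<open>X = n\<close> have a rational
  generating function in \<open>n\<close>. The numerator has one factor \<open>1 - fps_X ^ length\<close> for each cycle
  of \<open>\<beta>\<close>. By induction it suffices that this expression solves the recursion. The splitting
  and merging sums turn into derivatives of the numerator, which cancel.\<close>

lemma cycle_avg_full_fps:
  assumes "0 \<notin># M"
  shows "Abs_fps (\<lambda>n. poly (cycle_avg (\<lambda>_. 1) (b + sum_mset M) b M) (real n))
     = (1 - fps_X ^ Suc b) * signed_subset_fps M * J ^ (b + sum_mset M + 3)"
  using assms
proof (induction "b + sum_mset M" arbitrary: b M)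
  case 0
  have M: "M = {#}" using 0 by (cases M) auto
  have J2: "(1 - fps_X) * J ^ 3 = J ^ 2"
    using J_eq by (simp add: power3_eq_cube power2_eq_square mult.assoc[symmetric])
  show ?case
  proof (rule fps_ext)
    fix n
    have "fps_nth (J ^ Suc 1) n = real ((1 + n) choose 1)" by (rule J_nth)
    then show "fps_nth (Abs_fps (\<lambda>n. poly (cycle_avg (\<lambda>_. 1) (b + sum_mset M) b M) (real n))) n =
         fps_nth ((1 - fps_X ^ Suc b) * signed_subset_fps M * J ^ (b + sum_mset M + 3)) n"
      using 0 M J2 by (simp add: closing_def numeral_2_eq_2)
  qed
next
  case (Suc T)
  let ?W = "\<lambda>b M. (1 - fps_X ^ Suc b) * signed_subset_fps M * J ^ (T + 3)"
  have IH: "poly (cycle_avg (\<lambda>_. 1) T b' M') (real n) = fps_nth (?W b' M') n" if "T = b' + sum_mset M'" "0 \<notin># M'" for b' M' n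
    using Suc.hyps(1)[OF that] that(1) by (metis fps_nth_Abs_fps)
  define D where "D = signed_subset_fps M"
  define k where "k = b - 1"
  have split_part: "(\<Sum>i<b. poly (closing (b - 1 - i) * cycle_avg (\<lambda>_. 1) T i (add_part (b - 1 - i) M)) (real n))
     = fps_nth (if b = 0 then 0 else (\<Sum>i<k. (1 - fps_X ^ Suc i) * (1 - fps_X ^ (k - i)) * D * J ^ (T + 3))
         + fps_deriv (fps_X * ((1 - fps_X ^ b) * D * J ^ (T + 3)))) n" for n
  proof (cases b)
    case 0
    then show ?thesis by simp
  next
    case (Suc b')
    then have k: "k = b'" by (simp add: k_def)
    have 1: "poly (closing (b - 1 - i) * cycle_avg (\<lambda>_. 1) T i (add_part (b - 1 - i) M)) (real n)
       = fps_nth ((1 - fps_X ^ Suc i) * (1 - fps_X ^ (k - i)) * D * J ^ (T + 3)) n" if "i < k" for i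
    proof -
      have a: "add_part (b - 1 - i) M = add_mset (k - i) M" using that Suc k by (simp add: add_part_def)
      have "T = i + sum_mset (add_mset (k - i) M)" using Suc.hyps(2) that Suc k by simp
      moreover have "0 \<notin># add_mset (k - i) M" using Suc.prems that by auto
      ultimately have "poly (cycle_avg (\<lambda>_. 1) T i (add_mset (k - i) M)) (real n) = fps_nth (?W i (add_mset (k - i) M)) n"
        by (rule IH)
      then show ?thesis unfolding a using that Suc k by (simp add: closing_def D_def mult.assoc)
    qed
    have "T = b' + sum_mset M" using Suc.hyps(2) Suc by simp
    then have "poly (cycle_avg (\<lambda>_. 1) T b' M) (real n) = fps_nth (?W b' M) n" using Suc.prems by (intro IH)
    then have 2: "poly (closing (b - 1 - b') * cycle_avg (\<lambda>_. 1) T b' (add_part (b - 1 - b') M)) (real n)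
       = fps_nth (fps_deriv (fps_X * ((1 - fps_X ^ b) * D * J ^ (T + 3)))) n"
      using Suc by (simp add: closing_def add_part_def D_def fps_deriv_def fps_X_mult_nth distrib_right del: fps_deriv_mult)
    show ?thesis using 1 2 Suc k by (simp add: fps_sum_nth del: fps_deriv_mult)
  qed
  have merge_part: "(\<Sum>s\<in>#M. real s * poly (cycle_avg (\<lambda>_. 1) T (b + s - 1) (M - {#s#})) (real n))
     = fps_nth ((\<Sum>s\<in>#M. of_nat s * (1 - fps_X ^ (b + s)) * signed_subset_fps (M - {#s#})) * J ^ (T + 3)) n" for n
    unfolding sum_mset_distrib_right fps_nth_sum_mset
  proof (intro arg_cong[where f = sum_mset] image_mset_cong)
    fix s assume s: "s \<in># M"
    have s0: "s > 0" using s Suc.prems by (cases s) auto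
    have "sum_mset M = s + sum_mset (M - {#s#})" using s by (metis sum_mset.remove)
    then have "T = (b + s - 1) + sum_mset (M - {#s#})" using Suc.hyps(2) s0 by simp
    moreover have "0 \<notin># M - {#s#}" using Suc.prems by (meson in_diffD)
    ultimately have "poly (cycle_avg (\<lambda>_. 1) T (b + s - 1) (M - {#s#})) (real n) = fps_nth (?W (b + s - 1) (M - {#s#})) n"
      by (rule IH)
    then show "real s * poly (cycle_avg (\<lambda>_. 1) T (b + s - 1) (M - {#s#})) (real n)
        = fps_nth (of_nat s * (1 - fps_X ^ (b + s)) * signed_subset_fps (M - {#s#}) * J ^ (T + 3)) n"
      using s0 by (simp add: mult.assoc fps_mult_of_nat_nth)
  qed
  have T: "b + sum_mset M = Suc T" using Suc.hyps(2) by simp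
  define S where "S = of_nat (sum_mset M) * D - (1 - fps_X ^ b) * (fps_X * fps_deriv D)"
  define RHS where "RHS = (if b = 0 then 0 else (\<Sum>i<k. (1 - fps_X ^ Suc i) * (1 - fps_X ^ (k - i)) * D * J ^ (T + 3))
         + fps_deriv (fps_X * ((1 - fps_X ^ b) * D * J ^ (T + 3)))) + S * J ^ (T + 3)"
  have W: "poly (cycle_avg (\<lambda>_. 1) (b + sum_mset M) b M) (real n) = fps_nth RHS n / real (Suc T)" for n
    unfolding T cycle_avg.simps poly_smult poly_add poly_sum poly_sum_mset split_part merge_part RHS_def S_def
      fps_add_nth D_def signed_subset_fps_merge[of b M] by simp
  have JT: "J ^ (T + 3) = (1 - fps_X) * J ^ (T + 4)"
    using J_eq by (simp add: numeral_eq_Suc mult.assoc[symmetric])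
  have "RHS = of_nat (Suc T) * ((1 - fps_X ^ Suc b) * D * J ^ (T + 4))"
  proof (cases b)
    case 0
    then have "RHS = of_nat (Suc T) * D * J ^ (T + 3)" using T by (simp add: RHS_def S_def)
    then show ?thesis unfolding JT using 0 by (simp add: algebra_simps)
  next
    case (Suc b')
    then have k: "k = b'" by (simp add: k_def)
    define Y where "Y = (fps_X ^ b :: real fps)"
    define d where "d = fps_deriv D"
    have sp: "(1 - fps_X) * (\<Sum>i<k. (1 - fps_X ^ Suc i) * (1 - fps_X ^ (k - i)))
       = (1 - fps_X) * of_nat k * (1 + Y) - 2 * fps_X + 2 * (Y :: real fps)"
      unfolding split_sum using Suc k by (simp add: Y_def algebra_simps)
    have p1: "(\<Sum>i<k. (1 - fps_X ^ Suc i) * (1 - fps_X ^ (k - i)) * D * J ^ (T + 3))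
       = ((1 - fps_X) * of_nat k * (1 + Y) - 2 * fps_X + 2 * Y) * D * J ^ (T + 4)"
      unfolding sp[symmetric] JT by (simp add: sum_distrib_left sum_distrib_right algebra_simps)
    have XY: "fps_X * fps_deriv Y = of_nat b * Y" unfolding Y_def by (rule Xpow_deriv)
    have "fps_deriv (fps_X * ((1 - Y) * D * J ^ (T + 3)))
        = (1 - Y) * D * J ^ (T + 3) - fps_X * fps_deriv Y * D * J ^ (T + 3) + (1 - Y) * (fps_X * d) * J ^ (T + 3)
          + fps_X * (1 - Y) * D * fps_deriv (J ^ (T + 3))"
      by (simp add: d_def algebra_simps del: fps_deriv_power)
    also have "fps_deriv (J ^ (T + 3)) = of_nat (T + 3) * J ^ (T + 4)"
      using J_deriv[of "T + 3"] by (simp add: numeral_eq_Suc)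
    finally have p2: "fps_deriv (fps_X * ((1 - Y) * D * J ^ (T + 3)))
       = ((1 - fps_X) * ((1 - Y) * D - of_nat b * Y * D + (1 - Y) * (fps_X * d)) + fps_X * (1 - Y) * D * of_nat (T + 3)) * J ^ (T + 4)"
      unfolding XY JT by (simp add: algebra_simps)
    have "RHS = ((1 - fps_X) * of_nat k * (1 + Y) - 2 * fps_X + 2 * Y) * D * J ^ (T + 4)
       + ((1 - fps_X) * ((1 - Y) * D - of_nat b * Y * D + (1 - Y) * (fps_X * d)) + fps_X * (1 - Y) * D * of_nat (T + 3)) * J ^ (T + 4)
       + (of_nat (sum_mset M) * D - (1 - Y) * (fps_X * d)) * ((1 - fps_X) * J ^ (T + 4))"
      unfolding RHS_def S_def using Suc p1 p2 JT by (simp add: Y_def d_def del: fps_deriv_mult)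
    also have "\<dots> = of_nat (Suc T) * ((1 - fps_X * Y) * D * J ^ (T + 4))"
    proof -
      have e1: "of_nat b = (of_nat k + 1 :: real fps)" using Suc k by simp
      have n2: "T + 3 = k + sum_mset M + 3" and n3: "Suc T = k + sum_mset M + 1" using T Suc k by simp_all
      have e2: "of_nat (T + 3) = (of_nat k + of_nat (sum_mset M) + 3 :: real fps)"
        unfolding n2 by (simp only: of_nat_add of_nat_numeral)
      have e3: "of_nat (Suc T) = (of_nat k + of_nat (sum_mset M) + 1 :: real fps)"
        unfolding n3 by (simp only: of_nat_add of_nat_1)
      \<comment> \<open>all terms with \<open>d\<close> have cancelled, and \<open>T = k + sum_mset M\<close> settles the rest\<close>
      show ?thesis unfolding e1 e2 e3 by algebra
    qed
    finally show ?thesis by (simp add: Y_def)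
  qed
  then have "fps_nth RHS n / real (Suc T) = fps_nth ((1 - fps_X ^ Suc b) * D * J ^ (T + 4)) n" for n
    by (simp add: fps_mult_of_nat_nth del: of_nat_Suc)
  then show ?case unfolding W using T by (intro fps_ext) (simp add: D_def numeral_eq_Suc)
qed

lemma degree_signed_subset_poly: "degree (signed_subset_poly M) \<le> sum_mset M"
proof (induction M)
  case (add s M)
  have "degree ((1 - monom 1 s) * signed_subset_poly M) \<le> degree (1 - monom (1 :: real) s) + degree (signed_subset_poly M)"
    by (rule degree_mult_le)
  also have "degree (1 - monom (1 :: real) s) \<le> s"
    by (rule degree_diff_le) (auto simp: degree_monom_le)
  finally show ?case using add by simp
qed simp

lemma coeff_monom_mult': "coeff (monom 1 s * P) k = (if s \<le> k then coeff P (k - s) else (0 :: real))"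
  by (simp add: coeff_monom_mult)

lemma coeff_signed_subset_poly_add: "coeff (signed_subset_poly (add_mset s M)) k = coeff (signed_subset_poly M) k - (if s \<le> k then coeff (signed_subset_poly M) (k - s) else 0)"
  by (simp add: left_diff_distrib coeff_monom_mult')

lemma coeff_subset_sum_poly_add: "coeff (subset_sum_poly (add_mset s M)) k = coeff (subset_sum_poly M) k + (if s \<le> k then coeff (subset_sum_poly M) (k - s) else 0)"
  by (simp add: distrib_right coeff_monom_mult')

lemma subset_sum_poly_nonneg: "0 \<le> coeff (subset_sum_poly M) k"
  by (induction M arbitrary: k) (auto simp: coeff_subset_sum_poly_add simp del: subset_sum_poly_simps(2) simp: coeff_1)

lemma abs_signed_subset_poly_le_subset_sum_poly: "\<bar>coeff (signed_subset_poly M) k\<bar> \<le> coeff (subset_sum_poly M) k"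
proof (induction M arbitrary: k)
  case (add s M)
  show ?case unfolding coeff_signed_subset_poly_add coeff_subset_sum_poly_add
    using add[of k] add[of "k - s"] by (auto simp: abs_le_iff)
qed (simp add: coeff_1)

lemma signed_subset_poly_0: "0 \<notin># M \<Longrightarrow> coeff (signed_subset_poly M) 0 = 1"
  by (induction M) (auto simp: coeff_signed_subset_poly_add simp del: signed_subset_poly_simps(2) simp: coeff_1)

text \<open>Expanding the numerator of the generating function gives an identity at all natural numbers,
  hence of polynomials.\<close>

lemma cycle_avg_full_formula:
  fixes b :: nat
  assumes "0 \<notin># M"
  defines "m \<equiv> b + sum_mset M + 1"
  shows "cycle_avg (\<lambda>_. 1) (b + sum_mset M) b M
     = (\<Sum>s\<le>m. smult (coeff (signed_subset_poly (add_mset (Suc b) M)) s) (shifted_binomial (Suc m) s))"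
proof -
  let ?D = "signed_subset_poly (add_mset (Suc b) M)" and ?S = "cycle_avg (\<lambda>_. 1) (b + sum_mset M) b M"
  let ?R = "\<Sum>s\<le>m. smult (coeff ?D s) (shifted_binomial (Suc m) s)"
  have eq: "poly ?S (real n) = poly ?R (real n)" for n
  proof -
    have "poly ?S (real n) = fps_nth (Abs_fps (\<lambda>n. poly ?S (real n))) n" by simp
    also have "\<dots> = fps_nth (fps_of_poly ?D * J ^ Suc (Suc m)) n"
      unfolding cycle_avg_full_fps[OF assms(1)] fps_of_poly_signed_subset_poly by (simp add: m_def numeral_eq_Suc)
    also have "\<dots> = (\<Sum>s=0..n. coeff ?D s * real ((Suc m + (n - s)) choose Suc m))"
      unfolding fps_mult_nth J_nth by simp
    also have "\<dots> = (\<Sum>s=0..n. coeff ?D s * poly (shifted_binomial (Suc m) s) (real n))"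
    proof (rule sum.cong[OF refl])
      fix s assume "s \<in> {0..n}"
      then have "poly (shifted_binomial (Suc m) s) (real n) = real ((n - s + Suc m) choose Suc m)"
        by (subst poly_shifted_binomial) auto
      then show "coeff ?D s * real ((Suc m + (n - s)) choose Suc m) = coeff ?D s * poly (shifted_binomial (Suc m) s) (real n)"
        by (simp only: add.commute)
    qed
    also have "\<dots> = (\<Sum>s\<in>{..n} \<union> {..m}. coeff ?D s * poly (shifted_binomial (Suc m) s) (real n))"
    proof (rule sum.mono_neutral_left)
      show "\<forall>s\<in>({..n} \<union> {..m}) - {0..n}. coeff ?D s * poly (shifted_binomial (Suc m) s) (real n) = 0"
        by (auto simp: poly_shifted_binomial)
    qed auto
    also have "\<dots> = (\<Sum>s\<le>m. coeff ?D s * poly (shifted_binomial (Suc m) s) (real n))"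
    proof (rule sum.mono_neutral_right)
      show "\<forall>s\<in>({..n} \<union> {..m}) - {..m}. coeff ?D s * poly (shifted_binomial (Suc m) s) (real n) = 0"
      proof
        fix s assume "s \<in> ({..n} \<union> {..m}) - {..m}"
        then have "degree ?D < s" using degree_signed_subset_poly[of "add_mset (Suc b) M"] by (auto simp: m_def)
        then show "coeff ?D s * poly (shifted_binomial (Suc m) s) (real n) = 0" by (simp add: coeff_eq_0)
      qed
    qed auto
    finally show ?thesis by (simp add: poly_sum)
  qed
  have "poly (?S - ?R) (real n) = 0" for n using eq[of n] by simp
  then have "range real \<subseteq> {x. poly (?S - ?R) x = 0}" by auto
  moreover have "infinite (range real)" by (rule range_inj_infinite) (simp add: inj_def)
  ultimately have "infinite {x. poly (?S - ?R) x = 0}" using finite_subset by blast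
  then have "?S - ?R = 0" using poly_roots_finite by blast
  then show ?thesis by simp
qed

section \<open>Counting submultisets of given sum\<close>

text \<open>Choosing a submultiset of sum \<open>s\<close> is a special way of choosing \<open>s\<close> out of \<open>sum_mset M\<close>
  points.\<close>

lemma subset_sum_poly_le_binomial: "0 \<notin># M \<Longrightarrow> coeff (subset_sum_poly M) s \<le> real (sum_mset M choose s)"
proof (induction M arbitrary: s)
  case (add l M)
  have l: "l > 0" "0 \<notin># M" using add.prems by auto
  have v: "(l + sum_mset M) choose s = (\<Sum>k\<le>s. (l choose k) * (sum_mset M choose (s - k)))"
    by (rule vandermonde[symmetric])
  have "(sum_mset M choose s) + (if l \<le> s then sum_mset M choose (s - l) else 0)
     \<le> (\<Sum>k\<in>{0, l} \<inter> {..s}. (l choose k) * (sum_mset M choose (s - k)))"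
    using l by (cases "l \<le> s") (auto simp: Int_insert_left)
  also have "\<dots> \<le> (\<Sum>k\<le>s. (l choose k) * (sum_mset M choose (s - k)))"
    by (rule sum_mono2) auto
  finally have "(sum_mset M choose s) + (if l \<le> s then sum_mset M choose (s - l) else 0) \<le> (l + sum_mset M) choose s"
    unfolding v .
  then have "real (sum_mset M choose s) + (if l \<le> s then real (sum_mset M choose (s - l)) else 0) \<le> real ((l + sum_mset M) choose s)"
    by (cases "l \<le> s") (simp_all flip: of_nat_add)
  then show ?case unfolding coeff_subset_sum_poly_add using add.IH[OF l(2), of s] add.IH[OF l(2), of "s - l"] by auto
qed (auto simp: coeff_1)

lemma subset_sum_poly_eq_0: "sum_mset M < s \<Longrightarrow> coeff (subset_sum_poly M) s = 0"
  by (induction M arbitrary: s) (auto simp: coeff_subset_sum_poly_add coeff_1 simp del: subset_sum_poly_simps(2))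

text \<open>Complementation of submultisets.\<close>

lemma subset_sum_poly_symmetric: "s \<le> sum_mset M \<Longrightarrow> coeff (subset_sum_poly M) (sum_mset M - s) = coeff (subset_sum_poly M) s"
proof (induction M arbitrary: s)
  case (add l M)
  show ?case
  proof (cases "l \<le> s")
    case ls: True
    then have s': "s - l \<le> sum_mset M" "sum_mset M - (s - l) = sum_mset (add_mset l M) - s" using add.prems by auto
    have 1: "coeff (subset_sum_poly M) (sum_mset (add_mset l M) - s) = coeff (subset_sum_poly M) (s - l)" using add.IH[OF s'(1)] s'(2) by simp
    have 2: "(if l \<le> sum_mset (add_mset l M) - s then coeff (subset_sum_poly M) (sum_mset (add_mset l M) - s - l) else 0) = coeff (subset_sum_poly M) s"
    proof (cases "s \<le> sum_mset M")
      case True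
      then show ?thesis using add.IH[OF True] by simp
    next
      case False
      then have "\<not> l \<le> sum_mset (add_mset l M) - s" using add.prems by simp
      then show ?thesis using subset_sum_poly_eq_0[of M s] False by simp
    qed
    show ?thesis unfolding coeff_subset_sum_poly_add 1 2 using ls by simp
  next
    case ls: False
    have 1: "coeff (subset_sum_poly M) (sum_mset (add_mset l M) - s) = 0" using ls by (intro subset_sum_poly_eq_0) simp
    have 2: "(if l \<le> sum_mset (add_mset l M) - s then coeff (subset_sum_poly M) (sum_mset (add_mset l M) - s - l) else 0) = coeff (subset_sum_poly M) s"
    proof (cases "s \<le> sum_mset M")
      case True
      then show ?thesis using add.IH[OF True] by simp
    next
      case False
      then have "\<not> l \<le> sum_mset (add_mset l M) - s" using add.prems by simp
      then show ?thesis using subset_sum_poly_eq_0[of M s] False by simp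
    qed
    show ?thesis unfolding coeff_subset_sum_poly_add 1 2 using ls by simp
  qed
qed simp

text \<open>Double counting of the pairs of a submultiset of sum \<open>s\<close> and one of its parts, weighted by
  the size of the part.\<close>

lemma subset_sum_poly_count: "real s * coeff (subset_sum_poly M) s = (\<Sum>l\<in>#M. real l * (if l \<le> s then coeff (subset_sum_poly (M - {#l#})) (s - l) else 0))"
proof (induction M arbitrary: s)
  case (add y M)
  let ?g = "\<lambda>N l s. real l * (if l \<le> s then coeff (subset_sum_poly N) (s - l) else 0)"
  have e: "?g (add_mset y N) l s = ?g N l s + (if y \<le> s then ?g N l (s - y) else 0)" for N l s
    unfolding coeff_subset_sum_poly_add by (auto simp: algebra_simps)
  have "(\<Sum>l\<in>#add_mset y M. ?g (add_mset y M - {#l#}) l s)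
     = ?g M y s + (\<Sum>l\<in>#M. ?g (add_mset y (M - {#l#})) l s)"
    by (rule sum_mset_add_mset_remove[where f = "\<lambda>l N. ?g N l s"])
  also have "(\<Sum>l\<in>#M. ?g (add_mset y (M - {#l#})) l s)
     = (\<Sum>l\<in>#M. ?g (M - {#l#}) l s) + (if y \<le> s then \<Sum>l\<in>#M. ?g (M - {#l#}) l (s - y) else 0)"
    unfolding e by (cases "y \<le> s") (simp_all add: sum_mset.distrib)
  also have "\<dots> = real s * coeff (subset_sum_poly M) s + (if y \<le> s then real (s - y) * coeff (subset_sum_poly M) (s - y) else 0)"
    unfolding add[symmetric] ..
  finally show ?case unfolding coeff_subset_sum_poly_add by (auto simp: algebra_simps of_nat_diff)
qed (auto simp: coeff_1)

text \<open>Lowering both arguments by one multiplies the binomial coefficient by \<open>s / m \<le> 1 / 2\<close>. The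
  first of the \<open>l\<close> factors is kept as \<open>s / m\<close>; it provides the gain that is needed in the next
  lemma.\<close>

lemma binomial_absorb2:
  assumes "2 \<le> l" "l \<le> s" "2 * s \<le> m"
  shows "real m * real ((m - l) choose (s - l)) \<le> real s * (1 / 2) ^ (l - 1) * real (m choose s)"
  using assms(1,2)
proof (induction l rule: dec_induct)
  case base
  have m: "real m * real ((m - 1) choose (s - 1)) = real s * real (m choose s)"
    using times_binomial_minus1_eq[of s m] base assms by (metis gr0I le_zero_eq mult.commute of_nat_mult zero_neq_numeral)
  have m1: "real (m - 1) * real ((m - 2) choose (s - 2)) = real (s - 1) * real ((m - 1) choose (s - 1))"
    using times_binomial_minus1_eq[of "s - 1" "m - 1"] base
    by (metis Suc_1 Suc_diff_le diff_Suc_1 diff_diff_left le_add1 less_le_trans mult.commute of_nat_mult one_add_one plus_1_eq_Suc zero_less_diff lessI)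
  have "real (s - 1) \<le> 1 / 2 * real (m - 1)" using base assms by (simp add: of_nat_diff)
  then have "real (m - 1) * real ((m - 2) choose (s - 2)) \<le> 1 / 2 * real (m - 1) * real ((m - 1) choose (s - 1))"
    unfolding m1 by (intro mult_right_mono) auto
  then have "real ((m - 2) choose (s - 2)) \<le> 1 / 2 * real ((m - 1) choose (s - 1))"
    using base assms by (simp add: mult.assoc)
  then have "real m * real ((m - 2) choose (s - 2)) \<le> 1 / 2 * (real m * real ((m - 1) choose (s - 1)))"
    by (metis mult_left_mono of_nat_0_le_iff mult.left_commute)
  then show ?case unfolding m by simp
next
  case (step l)
  have IH: "real m * real ((m - l) choose (s - l)) \<le> real s * (1 / 2) ^ (l - 1) * real (m choose s)"
    using step by simp
  have m1: "real (m - l) * real ((m - Suc l) choose (s - Suc l)) = real (s - l) * real ((m - l) choose (s - l))"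
    using times_binomial_minus1_eq[of "s - l" "m - l"] step
    by (metis Suc_diff_Suc diff_Suc_1 diff_Suc_eq_diff_pred diff_commute less_eq_Suc_le mult.commute of_nat_mult zero_less_diff)
  have "real (s - l) \<le> 1 / 2 * real (m - l)" using step assms by (simp add: of_nat_diff)
  then have "real (m - l) * real ((m - Suc l) choose (s - Suc l)) \<le> 1 / 2 * real (m - l) * real ((m - l) choose (s - l))"
    unfolding m1 by (intro mult_right_mono) auto
  then have "real ((m - Suc l) choose (s - Suc l)) \<le> 1 / 2 * real ((m - l) choose (s - l))"
    using step assms by (simp add: mult.assoc)
  then have "real m * real ((m - Suc l) choose (s - Suc l)) \<le> 1 / 2 * (real m * real ((m - l) choose (s - l)))"
    by (metis mult_left_mono of_nat_0_le_iff mult.left_commute)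
  also have "\<dots> \<le> 1 / 2 * (real s * (1 / 2) ^ (l - 1) * real (m choose s))" using IH by simp
  also have "\<dots> = real s * (1 / 2) ^ (Suc l - 1) * real (m choose s)"
    using step by (cases l) auto
  finally show ?case .
qed

text \<open>The trivial bound by \<open>m choose s\<close> is improved by the factor \<open>1 / m\<close>, unless there are many
  parts equal to \<open>1\<close>. The double counting identity expresses the coefficient by those of
  smaller multisets. Removing a part \<open>l \<ge> 2\<close> with \<open>l < s\<close> gains at least \<open>3 / 4\<close> relative to
  the claim; parts equal to \<open>1\<close> are estimated by the trivial bound and account for the factor
  \<open>1 + count M 1\<close>; a part \<open>l = s\<close> contributes at most \<open>m\<close> in total, which is small against
  \<open>m choose s\<close> for \<open>s \<ge> 2\<close>. The constant \<open>6\<close> satisfies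
  \<open>F + 3/4 * 6 * (1 + F) + 4/3 \<le> 6 * (1 + F)\<close>.\<close>

lemma subset_sum_poly_bound_low:
  assumes "0 \<notin># M" "1 \<le> s" "2 * s \<le> sum_mset M"
  shows "real (sum_mset M) * coeff (subset_sum_poly M) s \<le> 6 * (1 + real (count M 1)) * real (sum_mset M choose s)"
  using assms
proof (induction "size M" arbitrary: M s rule: less_induct)
  case less
  define m where "m = sum_mset M"
  define F where "F = real (count M 1)"
  define C where "C = real (m choose s)"
  have F0: "F \<ge> 0" by (simp add: F_def)
  have sm: "2 * s \<le> m" "1 \<le> s" using less.prems by (simp_all add: m_def)
  have Cpos: "C > 0" using sm by (simp add: C_def)
  have m0: "real m > 0" using sm by simp
  \<comment> \<open>\<open>R l\<close> is the summand of the double counting identity, \<open>B l\<close> its bound; the three terms of \<open>B l\<close> are for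
    \<open>l = 1\<close>, for the parts covered by the induction hypothesis, and for \<open>l = s\<close>\<close>
  define R where "R l = real l * (if l \<le> s then coeff (subset_sum_poly (M - {#l#})) (s - l) else 0)" for l
  define B where "B l = (if l = 1 then real s / real m * C else 0)
       + (real l * (3 / 4 * 6 * (1 + F) * (real s / real m * C) / real m)) + (if l = s \<and> 2 \<le> l then real l else 0)" for l
  have Bn: "0 \<le> real l * (3 / 4 * 6 * (1 + F) * (real s / real m * C) / real m)" for l
    using F0 Cpos by simp
  have bnd: "R l \<le> B l" if l: "l \<in># M" for l
  proof -
    have l0: "l > 0" using less.prems l by (cases l) auto
    have sub: "0 \<notin># M - {#l#}" using less.prems by (meson in_diffD)
    have sl: "m = l + sum_mset (M - {#l#})" using l unfolding m_def by (metis sum_mset.remove)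
    consider "l > s" | "l = 1" "1 \<le> s" | "l = s" "2 \<le> l" | "2 \<le> l" "l < s" using l0 sm by linarith
    then show ?thesis
    proof cases
      case 1
      then show ?thesis using Bn[of l] Cpos m0 by (auto simp: R_def B_def)
    next
      case 2
      have "coeff (subset_sum_poly (M - {#l#})) (s - 1) \<le> real (sum_mset (M - {#l#}) choose (s - 1))"
        by (rule subset_sum_poly_le_binomial[OF sub])
      also have "sum_mset (M - {#l#}) = m - 1" using sl 2 by simp
      also have "real ((m - 1) choose (s - 1)) = real s / real m * C"
      proof -
        have "s * (m choose s) = m * ((m - 1) choose (s - 1))" using times_binomial_minus1_eq[of s m] sm by simp
        then have "real s * C = real m * real ((m - 1) choose (s - 1))" unfolding C_def by (metis of_nat_mult)
        then show ?thesis using m0 by (simp add: field_simps)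
      qed
      finally show ?thesis using 2 Bn[of l] by (auto simp: R_def B_def)
    next
      case 3
      have "coeff (subset_sum_poly (M - {#l#})) 0 \<le> 1" using subset_sum_poly_le_binomial[OF sub, of 0] by simp
      then have "real l * coeff (subset_sum_poly (M - {#l#})) 0 \<le> real l * 1" by (intro mult_left_mono) auto
      moreover have "R l = real l * coeff (subset_sum_poly (M - {#l#})) 0" using 3 by (simp add: R_def)
      moreover have "B l = real l * (3 / 4 * 6 * (1 + F) * (real s / real m * C) / real m) + real l"
        using 3 by (simp add: B_def)
      ultimately show ?thesis using Bn[of l] by linarith
    next
      case 4
      have s1: "1 \<le> s - l" "2 * (s - l) \<le> sum_mset (M - {#l#})" using sl sm 4 by auto
      have "size (M - {#l#}) < size M" using l by (rule size_Diff1_less)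
      from less.hyps[OF this sub s1]
      have "real (m - l) * coeff (subset_sum_poly (M - {#l#})) (s - l) \<le> 6 * (1 + real (count (M - {#l#}) 1)) * real ((m - l) choose (s - l))"
        using sl by simp
      also have "real (count (M - {#l#}) 1) \<le> F" unfolding F_def by simp
      finally have 1: "real (m - l) * coeff (subset_sum_poly (M - {#l#})) (s - l) \<le> 6 * (1 + F) * real ((m - l) choose (s - l))"
        by (simp add: mult_right_mono)
      have ml: "real (m - l) > 0" using 4 sm by simp
      have 2: "real m * real ((m - l) choose (s - l)) \<le> real s * (1 / 2) ^ (l - 1) * C"
        unfolding C_def by (rule binomial_absorb2) (use 4 sm in auto)
      have 3: "(1 / 2) ^ (l - 1) * real m \<le> 3 / 4 * real (m - l)"
      proof (cases "l = 2")
        case True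
        then show ?thesis using sm 4 by (simp add: of_nat_diff)
      next
        case False
        then have "(1 / 2 :: real) ^ (l - 1) \<le> (1 / 2) ^ 2" using 4 by (intro power_decreasing) auto
        then have "(1 / 2) ^ (l - 1) * real m \<le> 1 / 4 * real m" by (intro mult_right_mono) (auto simp: power2_eq_square)
        also have "\<dots> \<le> 3 / 4 * real (m - l)" using sm 4 by (simp add: of_nat_diff)
        finally show ?thesis .
      qed
      have "real m * (real m * (real (m - l) * coeff (subset_sum_poly (M - {#l#})) (s - l)))
         \<le> real m * (real m * (6 * (1 + F) * real ((m - l) choose (s - l))))"
        using 1 m0 by (intro mult_left_mono) auto
      also have "\<dots> = 6 * (1 + F) * real m * (real m * real ((m - l) choose (s - l)))" by (simp add: algebra_simps)
      also have "\<dots> \<le> 6 * (1 + F) * real m * (real s * (1 / 2) ^ (l - 1) * C)"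
        using 2 F0 m0 by (intro mult_left_mono) auto
      also have "\<dots> = 6 * (1 + F) * (real s * C) * ((1 / 2) ^ (l - 1) * real m)" by (simp add: algebra_simps)
      also have "\<dots> \<le> 6 * (1 + F) * (real s * C) * (3 / 4 * real (m - l))"
        using 3 F0 Cpos by (intro mult_left_mono) auto
      finally have "real (m - l) * (real m * real m * coeff (subset_sum_poly (M - {#l#})) (s - l))
         \<le> real (m - l) * (3 / 4 * 6 * (1 + F) * (real s * C))" by (simp add: algebra_simps)
      then have "real m * real m * coeff (subset_sum_poly (M - {#l#})) (s - l) \<le> 3 / 4 * 6 * (1 + F) * (real s * C)"
        using ml by (simp only: mult_le_cancel_left_pos)
      then have "coeff (subset_sum_poly (M - {#l#})) (s - l) \<le> 3 / 4 * 6 * (1 + F) * (real s / real m * C) / real m"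
        using m0 by (simp add: field_simps)
      then have "real l * coeff (subset_sum_poly (M - {#l#})) (s - l) \<le> real l * (3 / 4 * 6 * (1 + F) * (real s / real m * C) / real m)"
        by (intro mult_left_mono) auto
      then show ?thesis using 4 by (simp add: R_def B_def)
    qed
  qed
  have sumc: "(\<Sum>l\<in>#M. if l = 1 then c else 0) = F * c" for c :: real
    unfolding F_def by (induction M) (auto simp: algebra_simps)
  have suml: "(\<Sum>l\<in>#M. real l * c) = real m * c" for c :: real
    unfolding m_def by (induction M) (auto simp: algebra_simps)
  have sums: "(\<Sum>l\<in>#M. if l = s \<and> 2 \<le> l then real l else 0) \<le> (if 2 \<le> s then real m else 0)"
    unfolding m_def by (induction M) auto
  have "real s * coeff (subset_sum_poly M) s = (\<Sum>l\<in>#M. R l)" unfolding R_def by (rule subset_sum_poly_count)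
  also have "\<dots> \<le> (\<Sum>l\<in>#M. B l)" by (rule sum_mset_mono) (rule bnd)
  also have "\<dots> \<le> F * (real s / real m * C) + real m * (3 / 4 * 6 * (1 + F) * (real s / real m * C) / real m)
       + (if 2 \<le> s then real m else 0)"
    unfolding B_def sum_mset.distrib sumc suml using sums by simp
  also have "(if 2 \<le> s then real m else 0) \<le> real s / real m * C * (4 / 3)"
  proof (cases "2 \<le> s")
    case True
    have m4: "m \<ge> 4" using sm True by simp
    have "m choose 2 \<le> m choose s" using sm True by (intro binomial_mono) auto
    moreover have "real (m choose 2) = real m * (real m - 1) / 2"
      using m4 by (simp add: choose_two real_of_nat_div of_nat_diff)
    ultimately have "real m * (real m - 1) / 2 \<le> C" unfolding C_def by (metis of_nat_le_iff)
    moreover have "0 \<le> real m * (real m - 1)" using m4 by simp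
    ultimately have "2 * (real m * (real m - 1) / 2) \<le> real s * C" using True Cpos by (intro mult_mono) auto
    moreover have "real m * real m \<le> 4 / 3 * (real m * (real m - 1))" using m4 by (simp add: algebra_simps)
    ultimately have "real m * real m \<le> real s * C * (4 / 3)" by simp
    then show ?thesis using True m0 by (simp add: field_simps)
  next
    case False
    then show ?thesis using Cpos by simp
  qed
  also have "real m * (3 / 4 * 6 * (1 + F) * (real s / real m * C) / real m) = 3 / 4 * 6 * (1 + F) * (real s / real m * C)"
    using m0 by simp
  finally have "real s * coeff (subset_sum_poly M) s \<le> real s / real m * C * (F + 3 / 4 * 6 * (1 + F) + 4 / 3)"
    by (simp only: algebra_simps)
  also have "\<dots> \<le> real s / real m * C * (6 * (1 + F))"
  proof (rule mult_left_mono)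
    have "3 / 4 * 6 * (1 + F) = 9 / 2 + 9 / 2 * F" by (simp add: field_simps)
    then show "F + 3 / 4 * 6 * (1 + F) + 4 / 3 \<le> 6 * (1 + F)" using F0 by linarith
  qed (use Cpos m0 in auto)
  finally have "real s * (real m * coeff (subset_sum_poly M) s) \<le> real s * (6 * (1 + F) * C)"
    using m0 by (simp add: field_simps)
  then have "real m * coeff (subset_sum_poly M) s \<le> 6 * (1 + F) * C" using sm by (simp only: mult_le_cancel_left_pos of_nat_0_less_iff)
  then show ?case by (simp add: m_def F_def C_def)
qed

lemma subset_sum_poly_bound_interior:
  assumes "0 \<notin># M" "1 \<le> s" "s < sum_mset M"
  shows "real (sum_mset M) * coeff (subset_sum_poly M) s \<le> 6 * (1 + real (count M 1)) * real (sum_mset M choose s)"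
proof (cases "2 * s \<le> sum_mset M")
  case True
  then show ?thesis using subset_sum_poly_bound_low assms by blast
next
  case False
  then have "real (sum_mset M) * coeff (subset_sum_poly M) (sum_mset M - s)
      \<le> 6 * (1 + real (count M 1)) * real (sum_mset M choose (sum_mset M - s))"
    using assms by (intro subset_sum_poly_bound_low) auto
  then show ?thesis using assms by (simp add: subset_sum_poly_symmetric binomial_symmetric[symmetric])
qed

text \<open>The term \<open>s = 0\<close> of the closed form is \<open>U (Suc m)\<close>. In the term for \<open>s\<close> the binomial
  coefficient in the bound for the shifted binomial polynomial cancels the one in the bound
  for the number of submultisets, which leaves \<open>1 / s\<close>; summation over \<open>s\<close> gives \<open>harm m\<close>.\<close>

lemma full_cycle_estimate:
  fixes z :: real and b :: nat
  assumes M: "0 \<notin># M" and z: "0 \<le> z"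
  defines "m \<equiv> b + sum_mset M + 1"
  shows "coeff_norm z (cycle_avg (\<lambda>_. 1) (b + sum_mset M) b M - U m)
     \<le> z * (growth z m)\<^sup>2 * (8 * harm m * (1 + real (count (add_mset (Suc b) M) 1)) / real m)"
proof -
  let ?M = "add_mset (Suc b) M"
  define F where "F = real (count ?M 1)"
  have M': "0 \<notin># ?M" and sm: "sum_mset ?M = m" using M by (auto simp: m_def)
  have m1: "m \<ge> 1" by (simp add: m_def)
  have F0: "F \<ge> 0" by (simp add: F_def)
  have h1: "harm m \<ge> (1 :: real)" using harm_mono[OF m1, where 'a = real] by (simp add: harm_expand)
  have "cycle_avg (\<lambda>_. 1) (b + sum_mset M) b M - U m
      = (\<Sum>s=1..m. smult (coeff (signed_subset_poly ?M) s) (shifted_binomial (Suc m) s)) + (U (Suc m) - U m)"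
    unfolding cycle_avg_full_formula[OF M] m_def[symmetric]
    using signed_subset_poly_0[OF M'] by (simp add: atMost_atLeast0 sum.atLeast_Suc_atMost shifted_binomial_0)
  also have "U (Suc m) - U m = smult (1 / real (Suc m)) (U m * [:0, 1:])"
    by (simp add: U_Suc)
  finally have "coeff_norm z (cycle_avg (\<lambda>_. 1) (b + sum_mset M) b M - U m)
     \<le> coeff_norm z (\<Sum>s=1..m. smult (coeff (signed_subset_poly ?M) s) (shifted_binomial (Suc m) s)) + coeff_norm z (smult (1 / real (Suc m)) (U m * [:0, 1:]))"
    using coeff_norm_triangle[OF z] by metis
  also have "coeff_norm z (smult (1 / real (Suc m)) (U m * [:0, 1:])) \<le> 1 / real (Suc m) * (growth z m * z)"
    unfolding coeff_norm_smult using coeff_norm_mult[OF z, of "U m" "[:0, 1:]"] coeff_norm_U[OF z, of m] z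
    by (simp add: mult_right_mono divide_right_mono order_trans del: of_nat_Suc mult_pCons_right)
  also have "\<dots> \<le> 1 / real m * ((growth z m)\<^sup>2 * z)"
  proof (rule mult_mono)
    show "1 / real (Suc m) \<le> 1 / real m" using m1 by (simp add: frac_le)
    show "growth z m * z \<le> (growth z m)\<^sup>2 * z"
      using growth_ge_1[OF z, of m] z by (intro mult_right_mono) (auto simp: power2_eq_square)
  qed (use growth_ge_1[OF z, of m] z in auto)
  also have "coeff_norm z (\<Sum>s=1..m. smult (coeff (signed_subset_poly ?M) s) (shifted_binomial (Suc m) s))
     \<le> (\<Sum>s=1..m. z * (growth z m)\<^sup>2 * (6 * (1 + F) / real m * (1 / real s) + (if s = m then 1 / real m else 0)))"
  proof (rule order_trans[OF coeff_norm_sum[OF z]], rule sum_mono)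
    fix s assume s: "s \<in> {1..m}"
    have cpos: "real (Suc m choose s) > 0" "real s > 0" using s by simp_all
    have cle: "real (m choose s) \<le> real (Suc m choose s)" using s by (cases s) auto
    have e: "coeff (subset_sum_poly ?M) s / (real s * real (Suc m choose s))
        \<le> 6 * (1 + F) / real m * (1 / real s) + (if s = m then 1 / real m else 0)"
    proof (cases "s = m")
      case True
      have "coeff (subset_sum_poly ?M) m \<le> 1" using subset_sum_poly_le_binomial[OF M', of m] unfolding sm by simp
      moreover have "1 \<le> real (Suc m choose m)" by simp
      ultimately have "coeff (subset_sum_poly ?M) m \<le> real (Suc m choose m)" by linarith
      then have "coeff (subset_sum_poly ?M) m / (real m * real (Suc m choose m))
          \<le> real (Suc m choose m) / (real m * real (Suc m choose m))"
        by (intro divide_right_mono) auto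
      also have "\<dots> = 1 / real m" using cpos True by simp
      finally have "coeff (subset_sum_poly ?M) m / (real m * real (Suc m choose m)) \<le> 1 / real m" .
      moreover have "0 \<le> 6 * (1 + F) / real m * (1 / real s)" using F0 by simp
      ultimately show ?thesis using True by simp
    next
      case False
      have "real m * coeff (subset_sum_poly ?M) s \<le> 6 * (1 + F) * real (m choose s)"
        using subset_sum_poly_bound_interior[OF M', of s] s False unfolding sm F_def by simp
      also have "\<dots> \<le> 6 * (1 + F) * real (Suc m choose s)" using cle F0 by (intro mult_left_mono) auto
      finally have "coeff (subset_sum_poly ?M) s \<le> 6 * (1 + F) * real (Suc m choose s) / real m"
        using m1 by (simp add: pos_le_divide_eq mult.commute del: subset_sum_poly_simps)
      then have "coeff (subset_sum_poly ?M) s / (real s * real (Suc m choose s))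
          \<le> 6 * (1 + F) * real (Suc m choose s) / real m / (real s * real (Suc m choose s))"
        using cpos by (intro divide_right_mono) auto
      also have "\<dots> = 6 * (1 + F) / real m * (1 / real s)" using cpos by simp
      finally show ?thesis using False by simp
    qed
    have "coeff_norm z (smult (coeff (signed_subset_poly ?M) s) (shifted_binomial (Suc m) s))
        \<le> coeff (subset_sum_poly ?M) s * (z * (growth z m)\<^sup>2 / (real s * real (Suc m choose s)))"
      unfolding coeff_norm_smult using s z
      by (intro mult_mono abs_signed_subset_poly_le_subset_sum_poly coeff_norm_shifted_binomial coeff_norm_nonneg subset_sum_poly_nonneg) auto
    also have "\<dots> = z * (growth z m)\<^sup>2 * (coeff (subset_sum_poly ?M) s / (real s * real (Suc m choose s)))" by simp
    also have "\<dots> \<le> z * (growth z m)\<^sup>2 * (6 * (1 + F) / real m * (1 / real s) + (if s = m then 1 / real m else 0))"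
      using e z by (intro mult_left_mono) auto
    finally show "coeff_norm z (smult (coeff (signed_subset_poly ?M) s) (shifted_binomial (Suc m) s))
        \<le> z * (growth z m)\<^sup>2 * (6 * (1 + F) / real m * (1 / real s) + (if s = m then 1 / real m else 0))" .
  qed
  also have "\<dots> = z * (growth z m)\<^sup>2 * (6 * (1 + F) / real m * harm m + 1 / real m)"
    unfolding sum_distrib_left[symmetric] sum.distrib using m1
    by (simp add: harm_def inverse_eq_divide)
  finally have "coeff_norm z (cycle_avg (\<lambda>_. 1) (b + sum_mset M) b M - U m)
     \<le> z * (growth z m)\<^sup>2 * ((6 * (1 + F) * harm m + 2) / real m)"
    by (simp add: algebra_simps add_divide_distrib)
  also have "\<dots> \<le> z * (growth z m)\<^sup>2 * (8 * harm m * (1 + F) / real m)"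
  proof (intro mult_left_mono divide_right_mono)
    have "1 \<le> harm m * (1 + F)" using h1 F0 mult_mono[of 1 "harm m" 1 "1 + F"] by simp
    then show "6 * (1 + F) * harm m + 2 \<le> 8 * harm m * (1 + F)" by (simp add: algebra_simps)
  qed (use z in auto)
  finally show ?thesis unfolding F_def .
qed

section \<open>How an error is carried through one cycle\<close>

text \<open>The factors \<open>real (sum_mset M)\<close> have to stay intact in what follows, as they cancel against
  the denominators of the averages.\<close>

declare of_nat_sum_mset [simp del]

text \<open>The recursion is linear in the terminal values, so the error splits into a propagated and a
  newly created part.\<close>

lemma cycle_avg_diff: "cycle_avg (\<lambda>N. h N - g N) r b M = cycle_avg h r b M - cycle_avg g r b M"
proof (induction r arbitrary: b M)
  case 0
  then show ?case by (simp add: right_diff_distrib)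
next
  case (Suc r)
  have sm: "(\<Sum>s\<in>#N. f s - f' s) = (\<Sum>s\<in>#N. f s) - (\<Sum>s\<in>#N. f' s)" for N :: "nat multiset" and f f' :: "nat \<Rightarrow> real poly"
    by (induction N) auto
  show ?case
    by (simp add: Suc right_diff_distrib smult_diff_right smult_add_right sum_subtractf sm)
qed

lemma coeff_norm_closing: "coeff_norm z (closing b) = 1 + (if b = 0 then z else 0)"
  by (simp add: closing_def)

text \<open>The triangle inequality for one step of the recursion: \<open>D\<close> stands for the differences before
  the step, and \<open>g\<close> for bounds on them.\<close>

lemma coeff_norm_averaging_step:
  assumes z: "0 \<le> z" and T: "0 < b + sum_mset M" and M: "0 \<notin># M"
    and g: "\<And>b' M'. 0 \<notin># M' \<Longrightarrow> b' + sum_mset M' + 1 = b + sum_mset M \<Longrightarrow> coeff_norm z (D b' M') \<le> g b' M'"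
  shows "coeff_norm z (smult (1 / real (b + sum_mset M))
     ((\<Sum>i<b. closing (b - 1 - i) * D i (add_part (b - 1 - i) M)) + (\<Sum>s\<in>#M. smult (real s) (D (b + s - 1) (M - {#s#})))))
   \<le> ((\<Sum>i<b. (1 + (if b - 1 - i = 0 then z else 0)) * g i (add_part (b - 1 - i) M))
       + (\<Sum>s\<in>#M. real s * g (b + s - 1) (M - {#s#}))) / real (b + sum_mset M)"
proof -
  have 1: "coeff_norm z (closing (b - 1 - i) * D i (add_part (b - 1 - i) M))
      \<le> (1 + (if b - 1 - i = 0 then z else 0)) * g i (add_part (b - 1 - i) M)" if "i < b" for i
  proof -
    have "coeff_norm z (closing (b - 1 - i) * D i (add_part (b - 1 - i) M)) \<le> coeff_norm z (closing (b - 1 - i)) * coeff_norm z (D i (add_part (b - 1 - i) M))"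
      by (rule coeff_norm_mult[OF z])
    also have "\<dots> \<le> coeff_norm z (closing (b - 1 - i)) * g i (add_part (b - 1 - i) M)"
      using that M by (intro mult_left_mono g coeff_norm_nonneg z) (auto simp: add_part_def)
    finally show ?thesis by (simp only: coeff_norm_closing)
  qed
  have 2: "coeff_norm z (smult (real s) (D (b + s - 1) (M - {#s#}))) \<le> real s * g (b + s - 1) (M - {#s#})" if s: "s \<in># M" for s
  proof -
    have s0: "s > 0" using s M by (cases s) auto
    have "sum_mset M = s + sum_mset (M - {#s#})" using s by (metis sum_mset.remove)
    then have "coeff_norm z (D (b + s - 1) (M - {#s#})) \<le> g (b + s - 1) (M - {#s#})"
      using s0 M by (intro g) (auto dest: in_diffD)
    then show ?thesis unfolding coeff_norm_smult by (simp add: mult_left_mono)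
  qed
  have 3: "coeff_norm z (\<Sum>i<b. closing (b - 1 - i) * D i (add_part (b - 1 - i) M))
      \<le> (\<Sum>i<b. (1 + (if b - 1 - i = 0 then z else 0)) * g i (add_part (b - 1 - i) M))"
    by (rule order_trans[OF coeff_norm_sum[OF z]], rule sum_mono) (use 1 in auto)
  have 4: "coeff_norm z (\<Sum>s\<in>#M. smult (real s) (D (b + s - 1) (M - {#s#})))
      \<le> (\<Sum>s\<in>#M. real s * g (b + s - 1) (M - {#s#}))"
    by (rule order_trans[OF coeff_norm_sum_mset[OF z]], rule sum_mset_mono) (use 2 in auto)
  show ?thesis
    unfolding coeff_norm_smult abs_divide abs_one abs_of_nat times_divide_eq_left mult_1_left
    by (rule divide_right_mono[OF order_trans[OF coeff_norm_triangle[OF z] add_mono[OF 3 4]]]) simp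
qed

text \<open>In a splitting step the pieces of size \<open>0\<close> or \<open>1\<close> are the only ones that affect the bound:
  size \<open>0\<close> brings a factor \<open>1 + X\<close>, and size \<open>1\<close> a new fixed point. Among all the positions of
  the cut only a bounded number produce such a piece.\<close>

definition at_most_1 :: "nat \<Rightarrow> real" where "at_most_1 i = (if i \<le> 1 then 1 else 0)"

lemma at_most_1_sum: "(\<Sum>i<b. at_most_1 i) \<le> 2" "(\<Sum>i<b. at_most_1 (b - 1 - i)) \<le> 2"
proof -
  have "(\<Sum>i<b. at_most_1 i) \<le> (\<Sum>i\<in>{0, 1}. at_most_1 i)" for b
  proof -
    have "(\<Sum>i<b. at_most_1 i) = (\<Sum>i\<in>{..<b} \<inter> {0, 1}. at_most_1 i)"
      by (rule sum.mono_neutral_right) (auto simp: at_most_1_def)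
    also have "\<dots> \<le> (\<Sum>i\<in>{0, 1}. at_most_1 i)" by (rule sum_mono2) (auto simp: at_most_1_def)
    finally show ?thesis .
  qed
  then show 1: "(\<Sum>i<b. at_most_1 i) \<le> 2" for b by (simp add: at_most_1_def)
  have "(\<Sum>i<b. at_most_1 (b - 1 - i)) = (\<Sum>i<b. at_most_1 i)" using sum.nat_diff_reindex[of at_most_1 b] by simp
  then show "(\<Sum>i<b. at_most_1 (b - 1 - i)) \<le> 2" using 1 by simp
qed

lemma near_product:
  assumes "0 \<le> w" "w \<le> 1" "p \<le> 1 + w * at_most_1 i" "q \<le> 1 + w * at_most_1 j" "0 \<le> p" "0 \<le> q"
  shows "p * q \<le> 1 + 2 * w * at_most_1 i + w * at_most_1 j"
proof -
  have "p * q \<le> (1 + w * at_most_1 i) * (1 + w * at_most_1 j)" using assms by (intro mult_mono) (auto simp: at_most_1_def)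
  also have "\<dots> \<le> 1 + 2 * w * at_most_1 i + w * at_most_1 j"
    using assms mult_left_mono[of w 1 w] by (auto simp: at_most_1_def algebra_simps)
  finally show ?thesis .
qed

lemma sum_near_product:
  assumes "\<And>i. i < b \<Longrightarrow> f i \<le> c * (1 + 2 * w * at_most_1 i + w * at_most_1 (b - 1 - i))" "0 \<le> w" "0 \<le> c"
  shows "(\<Sum>i<b. f i) \<le> c * (real b + 6 * w)"
proof -
  have "(\<Sum>i<b. f i) \<le> (\<Sum>i<b. c * (1 + 2 * w * at_most_1 i + w * at_most_1 (b - 1 - i)))"
    using assms(1) by (intro sum_mono) auto
  also have "\<dots> = c * (real b + 2 * w * (\<Sum>i<b. at_most_1 i) + w * (\<Sum>i<b. at_most_1 (b - 1 - i)))"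
    by (simp add: sum_distrib_left[symmetric] sum.distrib)
  also have "\<dots> \<le> c * (real b + 2 * w * 2 + w * 2)"
    using assms at_most_1_sum[of b] by (intro mult_left_mono add_mono order_refl) auto
  finally show ?thesis by (simp add: algebra_simps)
qed

lemma count_add_part: "count (add_part i M) 1 = count M 1 + (if i = 1 then 1 else 0)"
  by (auto simp: add_part_def)

lemma count_minus: "count (M - {#s#}) 1 \<le> count M 1" by simp

lemma sum_mset_weight: "(\<Sum>s\<in>#M. real s * c) = real (sum_mset M) * c"
  by (induction M) (auto simp: algebra_simps)

lemma sum_mset_weight1: "(\<Sum>s\<in>#M. real s * (c + (if s = 1 then e else 0))) = real (sum_mset M) * c + real (count M 1) * e"
  by (induction M) (auto simp: algebra_simps)

text \<open>An error that is at most \<open>E * B ^ F\<close> for the remaining cycles, with \<open>F\<close> the number of fixed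
  points of \<open>\<beta>\<close>, stays of this form after one more cycle of \<open>\<rho>\<close> of length at least \<open>2\<close>. In
  every step on \<open>T\<close> points only boundedly many choices of \<open>w\<close> create a fixed point or close a
  cycle, and each of them costs a factor \<open>1 + O(w)\<close>; this is the factor \<open>1 + 6 w / T\<close> in
  \<open>growth\<close>. In addition \<open>w\<close> may be one of the \<open>F\<close> fixed points. In the last step, where this
  may raise the bound by \<open>u / d\<close> per fixed point, Bernoulli's inequality absorbs the loss in
  the larger base \<open>B1\<close>. The last factor stands for the case that \<open>x\<close> itself is fixed by \<open>\<beta>\<close>.\<close>

lemma cycle_avg_propagates:
  fixes z B u w E :: real
  assumes z: "0 \<le> z" and B: "1 \<le> B" and E: "0 \<le> E" and u: "u = z + B - 1" and w: "u \<le> w" "w \<le> 1"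
    and d: "1 \<le> d" and B1: "B1 = B * (1 + u / real d)" "B1 \<le> 1 + w"
    and h: "\<And>N. 0 \<notin># N \<Longrightarrow> sum_mset N = d \<Longrightarrow> coeff_norm z (h N) \<le> E * B ^ count N 1"
  shows "0 \<notin># M \<Longrightarrow> b + sum_mset M = d + Suc r \<Longrightarrow> coeff_norm z (cycle_avg h (Suc r) b M)
     \<le> E * growth (6 * w) (d + Suc r) / growth (6 * w) d * B1 ^ count M 1 * (1 + (if b = 0 then u else 0))"
proof (induction r arbitrary: b M)
  case 0
  let ?F = "count M 1"
  define T where "T = real (b + sum_mset M)"
  have u0: "0 \<le> u" "z \<le> w" "B \<le> 1 + w" "0 \<le> w" using u z B w by auto
  have T0: "0 < b + sum_mset M" using 0 by simp
  then have Tp: "0 < T" unfolding T_def by (simp only: of_nat_0_less_iff)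
  have TS: "real b + real (sum_mset M) = T" by (simp add: T_def)
  have TT: "T = real (Suc d)" unfolding T_def 0(2) by simp
  have dT: "real d \<le> T" unfolding TT by simp
  have BB: "B \<le> B1" unfolding B1(1) using B u0 by (simp add: mult_le_cancel_left1)
  have Bp: "0 \<le> B" "1 \<le> B1" using B BB by linarith+
  define g where "g b' M' = (1 + (if b' = 0 then z else 0)) * (E * B ^ count (add_part b' M') 1)" for b' M'
  have g: "coeff_norm z (cycle_avg h 0 b' M') \<le> g b' M'" if "0 \<notin># M'" "b' + sum_mset M' + 1 = b + sum_mset M" for b' M'
  proof -
    have "coeff_norm z (closing b' * h (add_part b' M')) \<le> coeff_norm z (closing b') * coeff_norm z (h (add_part b' M'))" by (rule coeff_norm_mult[OF z])
    also have "\<dots> \<le> coeff_norm z (closing b') * (E * B ^ count (add_part b' M') 1)"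
      using that 0 by (intro mult_left_mono h coeff_norm_nonneg z) (auto simp: add_part_def)
    finally show ?thesis by (simp add: coeff_norm_closing g_def)
  qed
  let ?c = "E * B ^ ?F"
  have c0: "0 \<le> ?c" using E Bp by simp
  have i_part: "(\<Sum>i<b. (1 + (if b - 1 - i = 0 then z else 0)) * g i (add_part (b - 1 - i) M)) \<le> ?c * (real b + 6 * w)"
  proof (rule sum_near_product[OF _ u0(4) c0])
    fix i assume "i < b"
    let ?p = "\<lambda>i. (1 + (if i = 0 then z else 0)) * (if i = 1 then B else 1)"
    have p: "?p i \<le> 1 + w * at_most_1 i" "0 \<le> ?p i" for i using u0 Bp z by (auto simp: at_most_1_def)
    have "(1 + (if b - 1 - i = 0 then z else 0)) * g i (add_part (b - 1 - i) M) = ?c * (?p i * ?p (b - 1 - i))"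
      unfolding g_def count_add_part by (auto simp: power_add)
    also have "\<dots> \<le> ?c * (1 + 2 * w * at_most_1 i + w * at_most_1 (b - 1 - i))"
      by (rule mult_left_mono[OF near_product[OF u0(4) w(2) p(1) p(1) p(2) p(2)] c0])
    finally show "(1 + (if b - 1 - i = 0 then z else 0)) * g i (add_part (b - 1 - i) M)
       \<le> ?c * (1 + 2 * w * at_most_1 i + w * at_most_1 (b - 1 - i))" .
  qed
  have Bm: "B ^ count (M - {#s#}) 1 \<le> B ^ ?F" for s using B by (intro power_increasing count_minus)
  have gfr: "growth (6 * w) (d + Suc 0) / growth (6 * w) d = 1 + 6 * w / T"
    using growth_ge_1[of "6 * w" d] u0 unfolding TT by (simp add: growth_Suc del: of_nat_Suc)
  have step: "coeff_norm z (cycle_avg h (Suc 0) b M) \<le>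
     ((\<Sum>i<b. (1 + (if b - 1 - i = 0 then z else 0)) * g i (add_part (b - 1 - i) M))
       + (\<Sum>s\<in>#M. real s * g (b + s - 1) (M - {#s#}))) / T"
    unfolding cycle_avg.simps(2) T_def by (rule coeff_norm_averaging_step[OF z T0 0(1)]) (rule g)
  have BB1: "?c \<le> E * B1 ^ ?F"
    using E Bp BB by (intro mult_left_mono power_mono) auto
  show ?case
  proof (cases "b = 0")
    case True
    have "(\<Sum>s\<in>#M. real s * g (b + s - 1) (M - {#s#})) \<le> (\<Sum>s\<in>#M. real s * (?c * (1 + u)))"
    proof (rule sum_mset_mono)
      fix s assume s: "s \<in># M"
      then have s0: "s > 0" using 0 by (cases s) auto
      have "(1 + (if s - 1 = 0 then z else 0)) * (if s - 1 = 1 then B else 1) \<le> 1 + u"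
        using u z B u0 by auto
      then have "E * (B ^ count (M - {#s#}) 1 * ((1 + (if s - 1 = 0 then z else 0)) * (if s - 1 = 1 then B else 1)))
          \<le> E * (B ^ ?F * (1 + u))"
        using E Bp z Bm by (intro mult_left_mono mult_mono) auto
      then have "g (b + s - 1) (M - {#s#}) \<le> ?c * (1 + u)"
        unfolding g_def count_add_part using True by (auto simp: power_add algebra_simps)
      then show "real s * g (b + s - 1) (M - {#s#}) \<le> real s * (?c * (1 + u))" by (intro mult_left_mono) auto
    qed
    then have sumle: "(\<Sum>s\<in>#M. real s * g (b + s - 1) (M - {#s#})) \<le> T * (?c * (1 + u))"
      unfolding sum_mset_weight T_def using True by simp
    have isum: "(\<Sum>i<b. (1 + (if b - 1 - i = 0 then z else 0)) * g i (add_part (b - 1 - i) M)) \<le> 0"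
      using True by simp
    have "coeff_norm z (cycle_avg h (Suc 0) b M) \<le> (0 + T * (?c * (1 + u))) / T"
      by (rule order_trans[OF step divide_right_mono[OF add_mono[OF isum sumle]]]) (use Tp in simp)
    also have "\<dots> = ?c * (1 + u)" using Tp by simp
    also have "\<dots> \<le> (E * B1 ^ ?F) * (1 + 6 * w / T) * (1 + u)"
    proof (intro mult_right_mono)
      have "?c * 1 \<le> (E * B1 ^ ?F) * (1 + 6 * w / T)"
        by (rule mult_mono[OF BB1 _ order_trans[OF c0 BB1]]) (use u0 Tp in auto)
      then show "?c \<le> (E * B1 ^ ?F) * (1 + 6 * w / T)" by simp
    qed (use u0 in auto)
    finally show ?thesis unfolding gfr[symmetric] using True by (simp add: algebra_simps)
  next
    case False
    have "(\<Sum>s\<in>#M. real s * g (b + s - 1) (M - {#s#})) \<le> (\<Sum>s\<in>#M. real s * (?c + (if s = 1 then ?c * (B - 1) else 0)))"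
    proof (rule sum_mset_mono)
      fix s assume s: "s \<in># M"
      then have s0: "s > 0" using 0 by (cases s) auto
      have "(if b + s - 1 = 1 then B else 1) \<le> 1 + (if s = 1 then B - 1 else 0)" using False s0 B by auto
      then have "E * (B ^ count (M - {#s#}) 1 * (if b + s - 1 = 1 then B else 1)) \<le> E * (B ^ ?F * (1 + (if s = 1 then B - 1 else 0)))"
        using E Bp Bm by (intro mult_left_mono mult_mono) auto
      then have "g (b + s - 1) (M - {#s#}) \<le> ?c + (if s = 1 then ?c * (B - 1) else 0)"
        unfolding g_def count_add_part using False s0 by (auto simp: power_add algebra_simps)
      then show "real s * g (b + s - 1) (M - {#s#}) \<le> real s * (?c + (if s = 1 then ?c * (B - 1) else 0))"
        by (intro mult_left_mono) auto
    qed
    also have "\<dots> = ?c * (real (sum_mset M) + real ?F * (B - 1))"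
      unfolding sum_mset_weight1 by (simp add: algebra_simps)
    finally have "coeff_norm z (cycle_avg h (Suc 0) b M) \<le> (?c * (real b + 6 * w) + ?c * (real (sum_mset M) + real ?F * (B - 1))) / T"
      by (intro order_trans[OF step] divide_right_mono add_mono i_part) (use Tp in auto)
    also have "?c * (real b + 6 * w) + ?c * (real (sum_mset M) + real ?F * (B - 1)) = ?c * (T + 6 * w + real ?F * (B - 1))"
      unfolding TS[symmetric] by (simp add: algebra_simps)
    also have "\<dots> / T = ?c * (1 + 6 * w / T + real ?F * ((B - 1) / T))"
      using Tp by (simp add: field_simps)
    also have "\<dots> \<le> ?c * ((1 + 6 * w / T) * (1 + real ?F * (u / real d)))"
    proof (rule mult_left_mono[OF _ c0])
      have "(B - 1) / T \<le> u / real d" using u z B d dT by (intro frac_le) auto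
      then have "real ?F * ((B - 1) / T) \<le> real ?F * (u / real d)" by (intro mult_left_mono) auto
      moreover have "0 \<le> 6 * w / T * (real ?F * (u / real d))" using u0 Tp by simp
      moreover have ex: "(1 + X) * (1 + A) = 1 + X + A + X * A" for X A :: real by (simp add: algebra_simps)
      ultimately show "1 + 6 * w / T + real ?F * ((B - 1) / T) \<le> (1 + 6 * w / T) * (1 + real ?F * (u / real d))"
        unfolding ex[of "6 * w / T" "real ?F * (u / real d)"] by argo
    qed
    also have "\<dots> \<le> ?c * ((1 + 6 * w / T) * (1 + u / real d) ^ ?F)"
    proof (intro mult_left_mono c0)
      have "0 \<le> u / real d" using u0 by simp
      then have "- 1 \<le> u / real d" by linarith
      then show "1 + real ?F * (u / real d) \<le> (1 + u / real d) ^ ?F" by (rule Bernoulli_inequality)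
      have "0 \<le> 6 * w / T" using u0 Tp by simp
      then show "0 \<le> 1 + 6 * w / T" by linarith
    qed
    also have "\<dots> = E * (1 + 6 * w / T) * B1 ^ ?F" by (simp add: B1(1) power_mult_distrib)
    finally show ?thesis unfolding gfr[symmetric] using False by (simp add: algebra_simps)
  qed
next
  case (Suc r)
  let ?F = "count M 1"
  define T where "T = real (b + sum_mset M)"
  have u0: "0 \<le> u" "z \<le> w" "B \<le> 1 + w" "0 \<le> w" using u z B w by auto
  have T0: "0 < b + sum_mset M" using Suc by simp
  then have Tp: "0 < T" unfolding T_def by (simp only: of_nat_0_less_iff)
  have TS: "real b + real (sum_mset M) = T" by (simp add: T_def)
  have TT: "T = real (Suc (d + Suc r))" unfolding T_def Suc.prems(2) by simp
  have BB: "B \<le> B1" unfolding B1(1) using B u0 by (simp add: mult_le_cancel_left1)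
  have Bp: "0 \<le> B" "1 \<le> B1" using B BB by linarith+
  define E' where "E' = E * growth (6 * w) (d + Suc r) / growth (6 * w) d"
  have E'0: "0 \<le> E'" unfolding E'_def using E growth_ge_1[of "6 * w" d] growth_ge_1[of "6 * w" "d + Suc r"] u0 by simp
  define g where "g b' M' = E' * B1 ^ count M' 1 * (1 + (if b' = 0 then u else 0))" for b' :: nat and M' :: "nat multiset"
  have g: "coeff_norm z (cycle_avg h (Suc r) b' M') \<le> g b' M'" if "0 \<notin># M'" "b' + sum_mset M' + 1 = b + sum_mset M" for b' M'
    unfolding g_def E'_def by (rule Suc.IH) (use that Suc.prems in auto)
  let ?c = "E' * B1 ^ ?F"
  have c0: "0 \<le> ?c" using E'0 Bp by simp
  have i_part: "(\<Sum>i<b. (1 + (if b - 1 - i = 0 then z else 0)) * g i (add_part (b - 1 - i) M)) \<le> ?c * (real b + 6 * w)"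
  proof (rule sum_near_product[OF _ u0(4) c0])
    fix i assume "i < b"
    let ?p = "1 + (if i = 0 then u else 0)"
    let ?q = "(1 + (if b - 1 - i = 0 then z else 0)) * (if b - 1 - i = 1 then B1 else 1)"
    have p: "?p \<le> 1 + w * at_most_1 i" "0 \<le> ?p" using u0 w by (auto simp: at_most_1_def)
    have q: "?q \<le> 1 + w * at_most_1 (b - 1 - i)" "0 \<le> ?q" using u0 z B1(2) Bp by (auto simp: at_most_1_def)
    have "(1 + (if b - 1 - i = 0 then z else 0)) * g i (add_part (b - 1 - i) M) = ?c * (?p * ?q)"
      unfolding g_def count_add_part by (auto simp: power_add)
    also have "\<dots> \<le> ?c * (1 + 2 * w * at_most_1 i + w * at_most_1 (b - 1 - i))"
      by (rule mult_left_mono[OF near_product[OF u0(4) w(2) p(1) q(1) p(2) q(2)] c0])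
    finally show "(1 + (if b - 1 - i = 0 then z else 0)) * g i (add_part (b - 1 - i) M)
       \<le> ?c * (1 + 2 * w * at_most_1 i + w * at_most_1 (b - 1 - i))" .
  qed
  have Bm: "B1 ^ count (M - {#s#}) 1 \<le> B1 ^ ?F" for s using Bp by (intro power_increasing count_minus) auto
  have gfr: "E' * (1 + 6 * w / T) = E * growth (6 * w) (d + Suc (Suc r)) / growth (6 * w) d"
    unfolding E'_def TT by (simp add: growth_Suc del: of_nat_Suc)
  have step: "coeff_norm z (cycle_avg h (Suc (Suc r)) b M) \<le>
     ((\<Sum>i<b. (1 + (if b - 1 - i = 0 then z else 0)) * g i (add_part (b - 1 - i) M))
       + (\<Sum>s\<in>#M. real s * g (b + s - 1) (M - {#s#}))) / T"
    unfolding cycle_avg.simps(2)[of h "Suc r"] T_def by (rule coeff_norm_averaging_step[OF z T0 Suc.prems(1)]) (rule g)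
  have s_part: "(\<Sum>s\<in>#M. real s * g (b + s - 1) (M - {#s#})) \<le> real (sum_mset M) * (?c * (1 + (if b = 0 then u else 0)))"
    unfolding sum_mset_weight[symmetric]
  proof (rule sum_mset_mono)
    fix s assume s: "s \<in># M"
    then have s0: "s > 0" using Suc.prems by (cases s) auto
    have "(if b + s - 1 = 0 then u else 0) \<le> (if b = 0 then u else 0)" using s0 u0 by auto
    then have "g (b + s - 1) (M - {#s#}) \<le> E' * B1 ^ ?F * (1 + (if b = 0 then u else 0))"
      unfolding g_def using E'0 Bm u0 Bp by (intro mult_mono mult_left_mono) auto
    then show "real s * g (b + s - 1) (M - {#s#}) \<le> real s * (?c * (1 + (if b = 0 then u else 0)))"
      by (intro mult_left_mono) auto
  qed
  have "coeff_norm z (cycle_avg h (Suc (Suc r)) b M) \<le> (?c * (real b + 6 * w) + real (sum_mset M) * (?c * (1 + (if b = 0 then u else 0)))) / T"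
    by (intro order_trans[OF step] divide_right_mono add_mono i_part s_part) (use Tp in auto)
  also have "\<dots> \<le> ?c * (1 + (if b = 0 then u else 0)) * (1 + 6 * w / T)"
  proof (cases "b = 0")
    case True
    have "(?c * (6 * w) + real (sum_mset M) * (?c * (1 + u))) / T = ?c * (1 + u) + ?c * (6 * w / T)"
    proof -
      have "real (sum_mset M) = T" using TS True by simp
      then show ?thesis using Tp by (simp add: field_simps)
    qed
    also have "\<dots> \<le> ?c * (1 + u) + ?c * (1 + u) * (6 * w / T)"
    proof -
      have "?c * 1 * (6 * w / T) \<le> ?c * (1 + u) * (6 * w / T)" using c0 u0 Tp by (intro mult_right_mono mult_left_mono) auto
      then show ?thesis by simp
    qed
    finally show ?thesis using True by (simp add: algebra_simps)
  next
    case False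
    have "?c * (real b + 6 * w) + real (sum_mset M) * ?c = ?c * (T + 6 * w)"
      unfolding TS[symmetric] by (simp add: algebra_simps)
    then have "(?c * (real b + 6 * w) + real (sum_mset M) * (?c * (1 + (if b = 0 then u else 0)))) / T = ?c * (T + 6 * w) / T"
      using False by simp
    also have "\<dots> = ?c * (1 + 6 * w / T)" using Tp by (simp add: field_simps)
    finally show ?thesis using False by simp
  qed
  also have "\<dots> = E' * (1 + 6 * w / T) * B1 ^ ?F * (1 + (if b = 0 then u else 0))" by (simp only: mult_ac)
  finally show ?case unfolding gfr .
qed

section \<open>The error created by one cycle\<close>

text \<open>Erasing \<open>x\<close> multiplies \<open>U d\<close> by \<open>1 + X\<close> or \<open>1\<close>, while \<open>U (Suc d)\<close> has the factor
  \<open>1 + X / Suc d\<close>. The difference is of order \<open>1 / d\<close> unless \<open>x\<close> is fixed by \<open>\<beta>\<close>.\<close>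

lemma cycle_avg_U_base:
  assumes z: "0 \<le> z" and d: "1 \<le> d" and G: "growth z (Suc d) \<le> G"
  shows "coeff_norm z (cycle_avg (\<lambda>_. U d) 0 b M - U (Suc d)) \<le> G * z * ((if b = 0 then 1 else 0) + 1 / real d)"
proof -
  let ?c = "if b = 0 then 1 - 1 / real (Suc d) else - (1 / real (Suc d))"
  have "cycle_avg (\<lambda>_. U d) 0 b M - U (Suc d) = smult ?c ([:0, 1:] * U d)"
    by (simp add: closing_def U_Suc smult_diff_left algebra_simps)
  then have "coeff_norm z (cycle_avg (\<lambda>_. U d) 0 b M - U (Suc d)) = \<bar>?c\<bar> * coeff_norm z ([:0, 1:] * U d)"
    by (simp only: coeff_norm_smult)
  also have "\<dots> \<le> ((if b = 0 then 1 else 0) + 1 / real d) * (z * G)"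
  proof (rule mult_mono)
    define q where "q = 1 / real (Suc d)"
    have "q \<le> 1 / real d" unfolding q_def using d by (intro frac_le) auto
    moreover have "0 \<le> q" "q \<le> 1" by (auto simp: q_def)
    ultimately show "\<bar>?c\<bar> \<le> (if b = 0 then 1 else 0) + 1 / real d"
      unfolding q_def[symmetric] by (auto simp: abs_if)
    have "coeff_norm z ([:0, 1:] * U d) \<le> coeff_norm z [:0, 1:] * coeff_norm z (U d)" by (rule coeff_norm_mult[OF z])
    also have "\<dots> \<le> z * G"
      using coeff_norm_U[OF z, of d] G growth_mono[OF z, of d "Suc d"] z by (intro mult_mono coeff_norm_nonneg) auto
    finally show "coeff_norm z ([:0, 1:] * U d) \<le> z * G" .
  qed (use z coeff_norm_nonneg[OF z] in auto)
  finally show ?thesis by (simp add: algebra_simps)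
qed

text \<open>Started at \<open>U d\<close>, the recursion almost reproduces the sequence \<open>U\<close>: the step on \<open>T\<close> points
  with \<open>b > 0\<close> multiplies a constant value by exactly \<open>1 + X / T\<close>, because exactly one choice
  of \<open>w\<close> closes a cycle, where \<open>1 + X / (T + 1)\<close> is wanted. For \<open>b = 0\<close> no cycle can be
  closed, which costs \<open>1 / (T + 1)\<close>. Errors of this size are produced in every step, and they
  are averaged in the following steps, where fixed points are hit with probability \<open>F / T\<close> and
  create the dependence on \<open>F\<close>. The accumulated factor \<open>(1 + 3 \<omega>) ^ r\<close> is at most \<open>exp 3\<close> as
  long as \<open>r \<le> d\<close>.\<close>

lemma cycle_avg_U_near_U:
  fixes z G :: real and d :: nat
  assumes z: "0 \<le> z" "z \<le> 1" and d: "1 \<le> d"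
  defines "\<omega> \<equiv> 1 / real d"
  shows "0 \<notin># M \<Longrightarrow> b + sum_mset M = d + Suc r \<Longrightarrow> growth z (d + Suc r) \<le> G \<Longrightarrow>
     coeff_norm z (cycle_avg (\<lambda>_. U d) (Suc r) b M - U (d + Suc r + 1))
     \<le> G * z * (4 * \<omega> * (1 + 3 * \<omega>) ^ r * (2 + real (count M 1)) + (if b = 0 then \<omega> else 0))"
proof (induction r arbitrary: b M)
  have w0: "0 < \<omega>" "\<omega> \<le> 1" using d by (auto simp: \<omega>_def)
  \<comment> \<open>One step: the averaged errors \<open>g\<close>, plus the defect by which the step fails to map \<open>U T\<close> to \<open>U (T + 1)\<close>.\<close>
  have step: "coeff_norm z (cycle_avg (\<lambda>_. U d) (Suc r) b M - U (T + 1))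
     \<le> ((\<Sum>i<b. (1 + (if b - 1 - i = 0 then z else 0)) * g i (add_part (b - 1 - i) M))
       + (\<Sum>s\<in>#M. real s * g (b + s - 1) (M - {#s#}))) / real T + G * z * (\<omega>\<^sup>2 + (if b = 0 then \<omega> else 0))"
    if M: "0 \<notin># M" and T: "T = b + sum_mset M" "d < T" and G: "growth z T \<le> G"
      and g: "\<And>b' M'. 0 \<notin># M' \<Longrightarrow> b' + sum_mset M' + 1 = b + sum_mset M
           \<Longrightarrow> coeff_norm z (cycle_avg (\<lambda>_. U d) r b' M' - U T) \<le> g b' M'" for b M r T g
  proof -
    have T0: "0 < b + sum_mset M" "0 < real T" using T by auto
    define D where "D b' M' = cycle_avg (\<lambda>_. U d) r b' M' - U T" for b' M'
    let ?X = "(\<Sum>i<b. closing (b - 1 - i) * D i (add_part (b - 1 - i) M)) + (\<Sum>s\<in>#M. smult (real s) (D (b + s - 1) (M - {#s#})))"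
    let ?c = "if b = 0 then - (1 / real (T + 1)) else 1 / real T - 1 / real (T + 1)"
    have sumcl: "(\<Sum>i<b. closing (b - 1 - i)) = of_nat b + (if b = 0 then 0 else [:0, 1:])"
    proof (cases b)
      case (Suc b')
      have "(\<Sum>i<b. closing (b - 1 - i)) = (\<Sum>i<b. closing i)" using sum.nat_diff_reindex[of closing b] by simp
      also have "\<dots> = closing 0 + (\<Sum>i<b'. closing (Suc i))" unfolding Suc by (rule sum.lessThan_Suc_shift)
      also have "\<dots> = of_nat b + [:0, 1:]" using Suc by (simp add: closing_def one_pCons of_nat_poly)
      finally show ?thesis using Suc by simp
    qed simp
    have sums: "(\<Sum>s\<in>#N. smult (real s) (P s - Q)) = (\<Sum>s\<in>#N. smult (real s) (P s)) - smult (real (sum_mset N)) Q"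
      for N :: "nat multiset" and P Q
      by (induction N) (auto simp: smult_diff_right smult_add_left algebra_simps)
    have "smult (1 / real T) ?X = cycle_avg (\<lambda>_. U d) (Suc r) b M
       - smult (1 / real T) ((\<Sum>i<b. closing (b - 1 - i)) * U T + smult (real (sum_mset M)) (U T))"
      unfolding D_def cycle_avg.simps(2) T(1) sums right_diff_distrib sum_subtractf sum_distrib_right
      by (simp add: smult_diff_right smult_add_right algebra_simps)
    also have "(\<Sum>i<b. closing (b - 1 - i)) * U T + smult (real (sum_mset M)) (U T)
       = smult (real T) (U T) + (if b = 0 then 0 else [:0, 1:] * U T)"
      unfolding sumcl T(1) by (simp add: of_nat_poly smult_add_left algebra_simps)
    also have "smult (1 / real T) \<dots> = U T + (if b = 0 then 0 else smult (1 / real T) ([:0, 1:] * U T))"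
      using T0 by (simp add: smult_add_right)
    finally have "cycle_avg (\<lambda>_. U d) (Suc r) b M - U (T + 1)
        = smult (1 / real T) ?X + (U T + (if b = 0 then 0 else smult (1 / real T) ([:0, 1:] * U T)) - U (T + 1))"
      by simp
    also have "U T + (if b = 0 then 0 else smult (1 / real T) ([:0, 1:] * U T)) - U (T + 1) = smult ?c ([:0, 1:] * U T)"
    proof -
      have "U (T + 1) = U T + smult (1 / real (T + 1)) ([:0, 1:] * U T)" by (simp add: U_Suc)
      then show ?thesis by (simp add: smult_diff_left)
    qed
    finally have "coeff_norm z (cycle_avg (\<lambda>_. U d) (Suc r) b M - U (T + 1))
        \<le> coeff_norm z (smult (1 / real T) ?X) + coeff_norm z (smult ?c ([:0, 1:] * U T))"
      by (simp only: coeff_norm_triangle[OF z(1)])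
    also have "coeff_norm z (smult (1 / real T) ?X) \<le> ((\<Sum>i<b. (1 + (if b - 1 - i = 0 then z else 0)) * g i (add_part (b - 1 - i) M))
       + (\<Sum>s\<in>#M. real s * g (b + s - 1) (M - {#s#}))) / real T"
      unfolding T(1) by (rule coeff_norm_averaging_step[OF z(1) T0(1) M]) (use g in \<open>auto simp: D_def\<close>)
    also have "coeff_norm z (smult ?c ([:0, 1:] * U T)) \<le> (\<omega>\<^sup>2 + (if b = 0 then \<omega> else 0)) * (z * G)"
      unfolding coeff_norm_smult
    proof (rule mult_mono)
      have "1 / real T \<le> \<omega>" unfolding \<omega>_def using T d by (intro frac_le) auto
      moreover have "1 / real (T + 1) \<le> 1 / real T" using T0 by (intro frac_le) auto
      moreover have "1 / real T - 1 / real (T + 1) = 1 / real T * (1 / real (T + 1))"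
        using T0 by (simp add: field_simps)
      moreover have "1 / real T * (1 / real (T + 1)) \<le> \<omega> * \<omega>"
        using calculation w0 T0 by (intro mult_mono) auto
      moreover have "0 \<le> 1 / real T * (1 / real (T + 1))" "0 \<le> 1 / real (T + 1)" "0 \<le> \<omega> * \<omega>" using w0 by auto
      ultimately show "\<bar>?c\<bar> \<le> \<omega>\<^sup>2 + (if b = 0 then \<omega> else 0)"
        by (auto simp: power2_eq_square abs_if)
      have "coeff_norm z ([:0, 1:] * U T) \<le> coeff_norm z [:0, 1:] * coeff_norm z (U T)" by (rule coeff_norm_mult[OF z(1)])
      also have "\<dots> \<le> z * G" using coeff_norm_U[OF z(1), of T] G z by (intro mult_mono coeff_norm_nonneg) auto
      finally show "coeff_norm z ([:0, 1:] * U T) \<le> z * G" .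
    qed (use w0 z coeff_norm_nonneg[OF z(1)] in auto)
    finally show ?thesis by (simp add: algebra_simps)
  qed
  have sums1: "(\<Sum>i<b. if i = k then c else 0) \<le> c" if "0 \<le> c" for b k :: nat and c :: real
    using that by (simp add: sum.delta')
  have sumr: "(\<Sum>i<b. if b - 1 - i = k then c else 0) \<le> c" if "0 \<le> c" for b k :: nat and c :: real
  proof -
    have "(\<Sum>i<b. if b - 1 - i = k then c else 0) = (\<Sum>i<b. if i = k then c else 0)"
      using sum.nat_diff_reindex[of "\<lambda>i. if i = k then c else 0" b] by simp
    then show ?thesis using sums1[OF that] by simp
  qed
  {
    case 0
    let ?F = "real (count M 1)" and ?T = "d + Suc 0"
    have G0: "0 \<le> G" using 0(3) growth_ge_1[OF z(1), of "d + Suc 0"] by linarith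
    define g where "g b' M' = G * z * ((if b' = 0 then 1 else 0) + \<omega>)" for b' :: nat and M' :: "nat multiset"
    have g: "coeff_norm z (cycle_avg (\<lambda>_. U d) 0 b' M' - U ?T) \<le> g b' M'" for b' M'
      unfolding g_def \<omega>_def using cycle_avg_U_base[OF z(1) d, of G b' M'] 0(3) by (simp only: add_Suc_right add_0_right)
    have Tp: "real ?T > 0" by simp
    have i_part: "(\<Sum>i<b. (1 + (if b - 1 - i = 0 then z else 0)) * g i (add_part (b - 1 - i) M)) \<le> G * z * (2 + \<omega> * (real b + 1))"
    proof -
      have "(\<Sum>i<b. (1 + (if b - 1 - i = 0 then z else 0)) * g i (add_part (b - 1 - i) M))
         \<le> (\<Sum>i<b. G * z * ((if i = 0 then 2 else 0) + \<omega> * (1 + (if b - 1 - i = 0 then 1 else 0))))"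
      proof (rule sum_mono)
        fix i
        have "(1 + (if b - 1 - i = 0 then z else 0)) * ((if i = 0 then 1 else 0) + \<omega>)
           \<le> (1 + (if b - 1 - i = 0 then 1 else 0)) * ((if i = 0 then 1 else 0) + \<omega>)"
          using z w0 by (intro mult_right_mono) auto
        also have "\<dots> \<le> (if i = 0 then 2 else 0) + \<omega> * (1 + (if b - 1 - i = 0 then 1 else 0))"
          using w0 by auto
        finally have "(1 + (if b - 1 - i = 0 then z else 0)) * ((if i = 0 then 1 else 0) + \<omega>)
           \<le> (if i = 0 then 2 else 0) + \<omega> * (1 + (if b - 1 - i = 0 then 1 else 0))" .
        then have "G * z * ((1 + (if b - 1 - i = 0 then z else 0)) * ((if i = 0 then 1 else 0) + \<omega>))
           \<le> G * z * ((if i = 0 then 2 else 0) + \<omega> * (1 + (if b - 1 - i = 0 then 1 else 0)))"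
          using G0 z by (intro mult_left_mono) auto
        then show "(1 + (if b - 1 - i = 0 then z else 0)) * g i (add_part (b - 1 - i) M)
           \<le> G * z * ((if i = 0 then 2 else 0) + \<omega> * (1 + (if b - 1 - i = 0 then 1 else 0)))"
          by (simp only: g_def mult.left_commute)
      qed
      also have "\<dots> = G * z * ((\<Sum>i<b. if i = 0 then 2 else 0) + \<omega> * (real b + (\<Sum>i<b. if b - 1 - i = 0 then 1 else 0)))"
        by (simp only: sum_distrib_left[symmetric] sum.distrib sum_constant card_lessThan mult_1_right)
      also have "\<dots> \<le> G * z * (2 + \<omega> * (real b + 1))"
        using G0 z w0 sums1[of 2 0 b] sumr[of 1 b 0] by (intro mult_left_mono add_mono) auto
      finally show ?thesis .
    qed
    have s_part: "(\<Sum>s\<in>#M. real s * g (b + s - 1) (M - {#s#})) \<le> G * z * (real (sum_mset M) * \<omega> + ?F)"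
    proof -
      have "(\<Sum>s\<in>#M. real s * g (b + s - 1) (M - {#s#})) \<le> (\<Sum>s\<in>#M. real s * (G * z * \<omega> + (if s = 1 then G * z else 0)))"
      proof (rule sum_mset_mono)
        fix s assume "s \<in># M"
        then have "s > 0" using 0 by (cases s) auto
        then have "g (b + s - 1) (M - {#s#}) \<le> G * z * \<omega> + (if s = 1 then G * z else 0)"
          using G0 z by (auto simp: g_def algebra_simps)
        then show "real s * g (b + s - 1) (M - {#s#}) \<le> real s * (G * z * \<omega> + (if s = 1 then G * z else 0))"
          by (intro mult_left_mono) auto
      qed
      then show ?thesis unfolding sum_mset_weight1 by (simp add: algebra_simps)
    qed
    have TS: "real b + real (sum_mset M) = real ?T" using 0(2) by (metis of_nat_add)
    have "coeff_norm z (cycle_avg (\<lambda>_. U d) (Suc 0) b M - U (?T + 1))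
       \<le> (G * z * (2 + \<omega> * (real b + 1)) + G * z * (real (sum_mset M) * \<omega> + ?F)) / real ?T + G * z * (\<omega>\<^sup>2 + (if b = 0 then \<omega> else 0))"
      by (rule order_trans[OF step[OF 0(1) 0(2)[symmetric] _ 0(3), of 0 g] add_right_mono[OF divide_right_mono[OF add_mono[OF i_part s_part]]]])
         (use g in auto)
    also have "G * z * (2 + \<omega> * (real b + 1)) + G * z * (real (sum_mset M) * \<omega> + ?F) = G * z * (2 + ?F + \<omega> + \<omega> * real ?T)"
      unfolding TS[symmetric] by (simp add: algebra_simps)
    also have "\<dots> / real ?T = G * z * ((2 + ?F + \<omega>) / real ?T + \<omega>)"
      using Tp by (simp add: field_simps)
    also have "\<dots> \<le> G * z * ((2 + ?F + \<omega>) * \<omega> + \<omega>)"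
    proof (intro mult_left_mono add_right_mono)
      have "1 / real ?T \<le> \<omega>" unfolding \<omega>_def using d by (intro frac_le) auto
      then have "(2 + ?F + \<omega>) * (1 / real ?T) \<le> (2 + ?F + \<omega>) * \<omega>" using w0 by (intro mult_left_mono) auto
      then show "(2 + ?F + \<omega>) / real ?T \<le> (2 + ?F + \<omega>) * \<omega>" by simp
    qed (use G0 z in auto)
    finally have "coeff_norm z (cycle_avg (\<lambda>_. U d) (Suc 0) b M - U (?T + 1))
       \<le> G * z * ((2 + ?F + \<omega>) * \<omega> + \<omega> + \<omega>\<^sup>2 + (if b = 0 then \<omega> else 0))"
      by (simp add: algebra_simps)
    also have "\<dots> \<le> G * z * (4 * \<omega> * (1 + 3 * \<omega>) ^ 0 * (2 + ?F) + (if b = 0 then \<omega> else 0))"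
    proof (intro mult_left_mono add_right_mono)
      have "\<omega> * \<omega> \<le> \<omega> * 1" using w0 by (intro mult_left_mono) auto
      moreover have "0 \<le> \<omega> * ?F" using w0 by simp
      moreover have "(2 + ?F + \<omega>) * \<omega> + \<omega> + \<omega>\<^sup>2 = 3 * \<omega> + \<omega> * ?F + 2 * (\<omega> * \<omega>)"
        by (simp add: algebra_simps power2_eq_square)
      moreover have "4 * \<omega> * (1 + 3 * \<omega>) ^ 0 * (2 + ?F) = 8 * \<omega> + 4 * (\<omega> * ?F)"
        by (simp add: algebra_simps)
      ultimately show "(2 + ?F + \<omega>) * \<omega> + \<omega> + \<omega>\<^sup>2 \<le> 4 * \<omega> * (1 + 3 * \<omega>) ^ 0 * (2 + ?F)"
        using w0 by linarith
    qed (use G0 z in auto)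
    finally show ?case by simp
  next
    case (Suc r)
    let ?F = "real (count M 1)" and ?T = "d + Suc (Suc r)"
    have G0: "0 \<le> G" using Suc.prems(3) growth_ge_1[OF z(1), of ?T] by linarith
    have G': "growth z (d + Suc r) \<le> G" using Suc.prems(3) growth_mono[OF z(1), of "d + Suc r" ?T] by linarith
    define \<alpha> where "\<alpha> = 4 * \<omega> * (1 + 3 * \<omega>) ^ r"
    have a0: "4 * \<omega> \<le> \<alpha>" "0 \<le> \<alpha>"
    proof -
      have "4 * \<omega> * 1 \<le> \<alpha>" unfolding \<alpha>_def using w0 by (intro mult_left_mono one_le_power) auto
      then show "4 * \<omega> \<le> \<alpha>" "0 \<le> \<alpha>" using w0 by auto
    qed
    define g where "g b' M' = G * z * (\<alpha> * (2 + real (count M' 1)) + (if b' = 0 then \<omega> else 0))"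
      for b' :: nat and M' :: "nat multiset"
    have g: "coeff_norm z (cycle_avg (\<lambda>_. U d) (Suc r) b' M' - U ?T) \<le> g b' M'"
      if "0 \<notin># M'" "b' + sum_mset M' + 1 = b + sum_mset M" for b' M'
    proof -
      have e: "b' + sum_mset M' = d + Suc r" using that Suc.prems(2) by simp
      have eq: "d + Suc r + 1 = ?T" by simp
      show ?thesis using Suc.IH[OF that(1) e G'] unfolding g_def \<alpha>_def eq .
    qed
    have Tp: "real ?T > 0" by simp
    have i_part: "(\<Sum>i<b. (1 + (if b - 1 - i = 0 then z else 0)) * g i (add_part (b - 1 - i) M))
       \<le> G * z * (\<alpha> * (2 + ?F) * (real b + 1) + \<alpha> + 2 * \<omega>)"
    proof -
      have "(\<Sum>i<b. (1 + (if b - 1 - i = 0 then z else 0)) * g i (add_part (b - 1 - i) M))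
         \<le> (\<Sum>i<b. G * z * (\<alpha> * (2 + ?F) * (1 + (if b - 1 - i = 0 then 1 else 0)) + (if b - 1 - i = 1 then \<alpha> else 0) + (if i = 0 then 2 * \<omega> else 0)))"
      proof (rule sum_mono)
        fix i
        have "(1 + (if b - 1 - i = 0 then z else 0)) * (\<alpha> * (2 + (?F + (if b - 1 - i = 1 then 1 else 0))) + (if i = 0 then \<omega> else 0))
          \<le> (1 + (if b - 1 - i = 0 then 1 else 0)) * (\<alpha> * (2 + (?F + (if b - 1 - i = 1 then 1 else 0))) + (if i = 0 then \<omega> else 0))"
          using z w0 a0 by (intro mult_right_mono) auto
        also have "\<dots> \<le> \<alpha> * (2 + ?F) * (1 + (if b - 1 - i = 0 then 1 else 0)) + (if b - 1 - i = 1 then \<alpha> else 0) + (if i = 0 then 2 * \<omega> else 0)"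
          using w0 a0 by (auto simp: algebra_simps)
        finally have "(1 + (if b - 1 - i = 0 then z else 0)) * (\<alpha> * (2 + (?F + (if b - 1 - i = 1 then 1 else 0))) + (if i = 0 then \<omega> else 0))
          \<le> \<alpha> * (2 + ?F) * (1 + (if b - 1 - i = 0 then 1 else 0)) + (if b - 1 - i = 1 then \<alpha> else 0) + (if i = 0 then 2 * \<omega> else 0)" .
        then have "G * z * ((1 + (if b - 1 - i = 0 then z else 0)) * (\<alpha> * (2 + (?F + (if b - 1 - i = 1 then 1 else 0))) + (if i = 0 then \<omega> else 0)))
          \<le> G * z * (\<alpha> * (2 + ?F) * (1 + (if b - 1 - i = 0 then 1 else 0)) + (if b - 1 - i = 1 then \<alpha> else 0) + (if i = 0 then 2 * \<omega> else 0))"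
          using G0 z by (intro mult_left_mono) auto
        moreover have "g i (add_part (b - 1 - i) M) = G * z * (\<alpha> * (2 + (?F + (if b - 1 - i = 1 then 1 else 0))) + (if i = 0 then \<omega> else 0))"
          unfolding g_def count_add_part by simp
        ultimately show "(1 + (if b - 1 - i = 0 then z else 0)) * g i (add_part (b - 1 - i) M)
          \<le> G * z * (\<alpha> * (2 + ?F) * (1 + (if b - 1 - i = 0 then 1 else 0)) + (if b - 1 - i = 1 then \<alpha> else 0) + (if i = 0 then 2 * \<omega> else 0))"
          by (simp only: mult.left_commute)
      qed
      also have "\<dots> = G * z * (\<alpha> * (2 + ?F) * (real b + (\<Sum>i<b. if b - 1 - i = 0 then 1 else 0))
          + (\<Sum>i<b. if b - 1 - i = 1 then \<alpha> else 0) + (\<Sum>i<b. if i = 0 then 2 * \<omega> else 0))"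
        by (simp only: sum_distrib_left[symmetric] sum.distrib sum_constant card_lessThan mult_1_right)
      also have "\<dots> \<le> G * z * (\<alpha> * (2 + ?F) * (real b + 1) + \<alpha> + 2 * \<omega>)"
        using G0 z w0 a0 sums1[of "2 * \<omega>" 0 b] sumr[of 1 b 0] sumr[of \<alpha> b 1] by (intro mult_left_mono add_mono) auto
      finally show ?thesis .
    qed
    have s_part: "(\<Sum>s\<in>#M. real s * g (b + s - 1) (M - {#s#})) \<le> G * z * (real (sum_mset M) * (\<alpha> * (2 + ?F)) + ?F * \<omega>)"
    proof -
      have "(\<Sum>s\<in>#M. real s * g (b + s - 1) (M - {#s#})) \<le> (\<Sum>s\<in>#M. real s * (G * z * (\<alpha> * (2 + ?F)) + (if s = 1 then G * z * \<omega> else 0)))"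
      proof (rule sum_mset_mono)
        fix s assume "s \<in># M"
        then have s0: "s > 0" using Suc.prems by (cases s) auto
        have "\<alpha> * (2 + real (count (M - {#s#}) 1)) + (if b + s - 1 = 0 then \<omega> else 0) \<le> \<alpha> * (2 + ?F) + (if s = 1 then \<omega> else 0)"
          using s0 w0 a0 by (intro add_mono mult_left_mono) auto
        then have "G * z * (\<alpha> * (2 + real (count (M - {#s#}) 1)) + (if b + s - 1 = 0 then \<omega> else 0))
            \<le> G * z * (\<alpha> * (2 + ?F) + (if s = 1 then \<omega> else 0))" using G0 z by (intro mult_left_mono) auto
        then have "g (b + s - 1) (M - {#s#}) \<le> G * z * (\<alpha> * (2 + ?F)) + (if s = 1 then G * z * \<omega> else 0)"
          unfolding g_def by (auto simp: distrib_left)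
        then show "real s * g (b + s - 1) (M - {#s#}) \<le> real s * (G * z * (\<alpha> * (2 + ?F)) + (if s = 1 then G * z * \<omega> else 0))"
          by (intro mult_left_mono) auto
      qed
      then show ?thesis unfolding sum_mset_weight1 by (simp add: algebra_simps)
    qed
    have TS: "real b + real (sum_mset M) = real ?T" using Suc.prems(2) by (metis of_nat_add)
    have "coeff_norm z (cycle_avg (\<lambda>_. U d) (Suc (Suc r)) b M - U (?T + 1))
       \<le> (G * z * (\<alpha> * (2 + ?F) * (real b + 1) + \<alpha> + 2 * \<omega>) + G * z * (real (sum_mset M) * (\<alpha> * (2 + ?F)) + ?F * \<omega>)) / real ?T
          + G * z * (\<omega>\<^sup>2 + (if b = 0 then \<omega> else 0))"
      by (rule order_trans[OF step[OF Suc.prems(1) Suc.prems(2)[symmetric] _ Suc.prems(3), of "Suc r" g] add_right_mono[OF divide_right_mono[OF add_mono[OF i_part s_part]]]])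
         (use g in auto)
    also have "G * z * (\<alpha> * (2 + ?F) * (real b + 1) + \<alpha> + 2 * \<omega>) + G * z * (real (sum_mset M) * (\<alpha> * (2 + ?F)) + ?F * \<omega>)
        = G * z * (\<alpha> * (2 + ?F) + \<alpha> + (2 + ?F) * \<omega> + \<alpha> * (2 + ?F) * real ?T)"
      unfolding TS[symmetric] by (simp add: algebra_simps)
    also have "\<dots> / real ?T = G * z * ((\<alpha> * (2 + ?F) + \<alpha> + (2 + ?F) * \<omega>) * (1 / real ?T) + \<alpha> * (2 + ?F))"
      using Tp by (simp add: field_simps)
    also have "\<dots> \<le> G * z * ((\<alpha> * (2 + ?F) + \<alpha> + (2 + ?F) * \<omega>) * \<omega> + \<alpha> * (2 + ?F))"
    proof (intro mult_left_mono add_right_mono)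
      show "1 / real ?T \<le> \<omega>" unfolding \<omega>_def using d by (intro frac_le) auto
    qed (use G0 z w0 a0 in auto)
    finally have "coeff_norm z (cycle_avg (\<lambda>_. U d) (Suc (Suc r)) b M - U (?T + 1))
       \<le> G * z * ((\<alpha> * (2 + ?F) + \<alpha> + (2 + ?F) * \<omega>) * \<omega> + \<alpha> * (2 + ?F) + \<omega>\<^sup>2 + (if b = 0 then \<omega> else 0))"
      by (simp add: algebra_simps)
    also have "\<dots> \<le> G * z * (4 * \<omega> * (1 + 3 * \<omega>) ^ Suc r * (2 + ?F) + (if b = 0 then \<omega> else 0))"
    proof (intro mult_left_mono add_right_mono)
      have "4 * \<omega> * (1 + 3 * \<omega>) ^ Suc r * (2 + ?F) = \<alpha> * (2 + ?F) + 3 * (\<alpha> * (2 + ?F) * \<omega>)"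
        by (simp add: \<alpha>_def algebra_simps)
      moreover have "\<alpha> * \<omega> * 2 \<le> \<alpha> * \<omega> * (2 + ?F)" using a0 w0 by (intro mult_left_mono) auto
      moreover have "4 * \<omega> * ((2 + ?F) * \<omega>) \<le> \<alpha> * ((2 + ?F) * \<omega>)" using a0 w0 by (intro mult_right_mono) auto
      moreover have "\<omega> * \<omega> * 2 \<le> \<omega> * \<omega> * (2 + ?F)" using w0 by (intro mult_left_mono) auto
      moreover have "0 \<le> \<omega> * \<omega> * (2 + ?F)" using w0 by simp
      moreover have "(\<alpha> * (2 + ?F) + \<alpha> + (2 + ?F) * \<omega>) * \<omega> + \<alpha> * (2 + ?F) + \<omega>\<^sup>2
          = \<alpha> * (2 + ?F) * \<omega> + \<alpha> * \<omega> + \<omega> * \<omega> * (2 + ?F) + \<alpha> * (2 + ?F) + \<omega> * \<omega>"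
        by (simp add: algebra_simps power2_eq_square)
      moreover have "\<alpha> * \<omega> * (2 + ?F) = \<alpha> * (2 + ?F) * \<omega>" "\<alpha> * ((2 + ?F) * \<omega>) = \<alpha> * (2 + ?F) * \<omega>"
        "4 * \<omega> * ((2 + ?F) * \<omega>) = 4 * (\<omega> * \<omega> * (2 + ?F))" by (simp_all only: mult_ac)
      moreover have "0 \<le> \<alpha> * \<omega>" "0 \<le> \<omega> * \<omega>" using a0 w0 by auto
      ultimately show "(\<alpha> * (2 + ?F) + \<alpha> + (2 + ?F) * \<omega>) * \<omega> + \<alpha> * (2 + ?F) + \<omega>\<^sup>2 \<le> 4 * \<omega> * (1 + 3 * \<omega>) ^ Suc r * (2 + ?F)"
        by linarith
    qed (use G0 z in auto)
    finally show ?case by simp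
  }
qed

lemma coeff_norm_average:
  assumes z: "0 \<le> z" and g: "\<And>s. s \<in># M \<Longrightarrow> coeff_norm z (D s) \<le> g s"
  shows "coeff_norm z (smult (1 / real m) (\<Sum>s\<in>#M. smult (real s) (D s))) \<le> (\<Sum>s\<in>#M. real s * g s) / real m"
proof -
  have "coeff_norm z (\<Sum>s\<in>#M. smult (real s) (D s)) \<le> (\<Sum>s\<in>#M. coeff_norm z (smult (real s) (D s)))"
    by (rule coeff_norm_sum_mset[OF z])
  also have "\<dots> \<le> (\<Sum>s\<in>#M. real s * g s)"
    by (rule sum_mset_mono) (simp add: coeff_norm_smult g mult_left_mono)
  finally show ?thesis unfolding coeff_norm_smult abs_divide abs_one abs_of_nat times_divide_eq_left mult_1_left
    by (rule divide_right_mono) simp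
qed

text \<open>A size-biased average of a constant is that constant.\<close>

lemma average_diff:
  assumes "0 < sum_mset M"
  shows "smult (1 / real (sum_mset M)) (\<Sum>s\<in>#M. smult (real s) (P s)) - Q
       = smult (1 / real (sum_mset M)) (\<Sum>s\<in>#M. smult (real s) (P s - Q))"
proof -
  have "(\<Sum>s\<in>#N. smult (real s) (P s - Q)) = (\<Sum>s\<in>#N. smult (real s) (P s)) - smult (real (sum_mset N)) Q"
    for N :: "nat multiset"
    by (induction N) (auto simp: smult_diff_right smult_add_left algebra_simps)
  then have "smult (1 / real (sum_mset M)) (\<Sum>s\<in>#M. smult (real s) (P s - Q))
      = smult (1 / real (sum_mset M)) (\<Sum>s\<in>#M. smult (real s) (P s)) - smult (1 / real (sum_mset M) * real (sum_mset M)) Q"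
    by (simp only: smult_diff_right smult_smult)
  moreover have "1 / real (sum_mset M) * real (sum_mset M) = 1"
  proof -
    have "real (sum_mset M) \<noteq> 0" using assms by (simp only: of_nat_eq_0_iff)
    moreover have "1 / x * x = 1" if "x \<noteq> 0" for x :: real using that by simp
    ultimately show ?thesis by blast
  qed
  ultimately show ?thesis by simp
qed

lemma star_sizes:
  fixes M :: "nat multiset"
  assumes "0 \<notin># M" "s \<in># M" "sum_mset M = m"
  shows "0 < s" "0 \<notin># M - {#s#}" "(s - 1) + sum_mset (M - {#s#}) = m - 1" "s \<le> m"
proof -
  show s: "0 < s"
  proof (rule ccontr)
    assume "\<not> 0 < s"
    then show False using assms(1,2) by simp
  qed
  show "0 \<notin># M - {#s#}" using assms(1) by (meson in_diffD)
  have "sum_mset M = s + sum_mset (M - {#s#})" using assms(2) by (metis sum_mset.remove)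
  then show "(s - 1) + sum_mset (M - {#s#}) = m - 1" "s \<le> m" using s assms(3) by auto
qed

text \<open>The value \<open>exp 3\<close> bounds \<open>(1 + 3 / d) ^ r\<close> for \<open>r \<le> d\<close>.\<close>

definition source_const :: real where "source_const = 4 * exp 3 + 1"

text \<open>The choice of the first point \<open>x\<close> is averaged as well, which turns the term for a fixed \<open>x\<close>
  into \<open>F\<close> divided by the number of points. A cycle of length \<open>1\<close> involves no step of the
  recursion and is treated by the base case.\<close>

lemma average_cycle_avg_U_near_U:
  assumes z: "0 \<le> z" "z \<le> 1" and a: "1 \<le> a" "a \<le> d" and M: "0 \<notin># M" "sum_mset M = d + a" and G: "growth z (d + a) \<le> G"
  shows "coeff_norm z (smult (1 / real (sum_mset M)) (\<Sum>s\<in>#M. smult (real s) (cycle_avg (\<lambda>_. U d) (a - 1) (s - 1) (M - {#s#}))) - U (d + a))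
     \<le> G * z * source_const * (2 + real (count M 1)) / real d"
proof -
  let ?F = "real (count M 1)"
  define \<omega> where "\<omega> = 1 / real d"
  have d: "1 \<le> d" using a by simp
  have w0: "0 < \<omega>" using d by (simp add: \<omega>_def)
  have m0: "0 < sum_mset M" using M a by simp
  have m1: "real (sum_mset M) \<ge> 1" using m0 by linarith
  have G0: "0 \<le> G" using G growth_ge_1[OF z(1), of "d + a"] by linarith
  have Fm: "?F / real (sum_mset M) \<le> 1 / real d * ?F"
  proof -
    have "1 / real (sum_mset M) \<le> 1 / real d" using M d by (intro frac_le) auto
    then have "1 / real (sum_mset M) * ?F \<le> 1 / real d * ?F" by (rule mult_right_mono) simp
    then show ?thesis by simp
  qed
  have "\<exists>c. c \<le> 4 * exp 3 * \<omega> \<and> 0 \<le> c \<and> (\<exists>e. 0 \<le> e \<and> e * ?F / real (sum_mset M) \<le> \<omega> * (2 + ?F) \<and>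
     (\<forall>s\<in>#M. coeff_norm z (cycle_avg (\<lambda>_. U d) (a - 1) (s - 1) (M - {#s#}) - U (d + a)) \<le> G * z * (c * (2 + ?F) + (if s = 1 then e else 0))))"
  proof (cases "a = 1")
    case True
    have "coeff_norm z (cycle_avg (\<lambda>_. U d) (a - 1) (s - 1) (M - {#s#}) - U (d + a)) \<le> G * z * (\<omega> * (2 + ?F) + (if s = 1 then 1 else 0))"
      if s: "s \<in># M" for s
    proof -
      have "coeff_norm z (cycle_avg (\<lambda>_. U d) 0 (s - 1) (M - {#s#}) - U (Suc d)) \<le> G * z * ((if s - 1 = 0 then 1 else 0) + 1 / real d)"
        by (rule cycle_avg_U_base) (use z d G True in auto)
      also have "\<dots> \<le> G * z * (\<omega> * (2 + ?F) + (if s = 1 then 1 else 0))"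
      proof (rule mult_left_mono)
        have "\<omega> * 1 \<le> \<omega> * (2 + ?F)" using w0 by (intro mult_left_mono) auto
        then show "(if s - 1 = 0 then 1 else 0) + 1 / real d \<le> \<omega> * (2 + ?F) + (if s = 1 then 1 else 0)"
          using star_sizes(1)[OF M(1) s refl] by (auto simp: \<omega>_def)
      qed (use G0 z in auto)
      finally show ?thesis using True by simp
    qed
    moreover have "\<omega> \<le> 4 * exp 3 * \<omega>"
    proof -
      have "1 \<le> exp (3 :: real)" by simp
      then have "1 * \<omega> \<le> 4 * exp 3 * \<omega>" using w0 by (intro mult_right_mono) linarith+
      then show ?thesis by simp
    qed
    moreover have "1 * ?F / real (sum_mset M) \<le> \<omega> * (2 + ?F)"
    proof -
      have "\<omega> * (2 + ?F) = 2 * \<omega> + 1 / real d * ?F" by (simp add: \<omega>_def add_divide_distrib)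
      then have "?F / real (sum_mset M) \<le> \<omega> * (2 + ?F)" using Fm w0 by linarith
      then show ?thesis by simp
    qed
    ultimately show ?thesis using w0 by (intro exI[of _ \<omega>] conjI exI[of _ 1]) auto
  next
    case False
    then have "a = Suc (Suc (a - 2))" using a by simp
    then obtain r where r: "a = Suc (Suc r)" by blast
    let ?c = "4 * \<omega> * (1 + 3 * \<omega>) ^ r"
    have "coeff_norm z (cycle_avg (\<lambda>_. U d) (a - 1) (s - 1) (M - {#s#}) - U (d + a)) \<le> G * z * (?c * (2 + ?F) + (if s = 1 then \<omega> else 0))"
      if s: "s \<in># M" for s
    proof -
      note ss = star_sizes[OF M(1) s M(2)]
      have G': "growth z (d + Suc r) \<le> G" using G growth_mono[OF z(1), of "d + Suc r" "d + a"] r by simp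
      have e: "(s - 1) + sum_mset (M - {#s#}) = d + Suc r" using ss(3) r by simp
      have eq: "d + Suc r + 1 = d + a" using r by simp
      have "coeff_norm z (cycle_avg (\<lambda>_. U d) (Suc r) (s - 1) (M - {#s#}) - U (d + Suc r + 1))
         \<le> G * z * (?c * (2 + real (count (M - {#s#}) 1)) + (if s - 1 = 0 then \<omega> else 0))"
        unfolding \<omega>_def by (rule cycle_avg_U_near_U[OF z d ss(2) e G'])
      also have "\<dots> \<le> G * z * (?c * (2 + ?F) + (if s = 1 then \<omega> else 0))"
        using w0 z G0 ss(1) by (intro mult_left_mono add_mono) auto
      finally show ?thesis unfolding eq using r by simp
    qed
    moreover have "?c \<le> 4 * exp 3 * \<omega>"
    proof -
      have "(1 + 3 * \<omega>) ^ r \<le> exp (3 * \<omega>) ^ r" using w0 by (intro power_mono) (auto intro: exp_ge_add_one_self)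
      also have "\<dots> = exp (real r * (3 * \<omega>))" by (rule exp_of_nat_mult[symmetric])
      also have "\<dots> \<le> exp 3"
      proof -
        have "real r * \<omega> \<le> real d * \<omega>" using r a w0 by (intro mult_right_mono) auto
        also have "\<dots> = 1" using d by (simp add: \<omega>_def)
        finally show ?thesis by simp
      qed
      finally have "4 * \<omega> * (1 + 3 * \<omega>) ^ r \<le> 4 * \<omega> * exp 3" using w0 by (intro mult_left_mono) auto
      then show ?thesis by (simp only: mult_ac)
    qed
    moreover have "\<omega> * ?F / real (sum_mset M) \<le> \<omega> * (2 + ?F)"
    proof -
      have "?F / real (sum_mset M) \<le> ?F / 1" using m1 by (intro divide_left_mono) auto
      then have "\<omega> * (?F / real (sum_mset M)) \<le> \<omega> * (2 + ?F)" using w0 by (intro mult_left_mono) auto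
      then show ?thesis by simp
    qed
    ultimately show ?thesis using w0 by (intro exI[of _ ?c] conjI exI[of _ \<omega>]) auto
  qed
  then obtain c e where c: "c \<le> 4 * exp 3 * \<omega>" "0 \<le> c" and e: "0 \<le> e" "e * ?F / real (sum_mset M) \<le> \<omega> * (2 + ?F)"
    and bnd: "\<And>s. s \<in># M \<Longrightarrow> coeff_norm z (cycle_avg (\<lambda>_. U d) (a - 1) (s - 1) (M - {#s#}) - U (d + a)) \<le> G * z * (c * (2 + ?F) + (if s = 1 then e else 0))"
    by blast
  have "coeff_norm z (smult (1 / real (sum_mset M)) (\<Sum>s\<in>#M. smult (real s) (cycle_avg (\<lambda>_. U d) (a - 1) (s - 1) (M - {#s#}))) - U (d + a))
     \<le> (\<Sum>s\<in>#M. real s * (G * z * (c * (2 + ?F) + (if s = 1 then e else 0)))) / real (sum_mset M)"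
    unfolding average_diff[OF m0] by (rule coeff_norm_average[OF z(1)]) (rule bnd)
  also have "(\<Sum>s\<in>#M. real s * (G * z * (c * (2 + ?F) + (if s = 1 then e else 0))))
      = G * z * (\<Sum>s\<in>#M. real s * (c * (2 + ?F) + (if s = 1 then e else 0)))"
    unfolding sum_mset_distrib_left by (simp only: mult.left_commute)
  also have "\<dots> = G * z * (real (sum_mset M) * (c * (2 + ?F)) + ?F * e)"
    unfolding sum_mset_weight1 by simp
  also have "\<dots> / real (sum_mset M) = G * z * (c * (2 + ?F) + e * ?F / real (sum_mset M))"
  proof -
    have gen: "G * z * (T * X + ?F * e) / T = G * z * (X + e * ?F / T)" if "T \<noteq> 0" for T X
      using that by (simp add: field_simps)
    have "real (sum_mset M) \<noteq> 0" using m1 by linarith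
    then show ?thesis by (rule gen)
  qed
  also have "\<dots> \<le> G * z * (4 * exp 3 * \<omega> * (2 + ?F) + \<omega> * (2 + ?F))"
    using c e G0 z by (intro mult_left_mono add_mono mult_right_mono) auto
  also have "\<dots> = G * z * source_const * (2 + ?F) / real d" by (simp add: source_const_def \<omega>_def field_simps add_divide_distrib)
  finally show ?thesis .
qed

lemma weighted_average_le:
  assumes "0 < sum_mset M" "0 \<le> c"
  shows "(\<Sum>s\<in>#M. real s * (c * (1 + (if s = 1 then u else 0)))) / real (sum_mset M)
     = c * (1 + u * real (count M 1) / real (sum_mset M))"
proof -
  have "(\<Sum>s\<in>#M. real s * (c * (1 + (if s = 1 then u else 0)))) = (\<Sum>s\<in>#M. real s * (c + (if s = 1 then c * u else 0)))"
    by (intro arg_cong[where f = sum_mset] image_mset_cong) (auto simp: algebra_simps)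
  also have "\<dots> = real (sum_mset M) * c + real (count M 1) * (c * u)" by (rule sum_mset_weight1)
  finally have e: "(\<Sum>s\<in>#M. real s * (c * (1 + (if s = 1 then u else 0)))) = real (sum_mset M) * c + real (count M 1) * (c * u)" .
  define T where "T = real (sum_mset M)"
  have "T > 0" unfolding T_def using assms by (simp only: of_nat_0_less_iff)
  then show ?thesis unfolding e T_def[symmetric] by (simp add: field_simps)
qed

lemma exp_le_1_plus_2z: "0 \<le> z \<Longrightarrow> z \<le> 1 \<Longrightarrow> exp z \<le> 1 + 2 * (z :: real)"
proof -
  assume z: "0 \<le> z" "z \<le> 1"
  have "exp z \<le> 1 + z + z\<^sup>2" by (rule exp_bound[OF z])
  also have "z\<^sup>2 \<le> z" using z by (simp add: power2_eq_square mult_left_le)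
  finally show ?thesis by simp
qed

section \<open>Induction on the cycles\<close>

text \<open>The list is sorted, so the part of it that remains after removing the head has a larger
  average, and the bound \<open>length as \<le> \<kappa> * sum_list as\<close> passes to the tail. It follows that the
  cycle revealed when \<open>l\<close> cycles are left meets \<open>m \<ge> l / \<kappa>\<close> points and creates an error of
  order \<open>\<kappa> / l\<close>; these add up to the factor \<open>harm\<close>. A linear dependence on the number \<open>F\<close> of
  fixed points is not stable under the recursion, but \<open>1 + F \<le> exp (\<theta> F) / \<theta>\<close> is, at the price
  of \<open>1 / \<theta>\<close>; and the base may grow from \<open>exp (\<theta> * harm (l - 1))\<close> to \<open>exp (\<theta> * harm l)\<close> with
  each cycle, which leaves room for the loss in the propagation.

  The exponent is the number of fixed points of \<open>\<beta>\<close> as long as all cycles of \<open>\<rho>\<close> have length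
  at least \<open>2\<close>. A cycle of length \<open>1\<close> in \<open>\<rho>\<close> merely erases a point of \<open>\<beta>\<close>, which is likely to
  create a fixed point if \<open>\<beta>\<close> has many cycles of length \<open>2\<close>; but it never increases the number
  of cycles. As the ones come first in a sorted list, it suffices to weaken the exponent to
  \<open>size M\<close> from the moment when they appear.\<close>

lemma type_avg_near_U:
  fixes z \<theta> \<kappa> :: real and n n0 :: nat
  assumes z: "0 < z" "z \<le> 1 / 3" and \<theta>: "0 < \<theta>" "\<theta> \<le> 1" and \<kappa>: "0 < \<kappa>" "12 * z * \<kappa> \<le> \<theta>" and n0: "\<theta> * harm n0 \<le> z"
  defines "A \<equiv> 4 * source_const * (growth z n)\<^sup>2 * z * harm n * \<kappa> / \<theta>"
  defines "Bl \<equiv> \<lambda>l. exp (\<theta> * harm l)"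
  shows "sorted as \<Longrightarrow> as \<noteq> [] \<Longrightarrow> \<forall>a\<in>set as. a \<ge> 1 \<Longrightarrow> sum_list as \<le> n \<Longrightarrow> length as \<le> n0
    \<Longrightarrow> real (length as) \<le> \<kappa> * real (sum_list as) \<Longrightarrow> 0 \<notin># M \<Longrightarrow> sum_mset M = sum_list as \<Longrightarrow>
    (hd as \<ge> 2 \<or> tl as = [] \<longrightarrow> coeff_norm z (type_avg as M - U (sum_list as))
        \<le> A * harm (length as) * growth (18 * z) (sum_list as) * Bl (length as) ^ count M 1) \<and>
    coeff_norm z (type_avg as M - U (sum_list as)) \<le> A * harm (length as) * growth (18 * z) (sum_list as) * Bl (length as) ^ size M"
proof (induction as arbitrary: M)
  case Nil
  then show ?case by simp
next
  case (Cons a as)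
  define F where "F = count M 1"
  define l where "l = length (a # as)"
  define m where "m = sum_list (a # as)"
  have a1: "1 \<le> a" using Cons.prems by simp
  have M: "0 \<notin># M" "sum_mset M = m" using Cons.prems by (simp_all add: m_def)
  have mn: "1 \<le> m" "m \<le> n" using Cons.prems a1 by (simp_all add: m_def)
  have m0: "0 < sum_mset M" "0 < real m" using M mn by auto
  have z': "0 \<le> z" "z \<le> 1" using z by auto
  have g1: "1 \<le> growth z n" using growth_ge_1[OF z'(1)] .
  have h1: "1 \<le> (harm n :: real)" using harm_mono[of 1 n, where 'a = real] mn by (simp add: harm_expand)
  have "1 \<le> exp (3 :: real)" by simp
  then have Cs1: "2 \<le> source_const" unfolding source_const_def by linarith
  have A0: "0 \<le> A" unfolding A_def using Cs1 z \<theta> \<kappa> h1 by simp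
  have gg: "1 \<le> growth (18 * z) k" for k using growth_ge_1[of "18 * z" k] z by simp
  have lm: "1 / real m \<le> \<kappa> / real l"
  proof -
    have "real l \<le> \<kappa> * real m" using Cons.prems(6) by (simp only: l_def m_def)
    moreover have "0 < real l" by (simp add: l_def)
    ultimately show ?thesis using m0 by (simp add: field_simps)
  qed
  have l0: "0 < real l" by (simp add: l_def)
  have Bl1: "1 \<le> Bl k" for k unfolding Bl_def using \<theta> harm_nonneg[of k, where 'a = real] by simp
  have ln0: "l \<le> n0" using Cons.prems by (simp add: l_def)
  have Blz: "Bl k \<le> exp z" if "k \<le> l" for k
  proof -
    have "harm k \<le> (harm n0 :: real)" using that ln0 by (intro harm_mono) simp
    then have "\<theta> * harm k \<le> \<theta> * harm n0" using \<theta> by (intro mult_left_mono) auto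
    then show ?thesis unfolding Bl_def using n0 by simp
  qed
  have Fs: "F \<le> size M" unfolding F_def by (rule count_le_size)
  \<comment> \<open>the linear dependence on the number of fixed points is traded for an exponential one\<close>
  have thF: "1 + real F \<le> Bl l ^ F / \<theta>"
  proof -
    have "\<theta> * (1 + real F) \<le> 1 + real F * \<theta>" using \<theta> by (simp add: algebra_simps)
    also have "\<dots> \<le> exp (real F * \<theta>)" by (rule exp_ge_add_one_self)
    also have "\<dots> \<le> exp (real F * (\<theta> * harm l))"
    proof -
      have "harm 1 \<le> (harm l :: real)" by (intro harm_mono) (simp add: l_def)
      then have "\<theta> * 1 \<le> \<theta> * harm l" using \<theta> by (intro mult_left_mono) (auto simp: harm_expand)
      then have "real F * \<theta> \<le> real F * (\<theta> * harm l)" by (intro mult_left_mono) auto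
      then show ?thesis by simp
    qed
    also have "\<dots> = Bl l ^ F" unfolding Bl_def by (rule exp_of_nat_mult)
    finally show ?thesis using \<theta> by (simp add: pos_le_divide_eq mult.commute)
  qed
  have pows: "Bl l ^ F \<le> Bl l ^ size M" using Bl1 Fs by (intro power_increasing) auto
  define A' where "A' = 4 * source_const * growth z n * z * \<kappa> / \<theta>"
  have A'0: "0 \<le> A'" unfolding A'_def using Cs1 z \<theta> \<kappa> g1 by simp
  have A'A: "A' \<le> A"
  proof -
    have "1 * 1 \<le> growth z n * harm n" using g1 h1 by (intro mult_mono) auto
    then have "A' * 1 \<le> A' * (growth z n * harm n)" using A'0 by (intro mult_left_mono) auto
    also have "\<dots> = A" by (simp add: A_def A'_def power2_eq_square)
    finally show ?thesis by simp
  qed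
  show ?case
  proof (cases "as = []")
    case True
    have la: "l = 1" "m = a" using True by (simp_all add: l_def m_def)
    have Q0: "type_avg [] = (\<lambda>_. 1)" by (rule ext) simp
    have bnd: "coeff_norm z (cycle_avg (\<lambda>_. 1) (a - 1) (s - 1) (M - {#s#}) - U a)
        \<le> z * (growth z n)\<^sup>2 * (8 * harm n * (1 + real F) / real m)" if s: "s \<in># M" for s
    proof -
      note ss = star_sizes[OF M(1) s M(2)]
      have "coeff_norm z (cycle_avg (\<lambda>_. 1) ((s - 1) + sum_mset (M - {#s#})) (s - 1) (M - {#s#}) - U ((s - 1) + sum_mset (M - {#s#}) + 1))
        \<le> z * (growth z ((s - 1) + sum_mset (M - {#s#}) + 1))\<^sup>2 * (8 * harm ((s - 1) + sum_mset (M - {#s#}) + 1)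
            * (1 + real (count (add_mset (Suc (s - 1)) (M - {#s#})) 1)) / real ((s - 1) + sum_mset (M - {#s#}) + 1))"
        by (rule full_cycle_estimate[OF ss(2) z'(1)])
      also have "(s - 1) + sum_mset (M - {#s#}) + 1 = m" using ss(3) mn by simp
      also have "add_mset (Suc (s - 1)) (M - {#s#}) = M" using ss(1) s by simp
      finally have "coeff_norm z (cycle_avg (\<lambda>_. 1) (a - 1) (s - 1) (M - {#s#}) - U a)
          \<le> z * (growth z m)\<^sup>2 * (8 * harm m * (1 + real F) / real m)"
        unfolding ss(3) F_def la(2) .
      also have "\<dots> \<le> z * (growth z n)\<^sup>2 * (8 * harm n * (1 + real F) / real m)"
        using growth_mono[OF z'(1) mn(2)] growth_ge_1[OF z'(1), of m] z harm_mono[OF mn(2), where 'a = real] harm_nonneg[of m, where 'a = real]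
        by (intro mult_mono divide_right_mono mult_left_mono power_mono mult_nonneg_nonneg) (auto intro: mult_nonneg_nonneg)
      finally show ?thesis .
    qed
    have "coeff_norm z (type_avg (a # as) M - U a) \<le> (\<Sum>s\<in>#M. real s * (z * (growth z n)\<^sup>2 * (8 * harm n * (1 + real F) / real m))) / real (sum_mset M)"
      unfolding True type_avg.simps(2) Q0 average_diff[OF m0(1)]
      by (rule coeff_norm_average[OF z'(1)]) (rule bnd)
    also have "\<dots> = z * (growth z n)\<^sup>2 * (8 * harm n * (1 + real F) / real m)"
      unfolding sum_mset_weight M(2) using m0(2) by simp
    also have "\<dots> = z * (growth z n)\<^sup>2 * 8 * harm n * (1 + real F) * (1 / real m)" by simp
    also have "\<dots> \<le> z * (growth z n)\<^sup>2 * (4 * source_const) * harm n * (Bl l ^ F / \<theta>) * \<kappa>"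
      using thF lm la z h1 Cs1 \<theta> \<kappa> Bl1[of l]
      by (intro mult_mono mult_nonneg_nonneg mult_left_mono) (auto intro!: divide_nonneg_pos)
    also have "\<dots> = A * Bl l ^ F" by (simp add: A_def)
    also have "\<dots> \<le> A * harm l * growth (18 * z) m * Bl l ^ F"
    proof -
      have "A * 1 * 1 * Bl l ^ F \<le> A * harm l * growth (18 * z) m * Bl l ^ F"
        using A0 gg[of m] order_trans[OF zero_le_one gg[of m]] Bl1[of l] la
        by (intro mult_mono) (auto simp: harm_expand)
      then show ?thesis by simp
    qed
    finally have 1: "coeff_norm z (type_avg (a # as) M - U a) \<le> A * harm l * growth (18 * z) m * Bl l ^ F" .
    also have "\<dots> \<le> A * harm l * growth (18 * z) m * Bl l ^ size M"
      using pows A0 gg[of m] harm_nonneg[of l, where 'a = real] by (intro mult_left_mono) auto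
    finally have 2: "coeff_norm z (type_avg (a # as) M - U a) \<le> A * harm l * growth (18 * z) m * Bl l ^ size M" .
    show ?thesis using 1 2 unfolding l_def[symmetric] m_def[symmetric] la(2) F_def by blast
  next
    case False
    define d where "d = sum_list as"
    define k where "k = length as"
    have md: "m = d + a" by (simp add: m_def d_def)
    have lk: "l = Suc k" by (simp add: l_def k_def)
    have k0: "0 < k" using False by (simp add: k_def)
    have srt: "sorted as" "\<forall>b\<in>set as. a \<le> b" using Cons.prems by auto
    have hd_in: "hd as \<in> set as" using False by simp
    have ad: "a \<le> d"
      using srt(2) hd_in member_le_sum_list[OF hd_in] by (force simp: d_def)
    have d1: "1 \<le> d" using ad a1 by simp
    \<comment> \<open>sortedness enters here: the \<open>k\<close> remaining cycles are at least as long as the one removed\<close>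
    have kad: "k * a \<le> d"
      using srt(2) sum_list_mono[of as "\<lambda>_. a" "\<lambda>x. x"] by (simp add: d_def k_def sum_list_triv)
    have kd: "real k \<le> \<kappa> * real d"
    proof -
      have "real k * (real k + 1) \<le> \<kappa> * (real k * real m)"
      proof -
        have "real k + 1 \<le> \<kappa> * real m" using Cons.prems(6) lk by (simp add: l_def m_def k_def)
        then have "real k * (real k + 1) \<le> real k * (\<kappa> * real m)" by (intro mult_left_mono) auto
        then show ?thesis by (simp only: mult_ac)
      qed
      also have "real k * real m \<le> (real k + 1) * real d"
      proof -
        have "real (k * a) \<le> real d" using kad by (simp only: of_nat_le_iff)
        then show ?thesis by (simp add: md algebra_simps)
      qed
      finally have "(real k + 1) * real k \<le> (real k + 1) * (\<kappa> * real d)"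
        using \<kappa> by (simp add: mult_left_mono algebra_simps)
      then show ?thesis by (simp only: mult_le_cancel_left_pos)
    qed
    have dm: "1 / real d \<le> 2 / real m"
    proof -
      have "real m \<le> 2 * real d" using ad md by simp
      then show ?thesis using d1 m0 by (simp add: field_simps)
    qed
    have dkl: "1 / real d \<le> 2 * \<kappa> / real l"
    proof -
      have "1 / real d \<le> 2 * (1 / real m)" using dm by simp
      also have "\<dots> \<le> 2 * (\<kappa> / real l)" using lm by (rule mult_left_mono) simp
      finally show ?thesis by simp
    qed
    have IH: "(hd as \<ge> 2 \<or> tl as = [] \<longrightarrow> coeff_norm z (type_avg as N - U d) \<le> A * harm k * growth (18 * z) d * Bl k ^ count N 1) \<and>
        coeff_norm z (type_avg as N - U d) \<le> A * harm k * growth (18 * z) d * Bl k ^ size N" if "0 \<notin># N" "sum_mset N = d" for N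
      unfolding d_def k_def
      by (rule Cons.IH[OF srt(1) False]) (use Cons.prems that kd in \<open>auto simp: d_def k_def\<close>)
    have source: "coeff_norm z (smult (1 / real (sum_mset M)) (\<Sum>s\<in>#M. smult (real s) (cycle_avg (\<lambda>_. U d) (a - 1) (s - 1) (M - {#s#}))) - U m)
        \<le> A / real l * growth (18 * z) m * Bl l ^ F"
    proof -
      have "coeff_norm z (smult (1 / real (sum_mset M)) (\<Sum>s\<in>#M. smult (real s) (cycle_avg (\<lambda>_. U d) (a - 1) (s - 1) (M - {#s#}))) - U m)
         \<le> growth z n * z * source_const * (2 + real F) / real d"
        unfolding md F_def using M(2) mn(2) growth_mono[OF z'(1), of m n]
        by (intro average_cycle_avg_U_near_U[OF z' a1 ad M(1)]) (simp_all add: md)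
      also have "\<dots> = growth z n * z * source_const * (2 + real F) * (1 / real d)" by simp
      also have "\<dots> \<le> growth z n * z * source_const * (2 * (Bl l ^ F / \<theta>)) * (2 * \<kappa> / real l)"
        using dkl thF g1 z Cs1 Bl1[of l] \<theta> by (intro mult_mono mult_left_mono mult_nonneg_nonneg) auto
      also have "\<dots> = A' / real l * 1 * Bl l ^ F" by (simp add: A'_def)
      also have "\<dots> \<le> A / real l * growth (18 * z) m * Bl l ^ F"
        using A'A A0 A'0 gg[of m] Bl1[of l] l0 by (intro mult_mono divide_right_mono) auto
      finally show ?thesis .
    qed
    define h where "h N = type_avg as N - U d" for N
    \<comment> \<open>the propagated error of the other cycles plus the error created by the first cycle\<close>
    have decomp: "coeff_norm z (type_avg (a # as) M - U m)
       \<le> coeff_norm z (smult (1 / real (sum_mset M)) (\<Sum>s\<in>#M. smult (real s) (cycle_avg h (a - 1) (s - 1) (M - {#s#}))))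
         + A / real l * growth (18 * z) m * Bl l ^ F"
    proof -
      have sm: "(\<Sum>s\<in>#N. smult (real s) (P s)) = (\<Sum>s\<in>#N. smult (real s) (P s - R s)) + (\<Sum>s\<in>#N. smult (real s) (R s))"
        for N :: "nat multiset" and P R :: "nat \<Rightarrow> real poly"
        by (induction N) (auto simp: smult_diff_right algebra_simps)
      have decomp_eq: "type_avg (a # as) M - U m = smult (1 / real (sum_mset M)) (\<Sum>s\<in>#M. smult (real s) (cycle_avg h (a - 1) (s - 1) (M - {#s#})))
         + (smult (1 / real (sum_mset M)) (\<Sum>s\<in>#M. smult (real s) (cycle_avg (\<lambda>_. U d) (a - 1) (s - 1) (M - {#s#}))) - U m)"
        unfolding type_avg.simps(2) h_def cycle_avg_diff
        by (subst sm[where R = "\<lambda>s. cycle_avg (\<lambda>_. U d) (a - 1) (s - 1) (M - {#s#})"]) (simp add: smult_add_right)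
      show ?thesis unfolding decomp_eq
        by (rule order_trans[OF coeff_norm_triangle[OF z'(1)] add_left_mono[OF source]])
    qed
    define E where "E = A * harm k * growth (18 * z) d"
    have E0: "0 \<le> E" unfolding E_def using A0 gg[of d] harm_nonneg[of k, where 'a = real] by simp
    have Em: "E * growth (18 * z) (m - 1) / growth (18 * z) d \<le> A * harm k * growth (18 * z) m" "E \<le> A * harm k * growth (18 * z) m"
    proof -
      have "A * harm k * growth (18 * z) (m - 1) \<le> A * harm k * growth (18 * z) m"
        using A0 harm_nonneg[of k, where 'a = real] z by (intro mult_left_mono growth_mono) auto
      moreover have "E * growth (18 * z) (m - 1) / growth (18 * z) d = A * harm k * growth (18 * z) (m - 1)"
        unfolding E_def using gg[of d] by simp
      ultimately show "E * growth (18 * z) (m - 1) / growth (18 * z) d \<le> A * harm k * growth (18 * z) m" by simp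
      show "E \<le> A * harm k * growth (18 * z) m" unfolding E_def
        using A0 harm_nonneg[of k, where 'a = real] z md by (intro mult_left_mono growth_mono) auto
    qed
    have Bll: "Bl l = Bl k * exp (\<theta> / real l)"
      unfolding Bl_def lk harm_Suc by (simp add: exp_add[symmetric] algebra_simps inverse_eq_divide)
    \<comment> \<open>adding the new error \<open>A / l\<close> to the old one with \<open>harm k\<close> gives \<open>harm l\<close>\<close>
    have comb: "A * harm k * growth (18 * z) m * X + A / real l * growth (18 * z) m * X = A * harm l * growth (18 * z) m * X" for X
      unfolding lk harm_Suc by (simp add: algebra_simps inverse_eq_divide)
    show ?thesis
    proof (cases "a = 1")
      case True
      have thz: "z / real m \<le> \<theta> / real l"
      proof -
        have "z * (1 / real m) \<le> z * (\<kappa> / real l)" using lm z by (intro mult_left_mono) auto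
        also have "\<dots> = z * \<kappa> / real l" by simp
        also have "\<dots> \<le> \<theta> / real l"
        proof (rule divide_right_mono)
          have "0 \<le> z * \<kappa>" using z \<kappa> by simp
          moreover have "12 * z * \<kappa> = 12 * (z * \<kappa>)" by simp
          ultimately show "z * \<kappa> \<le> \<theta>" using \<kappa>(2) by linarith
        qed simp
        finally show ?thesis by simp
      qed
      have bnd: "coeff_norm z (cycle_avg h (a - 1) (s - 1) (M - {#s#})) \<le> (E * Bl k ^ size M) * (1 + (if s = 1 then z else 0))"
        if s: "s \<in># M" for s
      proof -
        note ss = star_sizes[OF M(1) s M(2)]
        let ?N = "add_part (s - 1) (M - {#s#})"
        have N: "0 \<notin># ?N" "sum_mset ?N = d" using ss True md by (auto simp: add_part_def)
        have "size (M - {#s#}) < size M" using s by (rule size_Diff1_less)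
        then have "size ?N \<le> size M" unfolding add_part_def by (auto simp only: size_add_mset split: if_splits)
        then have pw: "Bl k ^ size ?N \<le> Bl k ^ size M" using Bl1 by (intro power_increasing) auto
        have "coeff_norm z (closing (s - 1) * h ?N) \<le> coeff_norm z (closing (s - 1)) * coeff_norm z (h ?N)" by (rule coeff_norm_mult[OF z'(1)])
        also have "\<dots> \<le> (1 + (if s = 1 then z else 0)) * (E * Bl k ^ size M)"
        proof (rule mult_mono)
          show "coeff_norm z (closing (s - 1)) \<le> 1 + (if s = 1 then z else 0)" using ss(1) by (auto simp: coeff_norm_closing)
          have "coeff_norm z (h ?N) \<le> E * Bl k ^ size ?N" unfolding h_def E_def using IH[OF N] by blast
          also have "\<dots> \<le> E * Bl k ^ size M" using pw E0 by (rule mult_left_mono)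
          finally show "coeff_norm z (h ?N) \<le> E * Bl k ^ size M" .
        qed (use z coeff_norm_nonneg[OF z'(1)] in auto)
        finally show ?thesis using True by (simp add: mult.commute)
      qed
      have "coeff_norm z (smult (1 / real (sum_mset M)) (\<Sum>s\<in>#M. smult (real s) (cycle_avg h (a - 1) (s - 1) (M - {#s#}))))
         \<le> (\<Sum>s\<in>#M. real s * ((E * Bl k ^ size M) * (1 + (if s = 1 then z else 0)))) / real (sum_mset M)"
        by (rule coeff_norm_average[OF z'(1)]) (rule bnd)
      also have "\<dots> = E * Bl k ^ size M * (1 + z * real F / real m)"
        using weighted_average_le[OF m0(1), of "E * Bl k ^ size M" z] E0 Bl1[of k] unfolding M(2) F_def by simp
      also have "\<dots> \<le> E * Bl k ^ size M * exp (\<theta> / real l) ^ size M"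
      proof (rule mult_left_mono)
        have "z / real m * real F \<le> \<theta> / real l * real (size M)"
          using thz Fs z \<theta> by (intro mult_mono) auto
        then have "1 + z * real F / real m \<le> 1 + real (size M) * (\<theta> / real l)" by (simp add: mult.commute)
        also have "\<dots> \<le> exp (real (size M) * (\<theta> / real l))" by (rule exp_ge_add_one_self)
        also have "\<dots> = exp (\<theta> / real l) ^ size M" by (rule exp_of_nat_mult)
        finally show "1 + z * real F / real m \<le> exp (\<theta> / real l) ^ size M" .
      qed (use E0 Bl1[of k] in auto)
      also have "\<dots> = E * Bl l ^ size M" unfolding Bll by (simp add: power_mult_distrib)
      also have "\<dots> \<le> A * harm k * growth (18 * z) m * Bl l ^ size M"
        using Em(2) Bl1[of l] by (intro mult_right_mono) auto
      finally have "coeff_norm z (type_avg (a # as) M - U m)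
          \<le> A * harm k * growth (18 * z) m * Bl l ^ size M + A / real l * growth (18 * z) m * Bl l ^ size M"
        using decomp mult_left_mono[OF pows, of "A / real l * growth (18 * z) m"] A0 gg[of m] by simp
      then have "coeff_norm z (type_avg (a # as) M - U m) \<le> A * harm l * growth (18 * z) m * Bl l ^ size M" unfolding comb .
      then show ?thesis using True False unfolding l_def[symmetric] m_def[symmetric] by simp
    next
      case a2: False
      then have "a = Suc (Suc (a - 2))" using a1 by simp
      then obtain r where r: "a = Suc (Suc r)" by blast
      have hd2: "2 \<le> hd as" using srt(2) hd_in r by force
      define u where "u = z + Bl k - 1"
      define B1 where "B1 = Bl k * (1 + u / real d)"
      have Blk: "Bl k \<le> 1 + 2 * z" using Blz[of k] lk exp_le_1_plus_2z[OF z'] by simp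
      have u: "0 \<le> u" "u \<le> 3 * z" using Bl1[of k] Blk z unfolding u_def by auto
      have ud: "2 * (u / real d) \<le> \<theta> / real l"
      proof -
        have "u * (1 / real d) \<le> 3 * z * (2 * \<kappa> / real l)" using u dkl z by (intro mult_mono) auto
        then have "2 * (u / real d) \<le> 12 * z * \<kappa> / real l" by simp
        also have "\<dots> \<le> \<theta> / real l" using \<kappa> by (intro divide_right_mono) auto
        finally show ?thesis .
      qed
      have B1l: "B1 * (1 + u / real d) \<le> Bl l"
      proof -
        have "(1 + u / real d) * (1 + u / real d) \<le> exp (u / real d) * exp (u / real d)"
          using u by (intro mult_mono) (auto intro: exp_ge_add_one_self)
        also have "\<dots> = exp (2 * (u / real d))" by (simp add: exp_add[symmetric])
        also have "\<dots> \<le> exp (\<theta> / real l)" using ud by simp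
        finally have "Bl k * ((1 + u / real d) * (1 + u / real d)) \<le> Bl k * exp (\<theta> / real l)"
          using Bl1[of k] by (intro mult_left_mono) auto
        then show ?thesis unfolding Bll B1_def by (simp only: mult_ac)
      qed
      have B11: "1 \<le> B1" "B1 \<le> B1 * (1 + u / real d)"
      proof -
        have "1 * 1 \<le> Bl k * (1 + u / real d)" using Bl1[of k] u by (intro mult_mono) auto
        then show b: "1 \<le> B1" by (simp add: B1_def)
        have "B1 * 1 \<le> B1 * (1 + u / real d)" using b u by (intro mult_left_mono) auto
        then show "B1 \<le> B1 * (1 + u / real d)" by simp
      qed
      have B1w: "B1 \<le> 1 + 3 * z" using B11(2) B1l Blz[of l] exp_le_1_plus_2z[OF z'] z by simp
      define E' where "E' = E * growth (6 * (3 * z)) (d + Suc r) / growth (6 * (3 * z)) d"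
      have E'm: "E' \<le> A * harm k * growth (18 * z) m" "0 \<le> E'"
        using Em(1) md r E0 gg[of d] gg[of "d + Suc r"] by (auto simp: E'_def)
      have bnd: "coeff_norm z (cycle_avg h (a - 1) (s - 1) (M - {#s#})) \<le> (E' * B1 ^ F) * (1 + (if s = 1 then u else 0))"
        if s: "s \<in># M" for s
      proof -
        note ss = star_sizes[OF M(1) s M(2)]
        have hb: "coeff_norm z (h N) \<le> E * Bl k ^ count N 1" if "0 \<notin># N" "sum_mset N = d" for N
          unfolding h_def E_def using IH[OF that] hd2 by blast
        have e: "(s - 1) + sum_mset (M - {#s#}) = d + Suc r" using ss(3) md r by simp
        have "coeff_norm z (cycle_avg h (Suc r) (s - 1) (M - {#s#})) \<le> E' * B1 ^ count (M - {#s#}) 1 * (1 + (if s - 1 = 0 then u else 0))"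
          unfolding E'_def
          by (rule cycle_avg_propagates[OF z'(1) Bl1[of k] E0 u_def u(2) _ d1 B1_def B1w hb ss(2) e]) (use z in auto)
        also have "\<dots> \<le> E' * B1 ^ F * (1 + (if s = 1 then u else 0))"
        proof (intro mult_mono mult_left_mono)
          show "B1 ^ count (M - {#s#}) 1 \<le> B1 ^ F" unfolding F_def using B11(1) by (intro power_increasing) auto
          show "1 + (if s - 1 = 0 then u else 0) \<le> 1 + (if s = 1 then u else 0)" using ss(1) by auto
        qed (use E'm u B11 in auto)
        finally show ?thesis using r by simp
      qed
      have "coeff_norm z (smult (1 / real (sum_mset M)) (\<Sum>s\<in>#M. smult (real s) (cycle_avg h (a - 1) (s - 1) (M - {#s#}))))
         \<le> (\<Sum>s\<in>#M. real s * ((E' * B1 ^ F) * (1 + (if s = 1 then u else 0)))) / real (sum_mset M)"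
        by (rule coeff_norm_average[OF z'(1)]) (rule bnd)
      also have "\<dots> = E' * B1 ^ F * (1 + u * real F / real m)"
        using weighted_average_le[OF m0(1), of "E' * B1 ^ F" u] E'm B11 unfolding M(2) F_def by simp
      also have "\<dots> \<le> E' * B1 ^ F * (1 + u / real d) ^ F"
      proof (rule mult_left_mono)
        have "1 / real m \<le> 1 / real d" using md d1 by (intro frac_le) auto
        then have "u * real F * (1 / real m) \<le> u * real F * (1 / real d)" using u by (intro mult_left_mono) auto
        then have "1 + u * real F / real m \<le> 1 + real F * (u / real d)" by (simp add: mult.commute)
        also have "\<dots> \<le> (1 + u / real d) ^ F"
        proof (rule Bernoulli_inequality)
          have "0 \<le> u / real d" using u by simp
          then show "- 1 \<le> u / real d" by linarith
        qed
        finally show "1 + u * real F / real m \<le> (1 + u / real d) ^ F" .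
      qed (use E'm B11 in auto)
      also have "\<dots> = E' * (B1 * (1 + u / real d)) ^ F" by (simp add: power_mult_distrib)
      also have "\<dots> \<le> E' * Bl l ^ F"
        using B1l B11 E'm by (intro mult_left_mono power_mono) auto
      also have "\<dots> \<le> A * harm k * growth (18 * z) m * Bl l ^ F" using E'm Bl1[of l] by (intro mult_right_mono) auto
      finally have "coeff_norm z (type_avg (a # as) M - U m)
          \<le> A * harm k * growth (18 * z) m * Bl l ^ F + A / real l * growth (18 * z) m * Bl l ^ F"
        using decomp by linarith
      then have 1: "coeff_norm z (type_avg (a # as) M - U m) \<le> A * harm l * growth (18 * z) m * Bl l ^ F" unfolding comb .
      also have "\<dots> \<le> A * harm l * growth (18 * z) m * Bl l ^ size M"
        using pows A0 gg[of m] harm_nonneg[of l, where 'a = real] by (intro mult_left_mono) auto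
      finally have 2: "coeff_norm z (type_avg (a # as) M - U m) \<le> A * harm l * growth (18 * z) m * Bl l ^ size M" .
      show ?thesis using 1 2 unfolding l_def[symmetric] m_def[symmetric] F_def by blast
    qed
  qed
qed

section \<open>The random variables as polynomials\<close>

lemma coeff_X1_power: "coeff (X1 ^ v) j = real (v choose j)"
  by (cases "j \<le> v")
     (simp_all add: coeff_linear_poly_power coeff_eq_0 degree_linear_power binomial_eq_0)

text \<open>The leading term is removed with a multiple of \<open>X (X - 1) \<cdots> (X - l)\<close>.\<close>

lemma poly_binomial_basis:
  fixes p :: "real poly"
  shows "degree p \<le> l \<Longrightarrow> \<exists>c. \<forall>x. poly p x = (\<Sum>j\<le>l. c j * (x gchoose j))"
proof (induction l arbitrary: p)
  case 0
  then show ?case by (intro exI[of _ "\<lambda>_. coeff p 0"]) (auto elim!: degree_eq_zeroE)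
next
  case (Suc l)
  define Q :: "real poly" where "Q = (\<Prod>i<Suc l. [:- real i, 1:])"
  have dQ: "degree Q = Suc l" unfolding Q_def by (subst degree_prod_eq_sum_degree) auto
  have lQ: "coeff Q (Suc l) = 1"
    using lead_coeff_prod[of "\<lambda>i. [:- real i, 1:]" "{..<Suc l}"] dQ by (simp add: Q_def)
  have pQ: "poly Q x = fact (Suc l) * (x gchoose Suc l)" for x
    unfolding Q_def poly_prod gbinomial_prod_rev atLeast0LessThan by (simp del: fact_Suc prod.lessThan_Suc)
  have "coeff (p - smult (coeff p (Suc l)) Q) k = 0" if "l < k" for k
  proof (cases "k = Suc l")
    case True
    then show ?thesis by (simp only: coeff_diff coeff_smult lQ mult_1_right diff_self)
  next
    case False
    then have "coeff p k = 0" "coeff Q k = 0" using that dQ Suc.prems by (intro coeff_eq_0; linarith)+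
    then show ?thesis by (simp only: coeff_diff coeff_smult)
  qed
  then have "degree (p - smult (coeff p (Suc l)) Q) \<le> l" by (intro degree_le) blast
  from Suc.IH[OF this] obtain c where
    c: "\<And>x. poly (p - smult (coeff p (Suc l)) Q) x = (\<Sum>j\<le>l. c j * (x gchoose j))" by blast
  define c' where "c' = c(Suc l := coeff p (Suc l) * fact (Suc l))"
  have "poly p x = (\<Sum>j\<le>Suc l. c' j * (x gchoose j))" for x
  proof -
    have "(\<Sum>j\<le>Suc l. c' j * (x gchoose j)) = (\<Sum>j\<le>l. c' j * (x gchoose j)) + c' (Suc l) * (x gchoose Suc l)"
      by simp
    also have "(\<Sum>j\<le>l. c' j * (x gchoose j)) = (\<Sum>j\<le>l. c j * (x gchoose j))"
      by (intro sum.cong) (auto simp: c'_def)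
    also have "\<dots> = poly p x - coeff p (Suc l) * poly Q x" by (simp flip: c)
    finally show ?thesis by (simp add: c'_def pQ)
  qed
  then show ?case by blast
qed

lemma expectation_binomial_basis:
  assumes "finite (set_pmf D)" "\<And>x. poly p x = (\<Sum>j\<le>l. c j * (x gchoose j))"
  shows "measure_pmf.expectation D (\<lambda>v. poly p (real v))
       = (\<Sum>j\<le>l. c j * measure_pmf.expectation D (\<lambda>v. real (v choose j)))"
proof -
  have "measure_pmf.expectation D (\<lambda>v. poly p (real v))
      = measure_pmf.expectation D (\<lambda>v. \<Sum>j\<le>l. c j * real (v choose j))"
    by (simp add: assms(2) binomial_gbinomial)
  also have "\<dots> = (\<Sum>j\<le>l. measure_pmf.expectation D (\<lambda>v. c j * real (v choose j)))"
    by (rule Bochner_Integration.integral_sum) (rule integrable_measure_pmf_finite[OF assms(1)])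
  finally show ?thesis by simp
qed

text \<open>The points are erased one after the other: the image of \<open>a\<close> is arbitrary, and only \<open>a\<close>
  itself closes a cycle, while any other image changes the sign. With \<open>c = 1\<close> this counts
  permutations by cycles, with \<open>c = - 1\<close> it does so with signs.\<close>

lemma sum_permutations_by_cycles:
  fixes c :: real
  assumes "finite S" "c = 1 \<or> c = - 1"
  shows "(\<Sum>\<pi> | \<pi> permutes S. smult (if evenperm \<pi> then 1 else c) (X1 ^ num_cycles S \<pi>))
       = (\<Prod>i<card S. [:1 + c * real i, 1:])"
  using assms(1)
proof (induction S)
  case empty
  have "{\<pi>. \<pi> permutes {}} = {id :: 'a \<Rightarrow> 'a}" by auto
  then show ?case by (simp add: evenperm_id num_cycles_def)
next
  case (insert a S)
  define sg where "sg = (\<lambda>\<pi> :: 'a \<Rightarrow> 'a. if evenperm \<pi> then 1 else c)"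
  have step: "smult (sg (Transposition.transpose a b \<circ> q)) (X1 ^ num_cycles (insert a S) (Transposition.transpose a b \<circ> q))
      = (if b = a then X1 else [:c:]) * smult (sg q) (X1 ^ num_cycles S q)"
    if b: "b \<in> insert a S" and q: "q permutes S" for b q
  proof -
    let ?\<pi> = "Transposition.transpose a b \<circ> q"
    have qa: "q a = a" using permutes_not_in[OF q] insert by blast
    have q': "q permutes insert a S" using q by (rule permutes_subset) auto
    have pi: "?\<pi> permutes insert a S"
      using b by (intro permutes_compose[OF q'] permutes_swap_id) auto
    have pa: "?\<pi> a = b" by (simp add: qa)
    have "contract ?\<pi> a = q" unfolding contract_def pa by (simp add: fun_eq_iff)
    then have n: "num_cycles (insert a S) ?\<pi> = (if b = a then 1 else 0) + num_cycles S q"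
      using num_cycles_contract[of "insert a S" ?\<pi> a, OF _ pi] insert(1,2) unfolding pa by simp
    have "permutation q" using q insert by (auto simp: permutation_permutes)
    then have "evenperm ?\<pi> = (evenperm q = (a = b))"
      by (auto simp: evenperm_comp permutation_swap_id evenperm_swap)
    then have "sg ?\<pi> = (if b = a then 1 else c) * sg q" using assms(2) by (auto simp: sg_def)
    then show ?thesis unfolding n by (auto simp: mult.commute[of c])
  qed
  have IH: "(\<Sum>\<pi> | \<pi> permutes S. smult (sg \<pi>) (X1 ^ num_cycles S \<pi>)) = (\<Prod>i<card S. [:1 + c * real i, 1:])"
    using insert.IH unfolding sg_def .
  have "(\<Sum>\<pi> | \<pi> permutes insert a S. smult (sg \<pi>) (X1 ^ num_cycles (insert a S) \<pi>))
      = (\<Sum>b\<in>insert a S. \<Sum>q | q permutes S. (if b = a then X1 else [:c:]) * smult (sg q) (X1 ^ num_cycles S q))"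
    unfolding sum_over_permutations_insert[OF insert(1,2)]
    by (intro sum.cong refl step) auto
  also have "\<dots> = (\<Sum>b\<in>insert a S. if b = a then X1 else [:c:]) * (\<Prod>i<card S. [:1 + c * real i, 1:])"
    unfolding sum_distrib_left[symmetric] IH by (simp only: sum_distrib_right)
  also have "(\<Sum>b\<in>insert a S. if b = a then X1 else [:c:]) = X1 + (\<Sum>b\<in>S. [:c:])"
  proof -
    have "(\<Sum>b\<in>S. if b = a then X1 else [:c:]) = (\<Sum>b\<in>S. [:c:])" using insert(2) by (intro sum.cong) auto
    then show ?thesis using insert(1,2) by (simp only: sum.insert if_True simp_thms)
  qed
  also have "\<dots> = [:1 + c * real (card S), 1:]" by (simp add: of_nat_poly)
  finally show ?case using insert by (simp add: sg_def)
qed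

lemma prod_rising_eq_U: "(\<Prod>i<n. [:1 + real i, 1:]) = smult (fact n) (U n)"
proof -
  have "(\<Prod>i<n. [:1 + real i, 1:]) = smult (fact n) (shifted_binomial n 0)"
    by (simp add: shifted_binomial_def add.commute)
  then show ?thesis by (simp add: shifted_binomial_0)
qed

lemma prod_falling_eq_shifted_binomial:
  assumes "1 \<le> n"
  shows "(\<Prod>i<n. [:1 - real i, 1:]) = smult (fact n) (shifted_binomial n (n - 1))"
proof -
  have "(\<Prod>i<n. [:1 - real i, 1:]) = (\<Prod>i<n. [:real i + 1 - real (n - 1), 1:])"
    by (rule prod.reindex_bij_witness[where i = "\<lambda>i. n - 1 - i" and j = "\<lambda>i. n - 1 - i"])
       (use assms in \<open>auto simp: of_nat_diff\<close>)
  then show ?thesis by (simp add: shifted_binomial_def)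
qed

lemma coeff_smult_sum: "coeff (\<Sum>i\<in>A. smult (k i) (X1 ^ v i)) j = (\<Sum>i\<in>A. k i * real (v i choose j))"
  by (simp add: coeff_sum coeff_X1_power)

text \<open>The indicator of an even permutation is the mean of \<open>1\<close> and the sign. For \<open>n \<ge> 2\<close> the
  alternating group has \<open>n! / 2\<close> elements.\<close>

lemma expectation_cycles_alt:
  assumes n: "2 \<le> n"
  shows "measure_pmf.expectation (num_cycles_alt_pmf n) (\<lambda>v. real (v choose j))
       = coeff (U n + shifted_binomial n (n - 1)) j"
proof -
  let ?P = "{\<pi>. \<pi> permutes {1..n}}" and ?A = "carrier (alt_group n)"
  have A: "?A = {\<pi> \<in> ?P. evenperm \<pi>}" by (auto simp: alt_group_carrier)
  have fP: "finite ?P" by (simp add: finite_permutations)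
  have fA: "finite ?A" unfolding A using fP by simp
  have cA: "2 * card ?A = fact n" using alt_group_card_carrier[of n] n by simp
  then have neA: "?A \<noteq> {}" by (metis card.empty fact_nonzero mult_0_right)
  have cA': "real (card ?A) = fact n / 2"
    using arg_cong[OF cA, of real] by simp
  have s1: "(\<Sum>\<pi>\<in>?P. real (num_cycles {1..n} \<pi> choose j)) = fact n * coeff (U n) j"
    using arg_cong[OF sum_permutations_by_cycles[of "{1..n}" 1], of "\<lambda>P. coeff P j"]
    by (simp add: prod_rising_eq_U coeff_sum coeff_X1_power)
  have s2: "(\<Sum>\<pi>\<in>?P. (if evenperm \<pi> then 1 else - 1) * real (num_cycles {1..n} \<pi> choose j))
      = fact n * coeff (shifted_binomial n (n - 1)) j"
    using arg_cong[OF sum_permutations_by_cycles[of "{1..n}" "- 1"], of "\<lambda>P. coeff P j"] n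
    by (simp add: prod_falling_eq_shifted_binomial coeff_smult_sum)
  have "(\<Sum>\<pi>\<in>?A. 2 * real (num_cycles {1..n} \<pi> choose j))
      = (\<Sum>\<pi>\<in>?P. if evenperm \<pi> then 2 * real (num_cycles {1..n} \<pi> choose j) else 0)"
    unfolding A using fP by (subst sum.inter_filter) auto
  also have "\<dots> = (\<Sum>\<pi>\<in>?P. real (num_cycles {1..n} \<pi> choose j)
      + (if evenperm \<pi> then 1 else - 1) * real (num_cycles {1..n} \<pi> choose j))"
    by (intro sum.cong) auto
  also have "\<dots> = fact n * coeff (U n + shifted_binomial n (n - 1)) j"
    unfolding sum.distrib s1 s2 by (simp add: algebra_simps)
  finally have "2 * (\<Sum>\<pi>\<in>?A. real (num_cycles {1..n} \<pi> choose j)) = fact n * coeff (U n + shifted_binomial n (n - 1)) j"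
    unfolding sum_distrib_left .
  then show ?thesis
    unfolding num_cycles_alt_pmf_def integral_map_pmf integral_pmf_of_set[OF neA fA] cA'
    by (simp add: cycles_of_def num_cycles_def field_simps)
qed

lemma is_partition_as_list:
  assumes "is_partition_of \<mu> n"
  shows "\<forall>a\<in>set (sorted_list_of_multiset \<mu>). 1 \<le> a" "sum_list (sorted_list_of_multiset \<mu>) = n"
proof -
  have "a \<noteq> 0" if "a \<in># \<mu>" for a using assms that unfolding is_partition_of_def by metis
  then show "\<forall>a\<in>set (sorted_list_of_multiset \<mu>). 1 \<le> a" by (simp add: Suc_le_eq)
  show "sum_list (sorted_list_of_multiset \<mu>) = n"
    using assms by (metis is_partition_of_def mset_sorted_list_of_multiset sum_mset_sum_list)
qed

lemma list_split_into_blocks: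
  "sum_list as = length xs \<Longrightarrow> \<exists>css. concat css = xs \<and> map length css = as"
proof (induction as arbitrary: xs)
  case (Cons a as)
  have "\<exists>css. concat css = drop a xs \<and> map length css = as" using Cons.prems by (intro Cons.IH) simp
  then obtain css where "concat css = drop a xs" "map length css = as" by blast
  then show ?case using Cons.prems by (intro exI[of _ "take a xs # css"]) auto
qed auto

lemma conj_class_nonempty:
  assumes "is_partition_of \<mu> n"
  shows "conj_class n \<mu> \<noteq> {}"
proof -
  define as where "as = sorted_list_of_multiset \<mu>"
  have as: "\<forall>a\<in>set as. 1 \<le> a" "sum_list as = n" "mset as = \<mu>"
    using is_partition_as_list[OF assms] by (simp_all add: as_def)
  obtain css where css: "concat css = [1..<Suc n]" "map length css = as"
    using list_split_into_blocks[of as "[1..<Suc n]"] as(2) by (auto simp del: upt_Suc)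
  have ne: "[] \<notin> set css" using as(1) css(2) by force
  have R: "set (concat css) = {1..n}" using css(1) by auto
  let ?s = "cyc_prod as [1..<Suc n]"
  have rep: "cycle_rep ?s {1..n} css"
    using cycle_rep_cyc_prod[of css] ne R css by (simp del: upt_Suc)
  have "?s permutes {1..n}"
    using as by (intro cyc_prod_permutes) (auto simp del: upt_Suc)
  moreover have "cycle_type n ?s = \<mu>"
    using cycle_type_cycle_rep[OF rep] as(3) css(2) by (simp add: cycle_type_def cycles_of_def)
  ultimately show ?thesis by (auto simp: conj_class_def sym_group_carrier)
qed

lemma finite_sym_group: "finite (carrier (sym_group n))" "carrier (sym_group n) = {\<pi>. \<pi> permutes {1..n}}"
  by (auto simp: sym_group_def finite_permutations)

lemma finite_conj_class: "finite (conj_class n \<mu>)"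
  unfolding conj_class_def using finite_sym_group(1) by simp

lemma expectation_vertices:
  assumes \<mu>: "is_partition_of \<mu> n"
  shows "measure_pmf.expectation (num_vertices_pmf n \<mu>) (\<lambda>v. real (v choose j))
       = coeff (type_avg (sorted_list_of_multiset \<mu>) \<mu>) j"
proof -
  define as where "as = sorted_list_of_multiset \<mu>"
  have as: "mset as = \<mu>" by (simp add: as_def)
  let ?P = "{\<pi>. \<pi> permutes {1..n}}" and ?K = "conj_class n \<mu>"
  have cP: "card ?P = fact n" by (subst card_permutations[of _ n]) auto
  have ne: "?K \<times> ?P \<noteq> {}" using conj_class_nonempty[OF \<mu>] permutes_id[of "{1..n}"] by blast
  have fin: "finite (?K \<times> ?P)" using finite_conj_class[of n \<mu>] finite_permutations[of "{1..n}"] by simp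
  have K0: "0 < card ?K" using conj_class_nonempty[OF \<mu>] finite_conj_class by (simp add: card_gt_0_iff)
  have inner: "(\<Sum>\<tau>\<in>?P. real (card (vertices n \<sigma> \<tau>) choose j)) = fact n * coeff (type_avg as \<mu>) j" if "\<sigma> \<in> ?K" for \<sigma>
  proof -
    have s: "\<sigma> permutes {1..n}" "mset as = image_mset card (mset_set (orbit \<sigma> ` {1..n}))"
      using that as by (auto simp: conj_class_def sym_group_carrier cycle_type_def cycles_of_def)
    have "(\<Sum>\<tau>\<in>?P. real (card (vertices n \<sigma> \<tau>) choose j))
        = coeff (\<Sum>\<tau>\<in>?P. X1 ^ num_cycles {1..n} (\<sigma> \<circ> \<tau> \<circ> inv \<sigma> \<circ> inv \<tau>)) j"
      unfolding coeff_sum coeff_X1_power by (intro sum.cong refl) (simp add: card_vertices[OF s(1)])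
    also have "\<dots> = fact n * coeff (type_avg as \<mu>) j"
      using sum_commutator_cycles[OF finite_atLeastAtMost s] by (simp only: as coeff_smult card_atLeastAtMost diff_Suc_1)
    finally show ?thesis .
  qed
  have "measure_pmf.expectation (num_vertices_pmf n \<mu>) (\<lambda>v. real (v choose j))
      = (\<Sum>x\<in>?K \<times> ?P. case x of (\<sigma>, \<tau>) \<Rightarrow> real (card (vertices n \<sigma> \<tau>) choose j)) / real (card (?K \<times> ?P))"
    unfolding num_vertices_pmf_def finite_sym_group(2) integral_map_pmf integral_pmf_of_set[OF ne fin]
    by (simp add: case_prod_beta)
  also have "(\<Sum>x\<in>?K \<times> ?P. case x of (\<sigma>, \<tau>) \<Rightarrow> real (card (vertices n \<sigma> \<tau>) choose j))
      = (\<Sum>\<sigma>\<in>?K. \<Sum>\<tau>\<in>?P. real (card (vertices n \<sigma> \<tau>) choose j))"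
    by (rule sum.cartesian_product[symmetric])
  also have "\<dots> = real (card ?K) * (fact n * coeff (type_avg as \<mu>) j)"
    by (subst sum.cong[OF refl inner]) auto
  also have "\<dots> / real (card (?K \<times> ?P)) = coeff (type_avg as \<mu>) j"
    using K0 by (simp add: card_cartesian_product cP del: One_nat_def)
  finally show ?thesis by (simp add: as_def)
qed

section \<open>Elementary symmetric functions of the reciprocals\<close>

lemma coeff_U_Suc: "coeff (U (Suc n)) (Suc j) = coeff (U n) (Suc j) + coeff (U n) j / real (Suc n)"
  by (simp add: U_Suc algebra_simps del: of_nat_Suc)

lemma coeff_U_0: "coeff (U n) 0 = 1"
  by (induction n) (simp_all add: U_Suc del: of_nat_Suc)

lemma coeff_U_nonneg: "0 \<le> coeff (U n) j"
proof (induction n arbitrary: j)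
  case 0
  show ?case by simp
next
  case (Suc n)
  then show ?case by (cases j) (simp_all add: coeff_U_0 coeff_U_Suc)
qed

text \<open>The coefficients of \<open>U n\<close> are the elementary symmetric functions of \<open>1, 1/2, \<dots>, 1/n\<close>. This
  is the amount by which the first two terms of Newton's identity fail to cancel; it is
  governed by the sum of the squares.\<close>

definition newton_defect :: "nat \<Rightarrow> nat \<Rightarrow> real" where
  "newton_defect n j = harm n * coeff (U n) j - real (j + 1) * coeff (U n) (j + 1)"

lemma coeff_U_1: "coeff (U n) 1 = harm n"
  by (induction n)
     (simp_all add: coeff_U_Suc coeff_U_0 harm_Suc harm_def[of 0] divide_inverse del: of_nat_Suc)

lemma newton_defect_0: "newton_defect n 0 = 0"
  using coeff_U_1[of n] by (simp add: newton_defect_def coeff_U_0)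

lemma newton_defect_Suc:
  "newton_defect (Suc n) (Suc j) = newton_defect n (Suc j) + newton_defect n j / real (Suc n)
     + coeff (U n) j / (real (Suc n))\<^sup>2"
proof -
  define a where "a = 1 / real (Suc n)"
  have h: "harm (Suc n) = harm n + a" by (simp add: harm_Suc a_def divide_inverse)
  have u: "coeff (U (Suc n)) (Suc i) = coeff (U n) (Suc i) + coeff (U n) i * a" for i
    by (simp add: coeff_U_Suc a_def del: of_nat_Suc)
  have a2: "coeff (U n) j / (real (Suc n))\<^sup>2 = coeff (U n) j * a * a" "x / real (Suc n) = x * a" for x
    by (simp_all add: a_def power2_eq_square del: of_nat_Suc)
  show ?thesis unfolding newton_defect_def a2 h by (simp add: u algebra_simps)
qed

text \<open>Adding the next reciprocal \<open>a\<close> changes the defect by the defect of lower order times \<open>a\<close>,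
  plus the square term \<open>a\<^sup>2\<close>; both have the right form for induction on \<open>n\<close>.\<close>

lemma newton_defect_bounds_aux:
  "0 \<le> newton_defect n (Suc j) \<and> newton_defect n (Suc j) \<le> (\<Sum>i=1..n. 1 / (real i)\<^sup>2) * coeff (U n) j"
proof (induction n arbitrary: j)
  case 0
  show ?case by (simp add: newton_defect_def harm_def)
next
  case (Suc n)
  define S where "S = (\<Sum>i=1..n. 1 / (real i)\<^sup>2)"
  define a where "a = 1 / real (Suc n)"
  have S: "(\<Sum>i=1..Suc n. 1 / (real i)\<^sup>2) = S + a * a" by (simp add: S_def a_def power2_eq_square)
  have a0: "0 \<le> a" and S0: "0 \<le> S" by (simp_all add: a_def S_def sum_nonneg)
  have e: "newton_defect (Suc n) (Suc j) = newton_defect n (Suc j) + a * newton_defect n j + a * a * coeff (U n) j"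
    by (simp add: newton_defect_Suc a_def power2_eq_square del: of_nat_Suc)
  note IH = Suc.IH[of j, folded S_def]
  show ?case
  proof (cases j)
    case 0
    then show ?thesis unfolding S e using IH a0 by (simp add: newton_defect_0 coeff_U_0)
  next
    case (Suc i)
    note IH' = Suc.IH[of i, folded S_def]
    have u: "coeff (U (Suc n)) j = coeff (U n) j + a * coeff (U n) i"
      using Suc by (simp add: coeff_U_Suc a_def del: of_nat_Suc)
    have "a * newton_defect n j \<le> a * (S * coeff (U n) i)" "0 \<le> a * newton_defect n j"
      using IH' Suc a0 by (auto intro: mult_left_mono)
    moreover have "0 \<le> a * a * coeff (U n) j" "0 \<le> a * a * (a * coeff (U n) i)"
      using a0 coeff_U_nonneg by (auto intro!: mult_nonneg_nonneg)
    ultimately show ?thesis unfolding S e u using IH by (simp add: algebra_simps)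
  qed
qed


text \<open>Comparison with the telescoping sum of \<open>1 / (i - 1) - 1 / i\<close>. The maximum covers the empty
  sum.\<close>

lemma sum_inverse_squares_le: "(\<Sum>i=1..n. 1 / (real i)\<^sup>2) \<le> 2 - 1 / real (max 1 n)"
proof (induction n)
  case (Suc n)
  show ?case
  proof (cases "n = 0")
    case False
    have "1 / (real (Suc n))\<^sup>2 \<le> 1 / (real n * real (Suc n))"
      using False by (intro divide_left_mono) (auto simp: power2_eq_square)
    also have "\<dots> = 1 / real n - 1 / real (Suc n)" using False by (simp add: field_simps)
    finally have "1 / (real (Suc n))\<^sup>2 \<le> 1 / real n - 1 / real (Suc n)" .
    moreover have "max 1 n = n" "max 1 (Suc n) = Suc n" using False by auto
    ultimately show ?thesis using Suc by (simp del: of_nat_Suc)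
  qed simp
qed simp

lemma newton_defect_bounds:
  "0 \<le> newton_defect n (Suc j)" "newton_defect n (Suc j) \<le> 2 * coeff (U n) j" "0 \<le> newton_defect n j"
proof -
  note b = newton_defect_bounds_aux[of n]
  show "0 \<le> newton_defect n (Suc j)" using b by blast
  show "0 \<le> newton_defect n j" using b newton_defect_0[of n] by (cases j) auto
  have "(\<Sum>i=1..n. 1 / (real i)\<^sup>2) \<le> 2"
    using sum_inverse_squares_le[of n] by (rule order_trans) simp
  then have "(\<Sum>i=1..n. 1 / (real i)\<^sup>2) * coeff (U n) j \<le> 2 * coeff (U n) j"
    by (rule mult_right_mono) (rule coeff_U_nonneg)
  then show "newton_defect n (Suc j) \<le> 2 * coeff (U n) j" using b[of j] by linarith
qed

lemma coeff_U_le_harm_power: "coeff (U n) j \<le> harm n ^ j"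
proof (induction j)
  case (Suc j)
  have "coeff (U n) (Suc j) \<le> real (j + 1) * coeff (U n) (Suc j)"
    using coeff_U_nonneg[of n "Suc j"] by (simp add: algebra_simps)
  also have "\<dots> \<le> harm n * coeff (U n) j"
    using newton_defect_bounds(3)[of n j] by (simp add: newton_defect_def)
  also have "\<dots> \<le> harm n * harm n ^ j" using Suc harm_nonneg by (intro mult_left_mono) auto
  finally show ?case by simp
qed (simp add: coeff_U_0)

lemma harm_le_ln_plus_1: "1 \<le> n \<Longrightarrow> harm n \<le> ln (real n) + 1"
proof (induction n rule: dec_induct)
  case base
  show ?case by (simp add: harm_expand)
next
  case (step n)
  have "ln (real n / real (Suc n)) \<le> real n / real (Suc n) - 1"
    using step by (intro ln_le_minus_one) simp
  also have "ln (real n / real (Suc n)) = ln (real n) - ln (real (Suc n))"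
    using step by (simp add: ln_div del: of_nat_Suc)
  also have "real n / real (Suc n) - 1 = - inverse (real (Suc n))" by (simp add: field_simps)
  finally show ?case using step by (simp add: harm_Suc)
qed

lemma ln_le_harm': "1 \<le> n \<Longrightarrow> ln (real n) \<le> harm n"
  using ln_le_harm[of n] ln_mono[of "real n" "real n + 1"] by linarith

lemma gbinomial_step: "real (Suc j) * (x gchoose Suc j) = (x - real j) * (x gchoose j)"
  for x :: real
  using gbinomial_absorb_comp[of x j] gbinomial_absorption[of j x] by simp

lemma gbinomial_le_power:
  fixes x :: real
  assumes "1 \<le> x"
  shows "\<bar>x gchoose j\<bar> \<le> x ^ j"
proof (induction j)
  case (Suc j)
  have "real j * 1 \<le> real j * x" using assms by (intro mult_left_mono) auto
  then have "\<bar>x - real j\<bar> \<le> real (Suc j) * x" using assms by (simp add: algebra_simps)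
  then have "\<bar>x - real j\<bar> * \<bar>x gchoose j\<bar> \<le> real (Suc j) * x * x ^ j"
    using Suc assms by (intro mult_mono) auto
  also have "\<bar>x - real j\<bar> * \<bar>x gchoose j\<bar> = real (Suc j) * \<bar>x gchoose Suc j\<bar>"
    unfolding abs_mult[symmetric] gbinomial_step[symmetric] by (simp add: abs_mult)
  finally have "real (Suc j) * \<bar>x gchoose Suc j\<bar> \<le> real (Suc j) * x ^ Suc j" by (simp add: algebra_simps)
  then show ?case by (rule mult_left_le_imp_le) simp
qed simp

text \<open>The coefficients of \<open>U n\<close> satisfy \<open>(j + 1) * coeff (U n) (j + 1) = harm n * coeff (U n) j -
  newton_defect n j\<close>, and the binomial coefficients of \<open>L = ln n\<close> satisfy the same recursion
  with \<open>L - j\<close> in place of \<open>harm n\<close>. The discrepancy in each step is of order \<open>L ^ j\<close>.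
  Multiplying by \<open>L\<close> states the bound \<open>O(L ^ (j - 1))\<close> without an exception for \<open>j = 0\<close>, where
  the two sides agree.\<close>

lemma coeff_U_near_binomial:
  "\<exists>C\<ge>0. \<forall>n. 1 \<le> ln (real n) \<longrightarrow> \<bar>coeff (U n) j - (ln (real n) gchoose j)\<bar> * ln (real n) \<le> C * ln (real n) ^ j"
proof (induction j)
  case 0
  then show ?case by (intro exI[of _ 0]) (simp add: coeff_U_0)
next
  case (Suc j)
  then obtain C where C: "0 \<le> C" "\<And>n. 1 \<le> ln (real n) \<Longrightarrow>
      \<bar>coeff (U n) j - (ln (real n) gchoose j)\<bar> * ln (real n) \<le> C * ln (real n) ^ j" by blast
  define C' where "C' = 2 ^ j + C + 2 * 2 ^ j + real j"
  have "\<bar>coeff (U n) (Suc j) - (ln (real n) gchoose Suc j)\<bar> * ln (real n) \<le> C' * ln (real n) ^ Suc j"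
    if L: "1 \<le> ln (real n)" for n
  proof -
    define x where "x = ln (real n)"
    define d where "d = coeff (U n) j - (x gchoose j)"
    define d' where "d' = coeff (U n) (Suc j) - (x gchoose Suc j)"
    have x1: "1 \<le> x" using L by (simp add: x_def)
    have n1: "1 \<le> n" using L by (cases n) auto
    have h: "0 \<le> harm n - x" "harm n - x \<le> 1" "harm n \<le> 2 * x"
      using harm_le_ln_plus_1[OF n1] ln_le_harm'[OF n1] x1 by (auto simp: x_def)
    have e: "coeff (U n) i \<le> 2 ^ i * x ^ i" for i
      using coeff_U_le_harm_power[of n i] power_mono[OF h(3), of i] harm_nonneg[of n, where 'a = real]
      by (simp add: power_mult_distrib)
    have D: "newton_defect n j \<le> 2 * 2 ^ j * x ^ j"
    proof (cases j)
      case (Suc i)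
      have "newton_defect n j \<le> 2 * (2 ^ i * x ^ i)"
        unfolding Suc by (rule order_trans[OF newton_defect_bounds(2)]) (use e[of i] in simp)
      also have "\<dots> \<le> 2 * (2 ^ j * x ^ j)"
        using Suc x1 by (intro mult_left_mono mult_mono power_increasing) auto
      finally show ?thesis by simp
    qed (simp add: newton_defect_0)
    have "real (Suc j) * d' = (harm n - x) * coeff (U n) j + x * d - newton_defect n j + real j * (x gchoose j)"
      using gbinomial_step[of j x] by (simp add: d'_def d_def newton_defect_def algebra_simps)
    then have "\<bar>real (Suc j) * d'\<bar> \<le> \<bar>(harm n - x) * coeff (U n) j\<bar> + \<bar>x * d\<bar> + \<bar>newton_defect n j\<bar> + \<bar>real j * (x gchoose j)\<bar>"
      by linarith
    also have "\<bar>(harm n - x) * coeff (U n) j\<bar> \<le> 1 * (2 ^ j * x ^ j)"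
      unfolding abs_mult using h coeff_U_nonneg[of n j] e[of j] by (intro mult_mono) auto
    also have "\<bar>x * d\<bar> \<le> C * x ^ j" using C(2)[OF L] x1 by (simp add: abs_mult x_def d_def mult.commute)
    also have "\<bar>newton_defect n j\<bar> \<le> 2 * 2 ^ j * x ^ j" using D newton_defect_bounds(3)[of n j] by simp
    also have "\<bar>real j * (x gchoose j)\<bar> \<le> real j * x ^ j"
      unfolding abs_mult using gbinomial_le_power[OF x1, of j] by (simp add: mult_left_mono)
    finally have b: "\<bar>real (Suc j) * d'\<bar> \<le> C' * x ^ j" by (simp add: C'_def algebra_simps)
    have "1 * \<bar>d'\<bar> \<le> real (Suc j) * \<bar>d'\<bar>" by (intro mult_right_mono) auto
    then have "\<bar>d'\<bar> \<le> \<bar>real (Suc j) * d'\<bar>" by (simp add: abs_mult)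
    then have "\<bar>d'\<bar> * x \<le> C' * x ^ j * x" using b x1 by (intro mult_right_mono) auto
    then show ?thesis by (simp add: d'_def x_def mult.commute mult.left_commute)
  qed
  moreover have "0 \<le> C'" using C by (simp add: C'_def)
  ultimately show ?case by blast
qed

section \<open>Asymptotics\<close>

text \<open>The parameters of the induction are chosen so that all exponential factors stay bounded:
  \<open>z = 1 / L\<close> with \<open>L = ln n\<close> makes \<open>growth z n\<close> bounded, and \<open>\<theta> = 1 / (K L)\<close> makes
  \<open>exp (\<theta> * harm k) ^ k\<close> bounded, since \<open>\<beta>\<close> has at most \<open>K\<close> cycles. The requirement
  \<open>12 * z * \<kappa> \<le> \<theta>\<close> then amounts to \<open>12 * k * K \<le> n\<close>.\<close>

lemma type_avg_U_distance:
  fixes K :: real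
  assumes part: "is_partition_of \<mu> n" and n: "1 \<le> n" and K: "1 \<le> K" "real (size \<mu>) \<le> K"
    and big: "3 \<le> ln (real n)" "12 * K\<^sup>2 \<le> real n"
  shows "coeff_norm (1 / ln (real n)) (type_avg (sorted_list_of_multiset \<mu>) \<mu> - U n)
     \<le> 16 * source_const * exp 42 * (K\<^sup>2 * (ln (real n))\<^sup>2 / real n)"
proof -
  define L z \<theta> k where "L = ln (real n)" and "z = 1 / L" and "\<theta> = 1 / (K * L)" and "k = size \<mu>"
  define \<kappa> where "\<kappa> = real k / real n"
  define as where "as = sorted_list_of_multiset \<mu>"
  have as: "\<forall>a\<in>set as. 1 \<le> a" "sum_list as = n" "mset as = \<mu>" "sorted as"
    using is_partition_as_list[OF part] by (simp_all add: as_def)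
  have len: "length as = k" using as(3) by (metis k_def size_mset)
  have ne: "as \<noteq> []" using as(2) n by auto
  then have k1: "1 \<le> k" using len by (cases as) auto
  have kn: "k \<le> n"
  proof -
    have "length as \<le> sum_list as" using as(1) by (induction as) auto
    then show ?thesis using len as(2) by simp
  qed
  have L: "3 \<le> L" using big by (simp add: L_def)
  have pos: "0 < L" "0 < K" "0 < real n" "0 < real k" using L K n k1 by auto
  have hk: "harm k \<le> real k" for k
  proof (induction k)
    case (Suc k)
    have "inverse (real (Suc k)) \<le> 1" by (simp add: inverse_le_1_iff)
    then show ?case using Suc by (simp add: harm_Suc)
  qed (simp add: harm_def)
  have hn: "harm n \<le> 2 * L" using harm_le_ln_plus_1[OF n] L by (simp add: L_def)
  have hkn: "harm k \<le> 2 * L" using harm_mono[OF kn, where 'a = real] hn by linarith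
  have z: "0 < z" "z \<le> 1 / 3" using L by (simp_all add: z_def field_simps)
  have \<theta>: "0 < \<theta>" "\<theta> \<le> 1"
    using pos mult_mono[of 1 K 1 L] K L by (simp_all add: \<theta>_def)
  have kK: "real k \<le> K" using K by (simp add: k_def)
  have \<kappa>: "0 < \<kappa>" "12 * z * \<kappa> \<le> \<theta>"
  proof -
    show "0 < \<kappa>" using pos by (simp add: \<kappa>_def)
    have "12 * (real k * K) \<le> 12 * K\<^sup>2" using kK pos by (simp add: power2_eq_square)
    then have "12 * (real k * K) \<le> real n" using big by linarith
    then show "12 * z * \<kappa> \<le> \<theta>" using pos by (simp add: z_def \<kappa>_def \<theta>_def field_simps)
  qed
  have n0: "\<theta> * harm k \<le> z"
  proof -
    have "harm k \<le> K" using hk[of k] kK by linarith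
    then show ?thesis using pos by (simp add: \<theta>_def z_def field_simps)
  qed
  have M: "0 \<notin># \<mu>" "sum_mset \<mu> = sum_list as" using part as(2) by (simp_all add: is_partition_of_def)
  have "coeff_norm z (type_avg as \<mu> - U n) \<le> 4 * source_const * (growth z n)\<^sup>2 * z * harm n * \<kappa> / \<theta> * harm k * growth (18 * z) n
      * exp (\<theta> * harm k) ^ k"
    using conjunct2[OF type_avg_near_U[OF z \<theta> \<kappa> n0 as(4) ne _ _ _ _ M, of n]] as(1,2) len pos
    by (simp add: k_def \<kappa>_def)
  also have "\<dots> \<le> 4 * source_const * (exp 2)\<^sup>2 * 2 * (real k * K * L / real n) * (2 * L) * exp 36 * exp 2"
  proof -
    have zh: "z * harm n \<le> 2" using hn pos by (simp add: z_def field_simps)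
    have g1: "growth z n \<le> exp 2" using growth_le_exp[of z n] z zh by (meson exp_le_cancel_iff less_imp_le order_trans)
    have "18 * z * harm n \<le> 36" using zh by simp
    then have g2: "growth (18 * z) n \<le> exp 36"
      using growth_le_exp[of "18 * z" n] z by (meson exp_le_cancel_iff less_imp_le mult_nonneg_nonneg order_trans zero_le_numeral)
    have "real k * (\<theta> * harm k) \<le> K * (\<theta> * (2 * L))"
      using kK hkn \<theta> pos harm_nonneg[of k, where 'a = real] by (intro mult_mono) auto
    also have "\<dots> = 2" using pos by (simp add: \<theta>_def)
    finally have e: "exp (\<theta> * harm k) ^ k \<le> exp 2" by (simp flip: exp_of_nat_mult)
    have kt: "\<kappa> / \<theta> = real k * K * L / real n" using pos by (simp add: \<kappa>_def \<theta>_def)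
    have Cs0: "0 \<le> source_const" by (simp add: source_const_def)
    note g0 = order_trans[OF zero_le_one growth_ge_1]
    have "4 * source_const * (growth z n)\<^sup>2 * (z * harm n) * (\<kappa> / \<theta>) * harm k * growth (18 * z) n * exp (\<theta> * harm k) ^ k
      \<le> 4 * source_const * (exp 2)\<^sup>2 * 2 * (real k * K * L / real n) * (2 * L) * exp 36 * exp 2"
      unfolding kt using g1 g2 e zh hkn Cs0 pos z g0[of z n] g0[of "18 * z" n] harm_nonneg[of n, where 'a = real] harm_nonneg[of k, where 'a = real]
      by (intro mult_mono power_mono mult_nonneg_nonneg zero_le_power order_refl) simp_all
    then show ?thesis by (simp add: mult.assoc)
  qed
  also have "\<dots> = 16 * source_const * exp 42 * (real k * K * L\<^sup>2 / real n)"
  proof -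
    have e: "(exp 2 :: real)\<^sup>2 * exp 36 * exp 2 = exp 42" by (simp flip: exp_add exp_of_nat_mult add: power2_eq_square)
    show ?thesis unfolding e[symmetric] by (simp add: power2_eq_square)
  qed
  also have "\<dots> \<le> 16 * source_const * exp 42 * (K\<^sup>2 * L\<^sup>2 / real n)"
    using kK pos by (intro mult_left_mono divide_right_mono mult_right_mono) (auto simp: power2_eq_square source_const_def)
  finally show ?thesis by (simp add: L_def z_def as_def)
qed

lemma coeff_le_of_coeff_norm:
  assumes "0 < x" "coeff_norm (1 / x) P \<le> B"
  shows "\<bar>coeff P j\<bar> \<le> B * x ^ j"
proof -
  have "\<bar>coeff P j\<bar> * (1 / x) ^ j \<le> B" using coeff_le_coeff_norm[of "1 / x" P j] assms by simp
  then show ?thesis using assms(1) by (simp add: power_divide divide_le_eq)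
qed

text \<open>This polynomial is the sign-weighted average of \<open>(1 + X) ^ C\<close> over all permutations.\<close>

lemma coeff_norm_shifted_binomial_top:
  assumes n: "2 \<le> n" and L: "3 \<le> ln (real n)"
  shows "coeff_norm (1 / ln (real n)) (shifted_binomial n (n - 1)) \<le> exp 4 / real n"
proof -
  define z where "z = 1 / ln (real n)"
  obtain m where m: "n = Suc m" "1 \<le> m" using n by (cases n) auto
  have z: "0 \<le> z" "z \<le> 1" using L by (simp_all add: z_def)
  have "harm m \<le> (harm n :: real)" using m by (intro harm_mono) simp
  also have "\<dots> \<le> 2 * ln (real n)" using harm_le_ln_plus_1[of n] n L by simp
  finally have "z * harm m \<le> 2" using L by (simp add: z_def field_simps)
  then have "growth z m \<le> exp 2" using growth_le_exp[OF z(1), of m] by (meson exp_le_cancel_iff order_trans)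
  then have "(growth z m)\<^sup>2 \<le> (exp 2)\<^sup>2" using growth_ge_1[OF z(1), of m] by (intro power_mono) auto
  also have "(exp 2 :: real)\<^sup>2 = exp 4" by (simp flip: exp_of_nat_mult exp_add add: power2_eq_square)
  finally have g: "z * (growth z m)\<^sup>2 \<le> 1 * exp 4" using z by (intro mult_mono) auto
  have "coeff_norm z (shifted_binomial (Suc m) m) \<le> z * (growth z m)\<^sup>2 / (real m * real (Suc m choose m))"
    using m(2) z by (intro coeff_norm_shifted_binomial) auto
  also have "Suc m choose m = Suc m" by (metis binomial_Suc_n)
  also have "z * (growth z m)\<^sup>2 / (real m * real (Suc m)) \<le> exp 4 / (1 * real (Suc m))"
    using g m(2) z by (intro frac_le mult_right_mono) auto
  finally show ?thesis using m by (simp add: z_def)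
qed

theorem theorem1p2:
  fixes \<alpha> \<epsilon> :: real and \<mu> :: "nat \<Rightarrow> nat multiset" and p :: "real poly" and l :: nat
  assumes "0 \<le> \<alpha>" and "\<alpha> < 1/2"
    and "\<And>n. n \<ge> 1 \<Longrightarrow> is_partition_of (\<mu> n) n"
    and "\<And>n. n \<ge> 1 \<Longrightarrow> real (size (\<mu> n)) \<le> real n powr \<alpha>"
    and "degree p = l"
    and "mono_on {0..} (poly p)"
    and "\<And>x. x \<ge> 0 \<Longrightarrow> poly p x \<ge> 0"
    and "\<epsilon> > 0" and "\<alpha> + \<epsilon> < 1/2"
  shows "(\<exists>f :: nat \<Rightarrow> real.
            f \<in> O(\<lambda>n. ln (real n) ^ l / real n powr (1 - 2 * \<alpha> - 2 * \<epsilon>)) \<and>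
            (\<forall>n\<ge>1. measure_pmf.expectation (num_vertices_pmf n (\<mu> n)) (\<lambda>v. poly p (real v)) =
                    measure_pmf.expectation (num_cycles_alt_pmf n) (\<lambda>c. poly p (real c)) + f n))
       \<and> (\<exists>g h :: nat \<Rightarrow> real.
            g \<in> O(\<lambda>n. ln (real n) powi (int l - 1)) \<and>
            h \<in> O(\<lambda>n. ln (real n) ^ l / real n powr (1 - 2 * \<alpha> - 2 * \<epsilon>)) \<and>
            (\<forall>n\<ge>1. measure_pmf.expectation (num_vertices_pmf n (\<mu> n)) (\<lambda>v. poly p (real v)) =
                    poly p (ln (real n)) + g n + h n))"
proof -
  let ?EV = "\<lambda>n. measure_pmf.expectation (num_vertices_pmf n (\<mu> n)) (\<lambda>v. poly p (real v))"
  let ?EA = "\<lambda>n. measure_pmf.expectation (num_cycles_alt_pmf n) (\<lambda>v. poly p (real v))"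
  let ?N = "\<lambda>n. real n powr (1 - 2 * \<alpha> - 2 * \<epsilon>)"
  define L where "L = (\<lambda>n :: nat. ln (real n))"
  obtain c where c: "\<And>x. poly p x = (\<Sum>j\<le>l. c j * (x gchoose j))"
    using poly_binomial_basis[of p l] assms(5) by auto
  \<comment> \<open>the expectation of \<open>p\<close> at the number of cycles of a uniform permutation in \<open>S_n\<close>\<close>
  define S where "S = (\<lambda>n. \<Sum>j\<le>l. c j * coeff (U n) j)"
  define R where "R = (\<lambda>n. type_avg (sorted_list_of_multiset (\<mu> n)) (\<mu> n) - U n)"
  have EV: "?EV n - S n = (\<Sum>j\<le>l. c j * coeff (R n) j)" if n: "1 \<le> n" for n
  proof -
    have fin: "finite (set_pmf (num_vertices_pmf n (\<mu> n)))"
    proof -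
      have "conj_class n (\<mu> n) \<times> carrier (sym_group n) \<noteq> {}"
        using conj_class_nonempty[OF assms(3)[OF n]] permutes_id[of "{1..n}"]
        unfolding finite_sym_group(2) by blast
      then show ?thesis unfolding num_vertices_pmf_def
        using finite_conj_class finite_sym_group(1) by simp
    qed
    show ?thesis
      unfolding expectation_binomial_basis[OF fin c] expectation_vertices[OF assms(3)[OF n]] S_def R_def
      by (simp add: sum_subtractf[symmetric] algebra_simps)
  qed
  have EA: "?EA n - S n = (\<Sum>j\<le>l. c j * coeff (shifted_binomial n (n - 1)) j)" if n: "2 \<le> n" for n
  proof -
    have fin: "finite (set_pmf (num_cycles_alt_pmf n))"
    proof -
      have "id \<in> carrier (alt_group n)" by (simp add: alt_group_carrier evenperm_id permutes_id)
      moreover have "finite (carrier (alt_group n))"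
        using finite_permutations[of "{1..n}"] by (rule rev_finite_subset) (auto simp: alt_group_carrier)
      ultimately have "finite (carrier (alt_group n))" "carrier (alt_group n) \<noteq> {}" by auto
      then show ?thesis unfolding num_cycles_alt_pmf_def by simp
    qed
    show ?thesis
      unfolding expectation_binomial_basis[OF fin c] expectation_cycles_alt[OF n] S_def
      by (simp add: sum_subtractf[symmetric] algebra_simps)
  qed
  define CC where "CC = (\<Sum>j\<le>l. \<bar>c j\<bar>)"
  have sum_bound: "\<bar>\<Sum>j\<le>l. c j * coeff P j\<bar> \<le> CC * (B * x ^ l)"
    if "1 \<le> x" "coeff_norm (1 / x) P \<le> B" for x B P
  proof -
    have B0: "0 \<le> B" using coeff_norm_nonneg[of "1 / x" P] that by simp
    have "\<bar>\<Sum>j\<le>l. c j * coeff P j\<bar> \<le> (\<Sum>j\<le>l. \<bar>c j\<bar> * \<bar>coeff P j\<bar>)"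
      by (rule order_trans[OF sum_abs]) (simp add: abs_mult)
    also have "\<dots> \<le> (\<Sum>j\<le>l. \<bar>c j\<bar> * (B * x ^ l))"
    proof (intro sum_mono mult_left_mono)
      fix j assume "j \<in> {..l}"
      then have "B * x ^ j \<le> B * x ^ l" using that(1) B0 by (intro mult_left_mono power_increasing) auto
      then show "\<bar>coeff P j\<bar> \<le> B * x ^ l" using coeff_le_of_coeff_norm[of x P B j] that by linarith
    qed simp
    finally show ?thesis by (simp add: CC_def sum_distrib_right)
  qed
  have sq: "(real n powr a)\<^sup>2 = real n powr (2 * a)" for n a
    by (simp add: power2_eq_square powr_add[symmetric])
  have ev3: "eventually (\<lambda>n. 3 \<le> L n) sequentially" unfolding L_def by real_asymp
  have evK: "eventually (\<lambda>n. 12 * (real n powr \<alpha>)\<^sup>2 \<le> real n) sequentially"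
  proof -
    have "eventually (\<lambda>n. 12 * real n powr (2 * \<alpha>) \<le> real n) sequentially"
      using assms(2) by real_asymp
    then show ?thesis unfolding sq .
  qed
  have ev2: "eventually (\<lambda>n :: nat. 2 \<le> n) sequentially" by (rule eventually_ge_at_top)
  \<comment> \<open>an error \<open>1 / n\<close> is smaller than the one allowed\<close>
  have N1: "inverse (real n) \<le> inverse (?N n)" if "1 \<le> n" for n
  proof -
    have "?N n \<le> real n powr 1" using that assms(1,8) by (intro powr_mono) auto
    then show ?thesis using that by (intro le_imp_inverse_le) auto
  qed
  have h: "(\<lambda>n. ?EV n - S n) \<in> O(\<lambda>n. L n ^ l / ?N n)"
  proof (rule bigoI)
    show "eventually (\<lambda>n. norm (?EV n - S n) \<le> (CC * (16 * source_const * exp 42 / \<epsilon>\<^sup>2)) * norm (L n ^ l / ?N n)) sequentially"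
      using ev3 evK ev2
    proof eventually_elim
      case (elim n)
      define K where "K = real n powr \<alpha>"
      have n: "1 \<le> n" "1 \<le> real n" "0 < real n" using elim by auto
      have K1: "1 \<le> K" using n assms(1) unfolding K_def by (simp add: ge_one_powr_ge_zero)
      have "L n \<le> real n powr \<epsilon> / \<epsilon>" unfolding L_def using ln_powr_bound[OF n(2) assms(8)] .
      then have "(L n)\<^sup>2 \<le> (real n powr \<epsilon> / \<epsilon>)\<^sup>2" using elim by (intro power_mono) auto
      then have "K\<^sup>2 * (L n)\<^sup>2 / real n \<le> K\<^sup>2 * (real n powr \<epsilon> / \<epsilon>)\<^sup>2 / real n"
        using n by (intro divide_right_mono mult_left_mono) auto
      also have "\<dots> = (real n powr (2 * \<alpha>) * real n powr (2 * \<epsilon>) / real n powr 1) / \<epsilon>\<^sup>2"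
        using n by (simp add: K_def power_divide sq)
      also have "real n powr (2 * \<alpha>) * real n powr (2 * \<epsilon>) / real n powr 1 = 1 / ?N n"
        unfolding powr_add[symmetric] powr_diff[symmetric]
        by (simp add: powr_minus_divide[symmetric] algebra_simps)
      finally have B: "K\<^sup>2 * (L n)\<^sup>2 / real n \<le> 1 / ?N n / \<epsilon>\<^sup>2" .
      have Cs0: "0 \<le> 16 * source_const * exp 42" by (simp add: source_const_def)
      have "coeff_norm (1 / L n) (R n) \<le> 16 * source_const * exp 42 * (K\<^sup>2 * (L n)\<^sup>2 / real n)"
        unfolding R_def L_def
        using type_avg_U_distance[OF assms(3)[OF n(1)] n(1) K1] assms(4)[OF n(1)] elim by (simp add: K_def L_def)
      also have "\<dots> \<le> 16 * source_const * exp 42 * (1 / ?N n / \<epsilon>\<^sup>2)" using B Cs0 by (rule mult_left_mono)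
      finally have "\<bar>?EV n - S n\<bar> \<le> CC * (16 * source_const * exp 42 * (1 / ?N n / \<epsilon>\<^sup>2) * L n ^ l)"
        unfolding EV[OF n(1)] using elim by (intro sum_bound) auto
      moreover have "norm (L n ^ l / ?N n) = L n ^ l / ?N n"
        unfolding real_norm_def by (rule abs_of_nonneg) (use elim in simp)
      ultimately show ?case by (simp only: real_norm_def) (simp add: field_simps)
    qed
  qed
  have a: "(\<lambda>n. ?EA n - S n) \<in> O(\<lambda>n. L n ^ l / ?N n)"
  proof (rule bigoI)
    show "eventually (\<lambda>n. norm (?EA n - S n) \<le> (CC * exp 4) * norm (L n ^ l / ?N n)) sequentially"
      using ev3 ev2
    proof eventually_elim
      case (elim n)
      have "coeff_norm (1 / L n) (shifted_binomial n (n - 1)) \<le> exp 4 * inverse (real n)"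
        using coeff_norm_shifted_binomial_top[of n] elim by (simp add: L_def divide_inverse)
      also have "\<dots> \<le> exp 4 * inverse (?N n)" using N1[of n] elim by simp
      finally have "\<bar>?EA n - S n\<bar> \<le> CC * (exp 4 * inverse (?N n) * L n ^ l)"
        unfolding EA[OF elim(2)] using elim by (intro sum_bound) auto
      moreover have "norm (L n ^ l / ?N n) = L n ^ l / ?N n"
        unfolding real_norm_def by (rule abs_of_nonneg) (use elim in simp)
      ultimately show ?case by (simp only: real_norm_def) (simp add: field_simps)
    qed
  qed
  have g: "(\<lambda>n. S n - poly p (L n)) \<in> O(\<lambda>n. L n powi (int l - 1))"
  proof -
    have "\<forall>j. \<exists>C\<ge>0. \<forall>n. 1 \<le> L n \<longrightarrow> \<bar>coeff (U n) j - (L n gchoose j)\<bar> * L n \<le> C * L n ^ j"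
      using coeff_U_near_binomial unfolding L_def by blast
    then obtain D where D: "\<And>j. 0 \<le> D j"
      "\<And>j n. 1 \<le> L n \<Longrightarrow> \<bar>coeff (U n) j - (L n gchoose j)\<bar> * L n \<le> D j * L n ^ j" by metis
    show ?thesis
    proof (rule bigoI)
      show "eventually (\<lambda>n. norm (S n - poly p (L n)) \<le> (\<Sum>j\<le>l. \<bar>c j\<bar> * D j) * norm (L n powi (int l - 1))) sequentially"
        using ev3
      proof eventually_elim
        case (elim n)
        define x where "x = L n"
        have x: "1 \<le> x" "0 < x" using elim by (simp_all add: x_def)
        have "\<bar>S n - poly p x\<bar> = \<bar>\<Sum>j\<le>l. c j * (coeff (U n) j - (x gchoose j))\<bar>"
          by (simp add: S_def c sum_subtractf[symmetric] algebra_simps)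
        also have "\<dots> \<le> (\<Sum>j\<le>l. \<bar>c j\<bar> * \<bar>coeff (U n) j - (x gchoose j)\<bar>)"
          by (rule order_trans[OF sum_abs]) (simp add: abs_mult)
        finally have "\<bar>S n - poly p x\<bar> * x \<le> (\<Sum>j\<le>l. \<bar>c j\<bar> * \<bar>coeff (U n) j - (x gchoose j)\<bar>) * x"
          using x by (intro mult_right_mono) auto
        also have "\<dots> = (\<Sum>j\<le>l. \<bar>c j\<bar> * (\<bar>coeff (U n) j - (x gchoose j)\<bar> * x))"
          by (simp add: sum_distrib_right mult.assoc)
        also have "\<dots> \<le> (\<Sum>j\<le>l. \<bar>c j\<bar> * (D j * x ^ l))"
        proof (intro sum_mono mult_left_mono)
          fix j assume "j \<in> {..l}"
          then have "D j * x ^ j \<le> D j * x ^ l" using x D(1) by (intro mult_left_mono power_increasing) auto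
          then show "\<bar>coeff (U n) j - (x gchoose j)\<bar> * x \<le> D j * x ^ l"
            using D(2)[of n j] x by (simp add: x_def)
        qed simp
        also have "\<dots> = (\<Sum>j\<le>l. \<bar>c j\<bar> * D j) * x ^ l" by (simp add: sum_distrib_right mult.assoc)
        finally have "\<bar>S n - poly p x\<bar> \<le> (\<Sum>j\<le>l. \<bar>c j\<bar> * D j) * x ^ l / x" using x by (simp add: le_divide_eq)
        moreover have "x powi (int l - 1) = x ^ l / x" using x by (simp add: power_int_diff)
        ultimately show ?case using x by (simp add: x_def)
      qed
    qed
  qed
  show ?thesis
  proof (intro conjI exI)
    have "(\<lambda>n. (?EV n - S n) - (?EA n - S n)) \<in> O(\<lambda>n. L n ^ l / ?N n)"
      using h a by (rule sum_in_bigo)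
    then show "(\<lambda>n. ?EV n - ?EA n) \<in> O(\<lambda>n. ln (real n) ^ l / ?N n)" by (simp add: L_def)
    show "(\<lambda>n. S n - poly p (L n)) \<in> O(\<lambda>n. ln (real n) powi (int l - 1))" using g by (simp add: L_def)
    show "(\<lambda>n. ?EV n - S n) \<in> O(\<lambda>n. ln (real n) ^ l / ?N n)" using h by (simp add: L_def)
  qed (auto simp: L_def)
qed

end
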